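(* Let $\Lambda\subseteq\mathbb{R}^d$ and suppose there are a cut-and-project scheme $(\mathbb{R}^d,H,\mathcal{L})$, a point $x\in\mathbb{R}^d\times H$, a non-empty open $U\subseteq H$ and a compact $W\subseteq H$ with $U\subseteq W$ such that $\Lambda_U(x)\subseteq\Lambda\subseteq\Lambda_W(x)$. Then there exist a cut-and-project scheme $(\mathbb{R}^d,H',\mathcal{L}')$ with second countable $H'$ and injective $\star$-map, and a relatively compact Borel measurable set $W'\subseteq H'$ with non-empty interior, such that $\Lambda=\pi^{\mathbb{R}^d}(\mathcal{L}'\cap(\mathbb{R}^d\times W'))$; i.e. $\Lambda$ is a model set. If moreover $W\setminus U$ has Haar measure zero, then $W'$ can be chosen measure-theoretically regular, so that $\Lambda$ is a regular model set. In particular, every translate of an inter model set in $\mathbb{R}^d$ is a model set, and every translate of an inter regular model set in $\mathbb{R}^d$ is a regular model set.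
   Context: A cut-and-project scheme $(G,H,\mathcal{L})$ consists of locally compact abelian groups $G,H$ and a discrete cocompact subgroup $\mathcal{L}\subseteq G\times H$ such that $\pi^G|_{\mathcal{L}}$ is injective and $\pi^H(\mathcal{L})$ is dense in $H$. The $\star$-map is $x^\star=\pi^H((\pi^G|_{\mathcal{L}})^{-1}(x))$ on $\pi^G(\mathcal{L})$; it is injective if $\pi^H|_{\mathcal L}$ is injective. For $W\subseteq H$ and $x\in G\times H$, $\Lambda_W(x)=\pi^G((x+\mathcal{L})\cap(G\times W))$ and $\Lambda_W=\Lambda_W(0)$. A model set is a set $\Lambda_W$ (in some cut-and-project scheme) with $W$ relatively compact, Borel measurable, with non-empty interior; it is a regular model set if in addition $\partial W=\overline W\setminus W^\circ$ has Haar measure zero (measure-theoretic regularity). An inter (regular) model set is a set $\Gamma\subseteq G$ with $\Lambda_{W^\circ}\subseteq\Gamma\subseteq\Lambda_{\overline W}$ for some cut-and-project scheme and some window $W$ as in the definition of a (regular) model set. *)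

theory Defs
  imports "HOL-Analysis.Analysis" "HOL-Probability.Probability"
begin

definition lca_group :: "'a topology \<Rightarrow> ('a \<Rightarrow> 'a \<Rightarrow> 'a) \<Rightarrow> 'a \<Rightarrow> ('a \<Rightarrow> 'a) \<Rightarrow> bool" where
  "lca_group T f z n \<longleftrightarrow>
     (\<forall>x\<in>topspace T. \<forall>y\<in>topspace T. f x y \<in> topspace T) \<and>
     z \<in> topspace T \<and> (\<forall>x\<in>topspace T. n x \<in> topspace T) \<and>
     (\<forall>x\<in>topspace T. \<forall>y\<in>topspace T. \<forall>w\<in>topspace T. f (f x y) w = f x (f y w)) \<and>
     (\<forall>x\<in>topspace T. \<forall>y\<in>topspace T. f x y = f y x) \<and>
     (\<forall>x\<in>topspace T. f z x = x) \<and>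
     (\<forall>x\<in>topspace T. f (n x) x = z) \<and>
     continuous_map (prod_topology T T) T (\<lambda>p. f (fst p) (snd p)) \<and>
     continuous_map T T n \<and>
     Hausdorff_space T \<and> locally_compact_space T"

definition borel_of :: "'a topology \<Rightarrow> 'a measure" where
  "borel_of T = sigma (topspace T) {U. openin T U}"

definition haar_measure :: "'a topology \<Rightarrow> ('a \<Rightarrow> 'a \<Rightarrow> 'a) \<Rightarrow> 'a measure \<Rightarrow> bool" where
  "haar_measure T f \<mu> \<longleftrightarrow>
     space \<mu> = topspace T \<and> sets \<mu> = sets (borel_of T) \<and>
     (\<forall>g\<in>topspace T. \<forall>A\<in>sets \<mu>. emeasure \<mu> (f g ` A) = emeasure \<mu> A) \<and>
     (\<forall>K. compactin T K \<longrightarrow> emeasure \<mu> K < \<infinity>) \<and>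
     (\<forall>V. openin T V \<and> V \<noteq> {} \<longrightarrow> emeasure \<mu> V > 0) \<and>
     (\<forall>A\<in>sets \<mu>. emeasure \<mu> A = (INF V\<in>{V. openin T V \<and> A \<subseteq> V}. emeasure \<mu> V)) \<and>
     (\<forall>V. openin T V \<longrightarrow> emeasure \<mu> V = (SUP K\<in>{K. compactin T K \<and> K \<subseteq> V}. emeasure \<mu> K))"

definition padd :: "('a \<Rightarrow> 'a \<Rightarrow> 'a) \<Rightarrow> ('g::euclidean_space \<times> 'a) \<Rightarrow> ('g \<times> 'a) \<Rightarrow> ('g \<times> 'a)" where
  "padd f p q = (fst p + fst q, f (snd p) (snd q))"

definition ptop :: "'a topology \<Rightarrow> ('g::euclidean_space \<times> 'a) topology" where
  "ptop T = prod_topology euclidean T"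

text \<open>Cut-and-project scheme (G, H, L) with G = 'g (a euclidean space, i.e. R^d) and
  H = (T, f, z, n): L a discrete cocompact subgroup of G \<times> H, fst injective on L,
  snd ` L dense in H.  Cocompact: the quotient space (G \<times> H)/L with the quotient topology
  is compact.\<close>
definition cp_scheme ::
  "'a topology \<Rightarrow> ('a \<Rightarrow> 'a \<Rightarrow> 'a) \<Rightarrow> 'a \<Rightarrow> ('a \<Rightarrow> 'a) \<Rightarrow> ('g::euclidean_space \<times> 'a) set \<Rightarrow> bool" where
  "cp_scheme T f z n L \<longleftrightarrow>
     lca_group T f z n \<and>
     L \<subseteq> UNIV \<times> topspace T \<and>
     (0, z) \<in> L \<and> (\<forall>p\<in>L. \<forall>q\<in>L. padd f p q \<in> L) \<and> (\<forall>p\<in>L. (- fst p, n (snd p)) \<in> L) \<and>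
     (\<forall>p\<in>L. \<exists>V. openin (ptop T) V \<and> V \<inter> L = {p}) \<and>
     (\<exists>Y :: ('g \<times> 'a) set topology.
        quotient_map (ptop T) Y (\<lambda>p. padd f p ` L) \<and> compact_space Y) \<and>
     inj_on fst L \<and>
     T closure_of (snd ` L) = topspace T"

definition star_map :: "('g \<times> 'a) set \<Rightarrow> 'g \<Rightarrow> 'a" where
  "star_map L x = snd (THE p. p \<in> L \<and> fst p = x)"

definition cp_set :: "('a \<Rightarrow> 'a \<Rightarrow> 'a) \<Rightarrow> ('g::euclidean_space \<times> 'a) set \<Rightarrow> 'a set \<Rightarrow> ('g \<times> 'a) \<Rightarrow> 'g set" where
  "cp_set f L W x = fst ` {q \<in> padd f x ` L. snd q \<in> W}"

definition boundary_in :: "'a topology \<Rightarrow> 'a set \<Rightarrow> 'a set" where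
  "boundary_in T W = (T closure_of W) - (T interior_of W)"

definition model_set_witness ::
  "'g::euclidean_space set \<Rightarrow> 'k topology \<Rightarrow> ('k \<Rightarrow> 'k \<Rightarrow> 'k) \<Rightarrow> 'k \<Rightarrow> ('k \<Rightarrow> 'k)
     \<Rightarrow> ('g \<times> 'k) set \<Rightarrow> 'k set \<Rightarrow> bool" where
  "model_set_witness Lam T f z n L W \<longleftrightarrow>
     cp_scheme T f z n L \<and> second_countable T \<and> inj_on (star_map L) (fst ` L) \<and>
     W \<subseteq> topspace T \<and> compactin T (T closure_of W) \<and> W \<in> sets (borel_of T) \<and>
     T interior_of W \<noteq> {} \<and>
     Lam = fst ` (L \<inter> (UNIV \<times> W))"

end

theory Submission
  imports Defs
begin

text \<open>Write \<open>x = (s, t)\<close>; translating the windows by \<open>-t\<close> gives \<open>t = 0\<close>. If the star map is injective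
  and \<open>s = 0\<close>, then \<open>W' = U \<union> \<Lambda>\<^sup>\<star>\<close> is the required window, because it adds only countably many points
  to \<open>U\<close>. This situation is reached by changing the scheme four times. First, \<open>H\<close> is replaced by an
  open \<open>\<sigma>\<close>-compact subgroup containing the window, which makes the lattice countable. Second, this
  subgroup is divided by a compact subgroup with second countable quotient that is so small that the
  window is distorted only by a null set. Third, \<open>s\<close> is adjoined to the lattice, with \<open>H\<close> replaced by
  the quotient of \<open>H \<times> \<int>\<close> by the relations between \<open>s\<close> and the lattice, and the window is moved to
  height \<open>1\<close>. Fourth, if the star map has a kernel, \<open>H\<close> is replaced by \<open>H \<times> \<real>/\<int>\<close>, and \<open>l\<close> is sent to
  \<open>(l\<^sup>\<star>, a \<bullet> l mod 1)\<close> for a vector \<open>a\<close> with \<open>a \<bullet> l\<close> irrational for all lattice vectors \<open>l \<noteq> 0\<close>. Haar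
  measures are pushed forward along these constructions, through a fundamental domain when the
  subgroup divided out is countable; regularity is recovered at the end from second countability.\<close>

section \<open>Locally compact abelian groups\<close>

text \<open>The order of the changes matters. Countability of the lattice comes first: lattice
  translates supply the base of the second countable quotient, \<open>a\<close> can avoid only
  countably many hyperplanes, and the points added to \<open>U\<close> must form a Borel set.
  Dividing out a compact subgroup may create new elements in the kernel of the star map, so
  injectivity is repaired last.

  A quotient by \<open>N\<close> replaces \<open>W\<close> by its saturation and forces
  \<open>U\<close> to shrink to a saturated set. No single neighbourhood of the identity makes the
  loss null, hence sequences of approximations and a subgroup that is an intersection of countably
  many neighbourhoods.

  Adjoining \<open>s\<close> by a plain product with \<int> would fail if a nonzero multiple of
  \<open>s\<close> is already the first coordinate of a lattice point: one vector would then carry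
  two internal coordinates. Dividing by the relations removes this.

  Density of the lattice after adding the circle is drawn from multiples of a nonzero kernel
  element, whence the case distinction in the fourth change. All groups built on the way must fit
  into one type fixed in advance, which dictates how quotients are encoded.\<close>

lemma ex_quotient_map: "\<exists>Y. quotient_map X Y q"
proof -
  let ?P = "\<lambda>U. U \<subseteq> q ` topspace X \<and> openin X {x \<in> topspace X. q x \<in> U}"
  have "istopology ?P"
    unfolding istopology_def
  proof (intro conjI allI impI)
    fix A B assume "?P A" "?P B"
    moreover have "{x \<in> topspace X. q x \<in> A \<inter> B} = {x \<in> topspace X. q x \<in> A} \<inter> {x \<in> topspace X. q x \<in> B}" by auto
    ultimately show "A \<inter> B \<subseteq> q ` topspace X" "openin X {x \<in> topspace X. q x \<in> A \<inter> B}"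
      by (auto simp del: Int_iff)
  next
    fix \<K> assume K: "\<forall>K\<in>\<K>. ?P K"
    have "{x \<in> topspace X. q x \<in> \<Union>\<K>} = (\<Union>A\<in>\<K>. {x \<in> topspace X. q x \<in> A})" by auto
    with K show "openin X {x \<in> topspace X. q x \<in> \<Union>\<K>}" by auto
  qed auto
  then have op: "openin (topology ?P) = ?P" by (rule topology_inverse')
  have "{x \<in> topspace X. q x \<in> q ` topspace X} = topspace X" by auto
  then have "topspace (topology ?P) = q ` topspace X"
    unfolding topspace_def[of "topology ?P"] op by (auto intro!: exI[of _ "q ` topspace X"])
  then have "quotient_map X (topology ?P) q"
    unfolding quotient_map_def op by auto
  then show ?thesis by blast
qed

lemma compactin_subcover:
  assumes "compactin X K" "\<And>i. i \<in> I \<Longrightarrow> openin X (V i)" "K \<subseteq> (\<Union>i\<in>I. V i)"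
  obtains F where "finite F" "F \<subseteq> I" "K \<subseteq> (\<Union>i\<in>F. V i)"
proof -
  have "\<forall>U\<in>V ` I. openin X U" using assms(2) by blast
  with assms(1,3) have "\<exists>\<F>. finite \<F> \<and> \<F> \<subseteq> V ` I \<and> K \<subseteq> \<Union>\<F>"
    unfolding compactin_def by simp
  then obtain \<F> where "finite \<F>" "\<F> \<subseteq> V ` I" "K \<subseteq> \<Union>\<F>" by blast
  then show ?thesis using that by (metis finite_subset_image)
qed

locale lca =
  fixes T :: "'a topology" and f :: "'a \<Rightarrow> 'a \<Rightarrow> 'a" (infixl "\<oplus>" 65) and z :: 'a and n :: "'a \<Rightarrow> 'a"
  assumes lca_group: "lca_group T f z n"
begin

abbreviation H where "H \<equiv> topspace T"

lemma add_closed [simp]: "x \<in> H \<Longrightarrow> y \<in> H \<Longrightarrow> x \<oplus> y \<in> H"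
  and zero_closed [simp]: "z \<in> H"
  and neg_closed [simp]: "x \<in> H \<Longrightarrow> n x \<in> H"
  and assoc: "x \<in> H \<Longrightarrow> y \<in> H \<Longrightarrow> w \<in> H \<Longrightarrow> x \<oplus> y \<oplus> w = x \<oplus> (y \<oplus> w)"
  and comm: "x \<in> H \<Longrightarrow> y \<in> H \<Longrightarrow> x \<oplus> y = y \<oplus> x"
  and zero_left [simp]: "x \<in> H \<Longrightarrow> z \<oplus> x = x"
  and neg_left [simp]: "x \<in> H \<Longrightarrow> n x \<oplus> x = z"
  and continuous_add': "continuous_map (prod_topology T T) T (\<lambda>p. fst p \<oplus> snd p)"
  and continuous_neg': "continuous_map T T n"
  and hausdorff: "Hausdorff_space T"
  and locally_compact: "locally_compact_space T"
  using lca_group unfolding lca_group_def by blast+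

lemma zero_right [simp]: "x \<in> H \<Longrightarrow> x \<oplus> z = x"
  by (metis comm zero_left zero_closed)

lemma neg_right [simp]: "x \<in> H \<Longrightarrow> x \<oplus> n x = z"
  by (metis comm neg_left neg_closed)

lemma lcomm: "x \<in> H \<Longrightarrow> y \<in> H \<Longrightarrow> w \<in> H \<Longrightarrow> x \<oplus> (y \<oplus> w) = y \<oplus> (x \<oplus> w)"
  by (metis assoc comm)

lemmas ac = assoc comm lcomm

lemma cancel [simp]:
  "x \<in> H \<Longrightarrow> y \<in> H \<Longrightarrow> n x \<oplus> (x \<oplus> y) = y"
  "x \<in> H \<Longrightarrow> y \<in> H \<Longrightarrow> x \<oplus> (n x \<oplus> y) = y"
  by (metis assoc neg_closed neg_left neg_right zero_left)+

lemma cancel_right [simp]: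
  "x \<in> H \<Longrightarrow> y \<in> H \<Longrightarrow> x \<oplus> y \<oplus> n y = x"
  "x \<in> H \<Longrightarrow> y \<in> H \<Longrightarrow> x \<oplus> n y \<oplus> y = x"
  by (simp_all add: assoc)

lemma cancel_middle [simp]:
  "x \<in> H \<Longrightarrow> y \<in> H \<Longrightarrow> x \<oplus> (y \<oplus> n x) = y"
  "x \<in> H \<Longrightarrow> y \<in> H \<Longrightarrow> n x \<oplus> (y \<oplus> x) = y"
  by (metis comm cancel neg_closed)+

lemma neg_unique: "x \<in> H \<Longrightarrow> y \<in> H \<Longrightarrow> x \<oplus> y = z \<Longrightarrow> n x = y"
  by (metis cancel(1) neg_closed zero_right)

lemma neg_neg [simp]: "x \<in> H \<Longrightarrow> n (n x) = x"
  by (simp add: neg_unique)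

lemma neg_zero [simp]: "n z = z"
  by (simp add: neg_unique)

lemma neg_add: "x \<in> H \<Longrightarrow> y \<in> H \<Longrightarrow> n (x \<oplus> y) = n x \<oplus> n y"
  by (rule neg_unique) (simp_all add: ac)

lemma diff_eq_zero: "x \<in> H \<Longrightarrow> y \<in> H \<Longrightarrow> x \<oplus> n y = z \<longleftrightarrow> x = y"
  by (metis cancel_right(2) neg_closed neg_right zero_left)

lemma neg_sub: "x \<in> H \<Longrightarrow> y \<in> H \<Longrightarrow> n (x \<oplus> n y) = y \<oplus> n x"
  by (simp add: neg_add comm)

lemma continuous_add [continuous_intros]:
  assumes "continuous_map X T g" "continuous_map X T h"
  shows "continuous_map X T (\<lambda>x. g x \<oplus> h x)"
  using continuous_map_compose[OF continuous_map_pairedI[OF assms] continuous_add']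
  by (simp add: o_def)

lemma continuous_neg [continuous_intros]:
  assumes "continuous_map X T g"
  shows "continuous_map X T (\<lambda>x. n (g x))"
  using continuous_map_compose[OF assms continuous_neg'] by (simp add: o_def)

lemma continuous_translate: "a \<in> H \<Longrightarrow> continuous_map T T (\<lambda>x. a \<oplus> x)"
  by (intro continuous_intros) simp_all

lemma openin_translate: "openin T V \<Longrightarrow> a \<in> H \<Longrightarrow> openin T {h \<in> H. a \<oplus> h \<in> V}"
  by (rule openin_continuous_map_preimage[OF continuous_translate])

lemma translate_image:
  assumes "a \<in> H" "A \<subseteq> H"
  shows "(\<oplus>) a ` A = {h \<in> H. n a \<oplus> h \<in> A}"
proof (intro set_eqI iffI)
  fix h assume "h \<in> {h \<in> H. n a \<oplus> h \<in> A}"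
  with assms have "h = a \<oplus> (n a \<oplus> h)" "n a \<oplus> h \<in> A" by auto
  then show "h \<in> (\<oplus>) a ` A" by blast
qed (use assms in \<open>auto simp: subset_iff\<close>)

lemma openin_translate_image: "openin T V \<Longrightarrow> a \<in> H \<Longrightarrow> openin T ((\<oplus>) a ` V)"
  using openin_translate[of V "n a"] translate_image[of a V] openin_subset[of T V] by simp

lemma compactin_sum:
  assumes "compactin T A" "compactin T B"
  shows "compactin T {a \<oplus> b | a b. a \<in> A \<and> b \<in> B}"
proof -
  have "{a \<oplus> b | a b. a \<in> A \<and> b \<in> B} = (\<lambda>p. fst p \<oplus> snd p) ` (A \<times> B)" by force
  with image_compactin[OF _ continuous_add', of "A \<times> B"] assms show ?thesis
    by (simp add: compactin_Times)
qed

lemma compactin_diff: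
  assumes "compactin T A" "compactin T B"
  shows "compactin T {a \<oplus> n b | a b. a \<in> A \<and> b \<in> B}"
proof -
  have "{a \<oplus> n b | a b. a \<in> A \<and> b \<in> B} = {a \<oplus> b | a b. a \<in> A \<and> b \<in> n ` B}" by force
  with compactin_sum[OF assms(1) image_compactin[OF assms(2) continuous_neg']] show ?thesis by simp
qed

lemma compactin_translate: "compactin T A \<Longrightarrow> a \<in> H \<Longrightarrow> compactin T ((\<oplus>) a ` A)"
  by (rule image_compactin[OF _ continuous_translate])

text \<open>By Wallace's theorem, one neighbourhood of \<open>z\<close> serves all of
  \<open>K\<close>, since addition maps \<open>K \<times> {z}\<close> into \<open>V\<close>. Thus a
  window can be thickened by a small subgroup without leaving its open approximations.\<close>

lemma compact_nbhd_in_open: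
  assumes "compactin T K" "openin T V" "K \<subseteq> V"
  obtains O1 where "openin T O1" "z \<in> O1" "\<And>k v. k \<in> K \<Longrightarrow> v \<in> O1 \<Longrightarrow> k \<oplus> v \<in> V"
proof -
  let ?W = "{p \<in> topspace (prod_topology T T). fst p \<oplus> snd p \<in> V}"
  have W: "openin (prod_topology T T) ?W"
    by (rule openin_continuous_map_preimage[OF continuous_add' assms(2)])
  have KZ: "K \<times> {z} \<subseteq> ?W"
    using assms compactin_subset_topspace[OF assms(1)] by (auto simp: subset_iff)
  have "compactin T {z}" by simp
  from assms(1) this W KZ obtain A B where
    "openin T A" "openin T B" "K \<subseteq> A" "{z} \<subseteq> B" "A \<times> B \<subseteq> ?W"
    by (rule Wallace_theorem_prod_topology)
  then show ?thesis by (intro that[of B]) force+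
qed

lemma small_nbhd:
  assumes "openin T V" "z \<in> V"
  obtains O1 where "openin T O1" "z \<in> O1" "O1 \<subseteq> V" "\<And>a b. a \<in> O1 \<Longrightarrow> b \<in> O1 \<Longrightarrow> a \<oplus> n b \<in> V"
proof -
  let ?W = "{p \<in> topspace (prod_topology T T). fst p \<oplus> n (snd p) \<in> V}"
  have "continuous_map (prod_topology T T) T (\<lambda>p. fst p \<oplus> n (snd p))"
    by (intro continuous_intros continuous_map_fst continuous_map_snd)
  then have W: "openin (prod_topology T T) ?W"
    by (rule openin_continuous_map_preimage[OF _ assms(1)])
  have "(z, z) \<in> ?W" using assms by simp
  with W obtain A B where "openin T A" "openin T B" "z \<in> A" "z \<in> B" "A \<times> B \<subseteq> ?W"
    unfolding openin_prod_topology_alt by meson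
  then show ?thesis using assms
    by (intro that[of "A \<inter> B \<inter> V"]) auto
qed

lemma compactin_closed: "compactin T K \<Longrightarrow> closedin T K"
  using hausdorff compactin_imp_closedin by blast

section \<open>Discrete and cocompact subgroups\<close>

definition subgrp :: "'a set \<Rightarrow> bool" where
  "subgrp S \<longleftrightarrow> S \<subseteq> H \<and> z \<in> S \<and> (\<forall>x\<in>S. \<forall>y\<in>S. x \<oplus> y \<in> S) \<and> (\<forall>x\<in>S. n x \<in> S)"

text \<open>If differences of points of \<open>W\<close> stay in \<open>V\<close>, each translate of
  \<open>W\<close> holds at most one point of \<open>S\<close>, and finitely many translates cover
  \<open>K\<close>. Isolation of \<open>z\<close> is enough because \<open>S\<close> is a
  group.\<close>

lemma discrete_subgroup_finite:
  assumes S: "subgrp S" and V: "openin T V" "V \<inter> S = {z}" and K: "compactin T K"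
  shows "finite (S \<inter> K)"
proof -
  have "z \<in> V" using V by blast
  then obtain W where W: "openin T W" "z \<in> W" "\<And>a b. a \<in> W \<Longrightarrow> b \<in> W \<Longrightarrow> a \<oplus> n b \<in> V"
    using small_nbhd[OF V(1)] by metis
  have WT: "W \<subseteq> H" using W(1) openin_subset by blast
  have one: "x = y" if p: "p \<in> H" and xy: "x \<in> S" "y \<in> S" "x \<in> (\<oplus>) p ` W" "y \<in> (\<oplus>) p ` W" for p x y
  proof -
    obtain a b where ab: "a \<in> W" "b \<in> W" "x = p \<oplus> a" "y = p \<oplus> b" using xy by blast
    have m: "a \<in> H" "b \<in> H" using ab WT by auto
    have "x \<oplus> n y = a \<oplus> n b" using ab m p by (simp add: neg_add ac)
    moreover have "x \<oplus> n y \<in> S" using S xy unfolding subgrp_def by blast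
    ultimately have "x \<oplus> n y = z" using V W(3) ab by auto
    then show ?thesis using xy S by (subst (asm) diff_eq_zero) (auto simp: subgrp_def)
  qed
  have pp: "p \<in> (\<oplus>) p ` W" if "p \<in> H" for p
    using imageI[OF W(2), of "(\<oplus>) p"] that by simp
  have "K \<subseteq> (\<Union>p\<in>H. (\<oplus>) p ` W)"
    using compactin_subset_topspace[OF K] pp by fast
  then obtain F where F: "finite F" "F \<subseteq> H" "K \<subseteq> (\<Union>p\<in>F. (\<oplus>) p ` W)"
    using compactin_subcover[OF K] openin_translate_image[OF W(1)] by metis
  have "finite (S \<inter> (\<oplus>) p ` W)" if "p \<in> F" for p
  proof (cases "S \<inter> (\<oplus>) p ` W = {}")
    case False
    then obtain x where x: "x \<in> S" "x \<in> (\<oplus>) p ` W" by blast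
    have "S \<inter> (\<oplus>) p ` W \<subseteq> {x}"
    proof
      fix y assume "y \<in> S \<inter> (\<oplus>) p ` W"
      then show "y \<in> {x}" using one[of p y x] x that F(2) by simp blast
    qed
    then show ?thesis by (rule finite_subset) simp
  qed simp
  then have "finite (\<Union>p\<in>F. S \<inter> (\<oplus>) p ` W)" using F(1) by blast
  moreover have "S \<inter> K \<subseteq> (\<Union>p\<in>F. S \<inter> (\<oplus>) p ` W)" using F(3) unfolding Int_UN_distrib[symmetric] by blast
  ultimately show ?thesis by (rule finite_subset[rotated])
qed

lemma coset_eq:
  assumes S: "subgrp S" and p: "p \<in> H" and l: "l \<in> S"
  shows "(\<oplus>) p ` S = (\<oplus>) (p \<oplus> l) ` S"
proof (intro equalityI image_subsetI)
  have m: "\<And>s. s \<in> S \<Longrightarrow> s \<in> H" using S unfolding subgrp_def by blast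
  fix s assume s: "s \<in> S"
  have "p \<oplus> s = p \<oplus> l \<oplus> (n l \<oplus> s)" using m[OF s] m[OF l] p by (simp add: assoc)
  moreover have "n l \<oplus> s \<in> S" using S s l unfolding subgrp_def by simp
  ultimately show "p \<oplus> s \<in> (\<oplus>) (p \<oplus> l) ` S" by (rule image_eqI)
  have "p \<oplus> l \<oplus> s = p \<oplus> (l \<oplus> s)" using m[OF s] m[OF l] p by (simp add: assoc)
  moreover have "l \<oplus> s \<in> S" using S s l unfolding subgrp_def by simp
  ultimately show "p \<oplus> l \<oplus> s \<in> (\<oplus>) p ` S" by (rule image_eqI)
qed

text \<open>The coset projection is open, because the saturation of an open set is a union of
  translates. So the images of relatively compact open sets cover the compact space
  \<open>Y\<close>, and the compact sets around finitely many of them together form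
  \<open>K\<close>.\<close>

lemma quotient_compact_imp:
  assumes S: "subgrp S" and q: "quotient_map T Y (\<lambda>p. (\<oplus>) p ` S)" and Y: "compact_space Y"
  shows "\<exists>K. compactin T K \<and> (\<forall>e\<in>H. \<exists>l\<in>S. e \<oplus> n l \<in> K)"
proof -
  let ?q = "\<lambda>p. (\<oplus>) p ` S"
  have ST: "S \<subseteq> H" using S unfolding subgrp_def by blast
  have qmem: "p \<in> ?q p" if "p \<in> H" for p
    using that S by (metis image_eqI subgrp_def zero_right)
  note qeq = coset_eq[OF S]
  have op: "openin Y (?q ` V)" if V: "openin T V" for V
  proof -
    have VT: "V \<subseteq> H" using V openin_subset by blast
    have "{x \<in> H. ?q x \<in> ?q ` V} = (\<Union>l\<in>S. (\<oplus>) l ` V)"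
    proof (intro equalityI subsetI)
      fix x assume "x \<in> {x \<in> H. ?q x \<in> ?q ` V}"
      then obtain v where v: "v \<in> V" "?q x = ?q v" "x \<in> H" by blast
      then obtain l where "l \<in> S" "x = v \<oplus> l" using qmem[of x] by auto
      then have "x = l \<oplus> v" using comm[of v l] subsetD[OF VT v(1)] subsetD[OF ST] by simp
      then show "x \<in> (\<Union>l\<in>S. (\<oplus>) l ` V)" using \<open>l \<in> S\<close> v by blast
    next
      fix x assume "x \<in> (\<Union>l\<in>S. (\<oplus>) l ` V)"
      then obtain l v where lv: "l \<in> S" "v \<in> V" "x = l \<oplus> v" by blast
      then have m: "l \<in> H" "v \<in> H" using VT ST by auto
      then have "?q x = ?q v" using lv comm qeq[of v l] by simp
      then show "x \<in> {x \<in> H. ?q x \<in> ?q ` V}" using m lv by (simp add: image_eqI)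
    qed
    moreover have "openin T (\<Union>l\<in>S. (\<oplus>) l ` V)" using V ST openin_translate_image by blast
    moreover have "?q ` V \<subseteq> topspace Y" using q image_mono[OF VT, of ?q] unfolding quotient_map_def by simp
    ultimately show ?thesis using q unfolding quotient_map_def
      by (elim conjE allE[of _ "?q ` V"]) simp
  qed
  have "\<exists>V K. openin T V \<and> compactin T K \<and> e \<in> V \<and> V \<subseteq> K" if "e \<in> H" for e
    using locally_compact that unfolding locally_compact_space_def by blast
  then obtain V K where VK: "\<And>e. e \<in> H \<Longrightarrow> openin T (V e) \<and> compactin T (K e) \<and> e \<in> V e \<and> V e \<subseteq> K e"
    by metis
  have qT: "?q ` H = topspace Y" using q unfolding quotient_map_def by (rule conjunct1)
  have "topspace Y \<subseteq> (\<Union>e\<in>H. ?q ` V e)"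
    unfolding qT[symmetric] using VK by fast
  then obtain F where F: "finite F" "F \<subseteq> H" "topspace Y \<subseteq> (\<Union>e\<in>F. ?q ` V e)"
    using compactin_subcover[OF Y[unfolded compact_space_def], of "H" "\<lambda>e. ?q ` V e"] op VK
    by metis
  show ?thesis
  proof (intro exI conjI ballI)
    show "compactin T (\<Union>e\<in>F. K e)" using F VK by (intro compactin_Union) auto
    fix e assume e: "e \<in> H"
    then have "?q e \<in> topspace Y" using qT by fast
    then have "?q e \<in> (\<Union>e\<in>F. ?q ` V e)" using F(3) by (rule subsetD[rotated])
    then obtain e' v where v: "e' \<in> F" "v \<in> V e'" "?q e = ?q v" by (elim UN_E imageE)
    then have "e \<in> ?q v" using qmem[OF e] by simp
    then obtain l where l: "l \<in> S" "e = v \<oplus> l" by (elim imageE)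
    have e': "e' \<in> H" using v(1) F(2) by (rule subsetD[rotated])
    then have "V e' \<subseteq> H" using VK by (simp add: openin_subset)
    then have "v \<in> H" using v(2) by (rule subsetD)
    then have "e \<oplus> n l = v" using l subsetD[OF ST l(1)] by simp
    then have "e \<oplus> n l \<in> K e'" using v(2) VK[OF e'] by auto
    then show "\<exists>l\<in>S. e \<oplus> n l \<in> (\<Union>e\<in>F. K e)" using l(1) v(1) by (intro bexI UN_I)
  qed
qed

text \<open>Every coset meets \<open>K\<close>, so \<open>Y\<close> is the continuous image of a
  compact set.\<close>

lemma quotient_compact_conv:
  assumes S: "subgrp S" and K: "compactin T K" "\<forall>e\<in>H. \<exists>l\<in>S. e \<oplus> n l \<in> K"
  shows "\<exists>Y. quotient_map T Y (\<lambda>p. (\<oplus>) p ` S) \<and> compact_space Y"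
proof -
  let ?q = "\<lambda>p. (\<oplus>) p ` S"
  obtain Y where Y: "quotient_map T Y ?q" using ex_quotient_map by blast
  have ST: "S \<subseteq> H" using S unfolding subgrp_def by blast
  have KT: "K \<subseteq> H" using K(1) compactin_subset_topspace by blast
  note qeq = coset_eq[OF S]
  have "?q e \<in> ?q ` K" if e: "e \<in> H" for e
  proof -
    obtain l where l: "l \<in> S" "e \<oplus> n l \<in> K" using K e by blast
    then have "n l \<in> S" using S unfolding subgrp_def by blast
    then show ?thesis using qeq[OF e, of "n l"] l(2) by simp
  qed
  then have "?q ` H \<subseteq> ?q ` K" by (rule image_subsetI)
  then have "topspace Y = ?q ` K" using Y image_mono[OF KT, of ?q] unfolding quotient_map_def by simp
  moreover have "compactin Y (?q ` K)"
    using image_compactin[OF K(1) quotient_imp_continuous_map[OF Y]] .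
  ultimately have "compact_space Y" unfolding compact_space_def by simp
  with Y show ?thesis by (intro exI conjI)
qed

end

section \<open>Products, Euclidean space and the integers as groups\<close>

lemma lca_prod:
  assumes "lca_group T f z n" "lca_group S g w m"
  shows "lca_group (prod_topology T S) (\<lambda>p q. (f (fst p) (fst q), g (snd p) (snd q))) (z, w)
           (\<lambda>p. (n (fst p), m (snd p)))"
proof -
  interpret A: lca T f z n by (rule lca.intro) fact
  interpret B: lca S g w m by (rule lca.intro) fact
  show ?thesis unfolding lca_group_def
  proof (intro conjI)
    show "continuous_map (prod_topology (prod_topology T S) (prod_topology T S)) (prod_topology T S)
      (\<lambda>p. (f (fst (fst p)) (fst (snd p)), g (snd (fst p)) (snd (snd p))))"
      by (intro continuous_intros continuous_map_fst_of continuous_map_snd_of)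
        (auto intro: continuous_map_fst continuous_map_snd simp: o_def
          intro!: continuous_map_compose[OF continuous_map_fst continuous_map_fst, unfolded o_def]
            continuous_map_compose[OF continuous_map_fst continuous_map_snd, unfolded o_def]
            continuous_map_compose[OF continuous_map_snd continuous_map_fst, unfolded o_def]
            continuous_map_compose[OF continuous_map_snd continuous_map_snd, unfolded o_def])
    show "continuous_map (prod_topology T S) (prod_topology T S) (\<lambda>p. (n (fst p), m (snd p)))"
      by (intro continuous_intros continuous_map_fst continuous_map_snd)
    show "Hausdorff_space (prod_topology T S)"
      using A.hausdorff B.hausdorff Hausdorff_space_prod_topology by blast
    show "locally_compact_space (prod_topology T S)"
      using A.locally_compact B.locally_compact locally_compact_space_prod_topology by blast
  qed (auto simp: A.assoc B.assoc intro: A.comm B.comm)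
qed

lemma lca_euclidean: "lca_group (euclidean :: 'g::euclidean_space topology) (+) 0 uminus"
  unfolding lca_group_def
  by (auto simp: locally_compact_space_euclidean intro!: continuous_intros)

lemma euclidean_int: "(euclidean :: int topology) = discrete_topology UNIV"
  unfolding topology_eq by (simp add: Topological_Spaces.open_discrete)

lemma lca_int: "lca_group (euclidean :: int topology) (+) 0 uminus"
  unfolding lca_group_def
  by (auto simp: euclidean_int locally_compact_space_discrete_topology Hausdorff_space_discrete_topology
      continuous_map_from_discrete_topology prod_topology_discrete_topology[symmetric])

text \<open>\<open>cps\<close> is \<open>cp_scheme\<close> with discreteness replaced by local finiteness of \<open>L\<close> and
  cocompactness by the existence of a compact set that meets every coset of \<open>L\<close>.\<close>

definition cps where
  "cps T f z n L \<longleftrightarrow> lca_group T f z n \<and> L \<subseteq> UNIV \<times> topspace T \<and>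
     (0, z) \<in> L \<and> (\<forall>p\<in>L. \<forall>q\<in>L. padd f p q \<in> L) \<and> (\<forall>p\<in>L. (- fst p, n (snd p)) \<in> L) \<and>
     inj_on fst L \<and>
     (\<forall>r C. compactin T C \<longrightarrow> finite {p\<in>L. norm (fst p) \<le> r \<and> snd p \<in> C}) \<and>
     (\<exists>r C. compactin T C \<and> (\<forall>g. \<forall>h\<in>topspace T. \<exists>p\<in>L. norm (g - fst p) \<le> r \<and> f h (n (snd p)) \<in> C)) \<and>
     T closure_of (snd ` L) = topspace T"
  for L :: "('g::euclidean_space \<times> 'a) set"

lemma lca_ptop:
  assumes "lca_group T f z n"
  shows "lca (ptop T) (padd f) (0, z) (\<lambda>p. (- fst p, n (snd p)))"
  using lca_prod[OF lca_euclidean assms] unfolding padd_def[abs_def] ptop_def by (rule lca.intro)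

lemma topspace_ptop [simp]: "topspace (ptop T) = UNIV \<times> topspace T"
  by (simp add: ptop_def)

text \<open>Local finiteness is discreteness seen in the compact box
  \<open>cball 0 r \<times> C\<close> of the product group. The compact set meeting all cosets is
  replaced by its two projections, which is all that \<open>cps\<close> retains.\<close>

lemma cp_scheme_imp_cps:
  assumes "cp_scheme T f z n L"
  shows "cps T f z n L"
proof -
  note a = assms[unfolded cp_scheme_def]
  have g: "lca_group T f z n" using a by blast
  interpret E: lca "ptop T" "padd f" "(0, z)" "\<lambda>p. (- fst p, n (snd p))"
    by (rule lca_ptop[OF g])
  have S: "E.subgrp L" unfolding E.subgrp_def using a by auto
  have "\<exists>V. openin (ptop T) V \<and> V \<inter> L = {(0, z)}" using a by blast
  then obtain V where V: "openin (ptop T) V" "V \<inter> L = {(0, z)}" by blast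
  have fin: "finite {p\<in>L. norm (fst p) \<le> r \<and> snd p \<in> C}" if "compactin T C" for r C
  proof -
    have "compactin (ptop T) (cball 0 r \<times> C)"
      unfolding ptop_def using that by (simp add: compactin_Times)
    from E.discrete_subgroup_finite[OF S V this] show ?thesis
      by (rule finite_subset[rotated]) auto
  qed
  obtain Y :: "('b \<times> 'a) set topology" where Y: "quotient_map (ptop T) Y (\<lambda>p. padd f p ` L)" "compact_space Y"
    using a by (elim conjE exE)
  obtain K where K: "compactin (ptop T) K" "\<forall>e\<in>topspace (ptop T). \<exists>l\<in>L. padd f e (- fst l, n (snd l)) \<in> K"
    using E.quotient_compact_imp[OF S Y] by (elim exE conjE)
  have "compactin euclidean (fst ` K)" "compactin T (snd ` K)"
    using K(1) image_compactin continuous_map_fst continuous_map_snd unfolding ptop_def by blast+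
  then have "bounded (fst ` K)" by (simp add: compact_imp_bounded)
  then obtain r where r: "\<And>p. p \<in> K \<Longrightarrow> norm (fst p) \<le> r" unfolding bounded_iff by blast
  have "\<exists>p\<in>L. norm (g - fst p) \<le> r \<and> f h (n (snd p)) \<in> snd ` K" if h: "h \<in> topspace T" for g h
  proof -
    obtain l where l: "l \<in> L" "padd f (g, h) (- fst l, n (snd l)) \<in> K" using K(2) h by force
    then have "(g - fst l, f h (n (snd l))) \<in> K" by (simp add: padd_def)
    with r l(1) show ?thesis by force
  qed
  then have "\<exists>r C. compactin T C \<and> (\<forall>g. \<forall>h\<in>topspace T. \<exists>p\<in>L. norm (g - fst p) \<le> r \<and> f h (n (snd p)) \<in> C)"
    using \<open>compactin T (snd ` K)\<close> by (intro exI[of _ r] exI[of _ "snd ` K"]) simp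
  moreover have "\<forall>r C. compactin T C \<longrightarrow> finite {p\<in>L. norm (fst p) \<le> r \<and> snd p \<in> C}"
    using fin by simp
  ultimately show ?thesis unfolding cps_def using a by (elim conjE) (intro conjI; assumption)
qed

lemma cps_imp_cp_scheme:
  assumes "cps T f z n L"
  shows "cp_scheme T f z n L"
proof -
  note a = assms[unfolded cps_def]
  have g: "lca_group T f z n" using a by blast
  interpret H: lca T f z n by (rule lca.intro[OF g])
  interpret E: lca "ptop T" "padd f" "(0, z)" "\<lambda>p. (- fst p, n (snd p))"
    by (rule lca_ptop[OF g])
  have S: "E.subgrp L" unfolding E.subgrp_def using a by auto
  obtain r C where C: "compactin T C" "\<And>g h. h \<in> topspace T \<Longrightarrow> \<exists>p\<in>L. norm (g - fst p) \<le> r \<and> f h (n (snd p)) \<in> C"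
    using a by blast
  have "compactin (ptop T) (cball 0 r \<times> C)"
    unfolding ptop_def using C by (simp add: compactin_Times)
  moreover have "\<forall>e\<in>topspace (ptop T). \<exists>l\<in>L. padd f e (- fst l, n (snd l)) \<in> cball 0 r \<times> C"
    using C(2) by (force simp: padd_def)
  ultimately have Y: "\<exists>Y. quotient_map (ptop T) Y (\<lambda>p. padd f p ` L) \<and> compact_space Y"
    by (rule E.quotient_compact_conv[OF S])
  have "\<exists>V. openin (ptop T) V \<and> V \<inter> L = {p}" if p: "p \<in> L" for p
  proof -
    have "snd p \<in> topspace T" using p a by auto
    then obtain V K where VK: "openin T V" "compactin T K" "snd p \<in> V" "V \<subseteq> K"
      using H.locally_compact unfolding locally_compact_space_def by meson
    \<comment> \<open>The other lattice points in a box around \<open>p\<close> are finite in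
      number, hence closed; removing them from the open box isolates \<open>p\<close>.\<close>
    let ?F = "{q\<in>L. norm (fst q) \<le> norm (fst p) + 1 \<and> snd q \<in> K} - {p}"
    have "finite ?F" using a VK by auto
    moreover have "?F \<subseteq> topspace (ptop T)" using a by auto
    ultimately have "closedin (ptop T) ?F"
      by (intro closedin_Hausdorff_finite E.hausdorff)
    moreover have "openin (ptop T) (ball 0 (norm (fst p) + 1) \<times> V)"
      using VK unfolding ptop_def by (simp add: openin_prod_Times_iff)
    ultimately have "openin (ptop T) (ball 0 (norm (fst p) + 1) \<times> V - ?F)" by (rule openin_diff[rotated])
    moreover have "(ball 0 (norm (fst p) + 1) \<times> V - ?F) \<inter> L = {p}"
    proof (intro equalityI subsetI)
      fix q assume q: "q \<in> (ball 0 (norm (fst p) + 1) \<times> V - ?F) \<inter> L"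
      then have "norm (fst q) \<le> norm (fst p) + 1" "snd q \<in> K" "q \<in> L" using VK by auto
      with q show "q \<in> {p}" by blast
    next
      fix q assume "q \<in> {p}"
      then show "q \<in> (ball 0 (norm (fst p) + 1) \<times> V - ?F) \<inter> L" using p VK by (cases p) auto
    qed
    ultimately show ?thesis by blast
  qed
  with Y a show ?thesis unfolding cp_scheme_def by auto
qed

section \<open>Second countable quotients\<close>

text \<open>\<open>q\<close> is the projection onto a second countable quotient by \<open>N\<close>. The points of the quotient
  need not be cosets, so that they can be encoded as sets of natural numbers.\<close>

definition lca_quot where
  "lca_quot T f z n N T' f' z' n' q \<longleftrightarrow>
     lca_group T' f' z' n' \<and> second_countable T' \<and> continuous_map T T' q \<and> open_map T T' q \<and>
     q ` topspace T = topspace T' \<and>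
     (\<forall>a\<in>topspace T. \<forall>b\<in>topspace T. q (f a b) = f' (q a) (q b)) \<and> q z = z' \<and>
     (\<forall>a\<in>topspace T. q (n a) = n' (q a)) \<and>
     (\<forall>a\<in>topspace T. \<forall>b\<in>topspace T. q a = q b \<longleftrightarrow> f a (n b) \<in> N)"

lemma open_map_prod_map:
  assumes "open_map X X' q" "open_map Y Y' r"
  shows "open_map (prod_topology X Y) (prod_topology X' Y') (\<lambda>p. (q (fst p), r (snd p)))"
  unfolding open_map_def
proof (intro allI impI)
  fix W assume W: "openin (prod_topology X Y) W"
  show "openin (prod_topology X' Y') ((\<lambda>p. (q (fst p), r (snd p))) ` W)"
    unfolding openin_prod_topology_alt
  proof (intro allI impI)
    fix x y assume "(x, y) \<in> (\<lambda>p. (q (fst p), r (snd p))) ` W"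
    then obtain a b where ab: "(a, b) \<in> W" "x = q a" "y = r b" by force
    with W obtain A B where AB: "openin X A" "openin Y B" "a \<in> A" "b \<in> B" "A \<times> B \<subseteq> W"
      unfolding openin_prod_topology_alt by meson
    have "q ` A \<times> r ` B \<subseteq> (\<lambda>p. (q (fst p), r (snd p))) ` W" using AB(5) by force
    with AB ab assms show "\<exists>U V. openin X' U \<and> openin Y' V \<and> x \<in> U \<and> y \<in> V \<and>
        U \<times> V \<subseteq> (\<lambda>p. (q (fst p), r (snd p))) ` W"
      unfolding open_map_def by (intro exI[of _ "q ` A"] exI[of _ "r ` B"]) simp
  qed
qed

text \<open>Serves two ends: the rectangles give a countable base of the product, and they show that
  its open sets belong to the product sigma-algebra.\<close>

lemma countable_rectangles:
  assumes "second_countable T" "second_countable S"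
  obtains R where "countable R" "\<And>U V. (U, V) \<in> R \<Longrightarrow> openin T U \<and> openin S V"
    "\<And>W x y. openin (prod_topology T S) W \<Longrightarrow> (x, y) \<in> W \<Longrightarrow>
      \<exists>U V. (U, V) \<in> R \<and> x \<in> U \<and> y \<in> V \<and> U \<times> V \<subseteq> W"
proof -
  obtain BT where BT: "countable BT" "\<And>V. V \<in> BT \<Longrightarrow> openin T V"
    "\<And>S x. openin T S \<Longrightarrow> x \<in> S \<Longrightarrow> \<exists>V \<in> BT. x \<in> V \<and> V \<subseteq> S"
    using assms(1) unfolding second_countable_def by metis
  obtain BS where BS: "countable BS" "\<And>V. V \<in> BS \<Longrightarrow> openin S V"
    "\<And>X x. openin S X \<Longrightarrow> x \<in> X \<Longrightarrow> \<exists>V \<in> BS. x \<in> V \<and> V \<subseteq> X"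
    using assms(2) unfolding second_countable_def by metis
  show ?thesis
  proof (rule that[of "BT \<times> BS"])
    fix W x y assume "openin (prod_topology T S) W" "(x, y) \<in> W"
    then obtain U V where UV: "openin T U" "openin S V" "x \<in> U" "y \<in> V" "U \<times> V \<subseteq> W"
      unfolding openin_prod_topology_alt by meson
    obtain U' V' where "U' \<in> BT" "x \<in> U'" "U' \<subseteq> U" "V' \<in> BS" "y \<in> V'" "V' \<subseteq> V"
      using BT(3)[OF UV(1,3)] BS(3)[OF UV(2,4)] by blast
    then show "\<exists>U V. (U, V) \<in> BT \<times> BS \<and> x \<in> U \<and> y \<in> V \<and> U \<times> V \<subseteq> W"
      using UV(5) by (intro exI[of _ U'] exI[of _ V']) auto
  qed (use BT(1,2) BS(1,2) in auto)
qed

lemma second_countable_prod: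
  assumes "second_countable T" "second_countable S"
  shows "second_countable (prod_topology T S)"
proof -
  obtain R where R: "countable R" "\<And>U V. (U, V) \<in> R \<Longrightarrow> openin T U \<and> openin S V"
    "\<And>W x y. openin (prod_topology T S) W \<Longrightarrow> (x, y) \<in> W \<Longrightarrow>
      \<exists>U V. (U, V) \<in> R \<and> x \<in> U \<and> y \<in> V \<and> U \<times> V \<subseteq> W"
    by (rule countable_rectangles[OF assms]) blast
  have "\<exists>V\<in>(\<lambda>(U, V). U \<times> V) ` R. e \<in> V \<and> V \<subseteq> W" if "openin (prod_topology T S) W" "e \<in> W" for W e
    using R(3)[of W "fst e" "snd e"] that by (force simp: mem_Times_iff)
  moreover have "openin (prod_topology T S) V" if "V \<in> (\<lambda>(U, V). U \<times> V) ` R" for V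
    using that R(2) by (auto simp: openin_prod_Times_iff)
  ultimately show ?thesis
    unfolding second_countable_def using R(1) by (intro exI[of _ "(\<lambda>(U, V). U \<times> V) ` R"]) simp
qed

context lca
begin

lemma saturated_image_preimage:
  assumes "V \<subseteq> H" "\<And>a b. a \<in> H \<Longrightarrow> b \<in> H \<Longrightarrow> q a = q b \<longleftrightarrow> a \<oplus> n b \<in> N" "subgrp N"
  shows "{x \<in> H. q x \<in> q ` V} = (\<Union>l\<in>N. (\<oplus>) l ` V)"
proof (intro equalityI subsetI)
  fix x assume "x \<in> {x \<in> H. q x \<in> q ` V}"
  then obtain v where v: "v \<in> V" "q x = q v" "x \<in> H" by blast
  have vT: "v \<in> H" using v(1) assms(1) by blast
  then have "x \<oplus> n v \<in> N" using assms(2) v by blast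
  moreover have "x = x \<oplus> n v \<oplus> v" using v vT by simp
  ultimately show "x \<in> (\<Union>l\<in>N. (\<oplus>) l ` V)" using v(1) by (intro UN_I image_eqI)
next
  fix x assume "x \<in> (\<Union>l\<in>N. (\<oplus>) l ` V)"
  then obtain l v where lv: "l \<in> N" "v \<in> V" "x = l \<oplus> v" by blast
  have m: "l \<in> H" "v \<in> H" using lv assms unfolding subgrp_def by blast+
  then have "q x = q v" using assms(2)[of x v] lv by simp
  then show "x \<in> {x \<in> H. q x \<in> q ` V}" using m lv by (simp add: image_eqI)
qed

text \<open>The operations on \<open>Y\<close> are computed on chosen preimages \<open>?s\<close>;
  another choice changes the result only by an element of \<open>N\<close>. Closedness of
  \<open>N\<close> yields the Hausdorff property, openness of \<open>q\<close> yields local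
  compactness.\<close>

lemma lca_group_quotient:
  assumes N: "subgrp N" "closedin T N" and Y: "quotient_map T Y q"
    and q: "\<And>a b. a \<in> H \<Longrightarrow> b \<in> H \<Longrightarrow> q a = q b \<longleftrightarrow> a \<oplus> n b \<in> N"
  shows "open_map T Y q"
    and "\<exists>f' n'. lca_group Y f' (q z) n' \<and> (\<forall>a\<in>H. \<forall>b\<in>H. q (a \<oplus> b) = f' (q a) (q b)) \<and>
           (\<forall>a\<in>H. q (n a) = n' (q a))"
proof -
  have NT: "N \<subseteq> H" using N(1) unfolding subgrp_def by blast
  have qT: "q ` H = topspace Y" using Y unfolding quotient_map_def by blast
  show op: "open_map T Y q" unfolding open_map_def
  proof (intro allI impI)
    fix V assume V: "openin T V"
    have VT: "V \<subseteq> H" using V by (rule openin_subset)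
    have "openin T (\<Union>l\<in>N. (\<oplus>) l ` V)" using openin_translate_image[OF V] NT by blast
    then have "openin T {x \<in> H. q x \<in> q ` V}"
      using saturated_image_preimage[OF VT q N(1)] by simp
    moreover have "q ` V \<subseteq> topspace Y" using qT VT by blast
    ultimately show "openin Y (q ` V)" using Y unfolding quotient_map_def by blast
  qed
  have cont: "continuous_map T Y q" using Y by (rule quotient_imp_continuous_map)
  let ?s = "inv_into (H) q"
  define f' where "f' x y = q (?s x \<oplus> ?s y)" for x y
  define n' where "n' x = q (n (?s x))" for x
  have s: "?s (q a) \<in> H" "?s (q a) \<oplus> n a \<in> N" if "a \<in> H" for a
  proof -
    show "?s (q a) \<in> H" using that by (intro inv_into_into) simp
    moreover have "q (?s (q a)) = q a" using that by (intro f_inv_into_f) simp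
    ultimately show "?s (q a) \<oplus> n a \<in> N" using q that by blast
  qed
  have qf: "q (a \<oplus> b) = f' (q a) (q b)" if ab: "a \<in> H" "b \<in> H" for a b
  proof -
    have "?s (q a) \<oplus> ?s (q b) \<oplus> n (a \<oplus> b) = (?s (q a) \<oplus> n a) \<oplus> (?s (q b) \<oplus> n b)"
      using ab s by (simp add: neg_add ac)
    also have "\<dots> \<in> N" using s ab N(1) unfolding subgrp_def by blast
    finally have "q (?s (q a) \<oplus> ?s (q b)) = q (a \<oplus> b)" using q s ab by simp
    then show ?thesis unfolding f'_def by simp
  qed
  have qn: "q (n a) = n' (q a)" if a: "a \<in> H" for a
  proof -
    have "n (?s (q a)) \<oplus> n (n a) = n (?s (q a) \<oplus> n a)"
      using a s by (simp add: neg_add)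
    also have "\<dots> \<in> N" using s a N(1) unfolding subgrp_def by blast
    finally have "q (n (?s (q a))) = q (n a)" using q[of "n (?s (q a))" "n a"] s a by simp
    then show ?thesis unfolding n'_def by simp
  qed
  have ex: "\<exists>a\<in>H. x = q a" if "x \<in> topspace Y" for x using that qT by blast
  have mem: "q a \<in> topspace Y" if "a \<in> H" for a using that qT by blast
  have "lca_group Y f' (q z) n'"
    unfolding lca_group_def
  proof (intro conjI ballI)
    fix x y w assume "x \<in> topspace Y" "y \<in> topspace Y" "w \<in> topspace Y"
    then obtain a b c where abc: "a \<in> H" "x = q a" "b \<in> H" "y = q b"
      "c \<in> H" "w = q c" using ex by metis
    show "f' (f' x y) w = f' x (f' y w)"
      using abc by (simp add: qf[symmetric] assoc)
  next
    fix x y assume "x \<in> topspace Y" "y \<in> topspace Y"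
    then obtain a b where abc: "a \<in> H" "x = q a" "b \<in> H" "y = q b"
      using ex by metis
    show "f' x y \<in> topspace Y" using abc by (simp add: qf[symmetric] mem)
    show "f' x y = f' y x" using abc by (simp add: qf[symmetric] comm)
  next
    fix x assume "x \<in> topspace Y"
    then obtain a where abc: "a \<in> H" "x = q a" using ex by meson
    show "n' x \<in> topspace Y" using abc by (simp add: qn[symmetric] mem)
    show "f' (q z) x = x" using abc by (simp add: qf[symmetric])
    show "f' (n' x) x = q z" using abc by (simp add: qf[symmetric] qn[symmetric])
  next
    show "q z \<in> topspace Y" by (simp add: mem)
    let ?qq = "\<lambda>p. (q (fst p), q (snd p))"
    \<comment> \<open>A product of quotient maps need not be a quotient map; openness of
      \<open>q\<close> guarantees it here. Addition on \<open>Y\<close> is then continuous because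
      its composition with this map is.\<close>
    have "quotient_map (prod_topology T T) (prod_topology Y Y) ?qq"
    proof (rule continuous_open_imp_quotient_map)
      show "continuous_map (prod_topology T T) (prod_topology Y Y) ?qq"
        using cont by (intro continuous_intros continuous_map_compose[OF continuous_map_fst cont, unfolded o_def]
            continuous_map_compose[OF continuous_map_snd cont, unfolded o_def])
      show "open_map (prod_topology T T) (prod_topology Y Y) ?qq"
        by (rule open_map_prod_map[OF op op])
      show "?qq ` topspace (prod_topology T T) = topspace (prod_topology Y Y)"
      proof -
        have "?qq ` (A \<times> B) = q ` A \<times> q ` B" for A B by force
        then show ?thesis using qT by simp
      qed
    qed
    moreover have "continuous_map (prod_topology T T) Y ((\<lambda>p. f' (fst p) (snd p)) \<circ> ?qq)"
    proof (rule continuous_map_eq)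
      show "continuous_map (prod_topology T T) Y (q \<circ> (\<lambda>p. fst p \<oplus> snd p))"
        by (rule continuous_map_compose[OF continuous_add' cont])
    qed (auto simp: qf)
    ultimately show "continuous_map (prod_topology Y Y) Y (\<lambda>p. f' (fst p) (snd p))"
      by (rule continuous_compose_quotient_map)
    have "continuous_map T Y (n' \<circ> q)"
      by (rule continuous_map_eq[OF continuous_map_compose[OF continuous_neg' cont]]) (simp add: qn)
    with Y show "continuous_map Y Y n'" by (rule continuous_compose_quotient_map)
    show "locally_compact_space Y"
      using locally_compact_space_continuous_open_map_image[OF cont op qT locally_compact] .
    show "Hausdorff_space Y" unfolding Hausdorff_space_def
    proof (intro allI impI)
      fix x y assume "x \<in> topspace Y \<and> y \<in> topspace Y \<and> x \<noteq> y"
      then obtain a b where ab: "a \<in> H" "x = q a" "b \<in> H" "y = q b" "q a \<noteq> q b"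
        using ex by metis
      \<comment> \<open>The pairs whose difference avoids the closed subgroup \<open>N\<close>. A
        rectangle in this open set has factors with disjoint images.\<close>
      let ?W = "{p \<in> topspace (prod_topology T T). fst p \<oplus> n (snd p) \<in> H - N}"
      have "continuous_map (prod_topology T T) T (\<lambda>p. fst p \<oplus> n (snd p))"
        by (intro continuous_intros continuous_map_fst continuous_map_snd)
      moreover have "openin T (H - N)" using N(2) by blast
      ultimately have W: "openin (prod_topology T T) ?W"
        by (rule openin_continuous_map_preimage)
      have "(a, b) \<in> ?W" using ab q by simp
      then obtain A B where AB: "openin T A" "openin T B" "a \<in> A" "b \<in> B" "A \<times> B \<subseteq> ?W"
        using W unfolding openin_prod_topology_alt by meson
      have "disjnt (q ` A) (q ` B)"
        unfolding disjnt_iff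
      proof (intro allI notI)
        fix w assume "w \<in> q ` A \<and> w \<in> q ` B"
        then obtain c d where "c \<in> A" "d \<in> B" "q c = q d" by force
        then show False using AB(5) q by force
      qed
      then show "\<exists>U V. openin Y U \<and> openin Y V \<and> x \<in> U \<and> y \<in> V \<and> disjnt U V"
        using op AB ab unfolding open_map_def by (intro exI[of _ "q ` A"] exI[of _ "q ` B"]) simp
    qed
  qed
  then show "\<exists>f' n'. lca_group Y f' (q z) n' \<and> (\<forall>a\<in>H. \<forall>b\<in>H. q (a \<oplus> b) = f' (q a) (q b)) \<and>
           (\<forall>a\<in>H. q (n a) = n' (q a))"
    using qf qn by (intro exI[of _ f'] exI[of _ n']) simp
qed

text \<open>The coset of \<open>h\<close> is coded by the indices of those members of the countable
  family \<open>B\<close> that it meets, so the quotient lives on \<open>nat set\<close> whatever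
  the type of the group. Since \<open>B\<close> has to refine only the \<open>N\<close>-invariant
  open sets, the lemma also covers groups that are not second countable.\<close>

lemma ex_lca_quot:
  assumes N: "subgrp N" "closedin T N" and B: "countable B" "\<And>V. V \<in> B \<Longrightarrow> openin T V"
    "\<And>S h. openin T S \<Longrightarrow> h \<in> S \<Longrightarrow> (\<And>s v. s \<in> S \<Longrightarrow> v \<in> N \<Longrightarrow> s \<oplus> v \<in> S) \<Longrightarrow> \<exists>V\<in>B. h \<in> V \<and> V \<subseteq> S"
  shows "\<exists>(T' :: nat set topology) f' z' n' q. lca_quot T f z n N T' f' z' n' q"
proof -
  have NT: "N \<subseteq> H" using N(1) unfolding subgrp_def by blast
  have Nz: "z \<in> N" using N(1) unfolding subgrp_def by blast
  have "\<exists>V\<in>B. z \<in> V \<and> V \<subseteq> H"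
    by (rule B(3)) (use NT in auto)
  then have "B \<noteq> {}" by blast
  define b where "b = from_nat_into B"
  have b: "range b = B" unfolding b_def using \<open>B \<noteq> {}\<close> B(1) by (rule range_from_nat_into)
  define q where "q h = {i. \<exists>v\<in>N. h \<oplus> v \<in> b i}" for h
  have 1: "q c \<subseteq> q d" if cd: "c \<in> H" "d \<in> H" "c \<oplus> n d \<in> N" for c d
  proof
    fix i assume "i \<in> q c"
    then obtain v where v: "v \<in> N" "c \<oplus> v \<in> b i" unfolding q_def by blast
    have "d \<oplus> (c \<oplus> n d \<oplus> v) = c \<oplus> v" using cd v NT by (simp add: ac subset_iff)
    moreover have "c \<oplus> n d \<oplus> v \<in> N" using N(1) v cd unfolding subgrp_def by blast
    ultimately show "i \<in> q d" using v unfolding q_def by (intro CollectI bexI[of _ "c \<oplus> n d \<oplus> v"]) simp_all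
  qed
  have q: "q c = q d \<longleftrightarrow> c \<oplus> n d \<in> N" if cd: "c \<in> H" "d \<in> H" for c d
  proof
    assume "c \<oplus> n d \<in> N"
    moreover from this have "n (c \<oplus> n d) \<in> N" using N(1) unfolding subgrp_def by blast
    ultimately show "q c = q d" using 1 cd by (metis neg_sub subset_antisym)
  next
    assume eq: "q c = q d"
    show "c \<oplus> n d \<in> N"
    proof (rule ccontr)
      assume non: "c \<oplus> n d \<notin> N"
      \<comment> \<open>The complement of the coset of \<open>d\<close>: an
        \<open>N\<close>-invariant open set around \<open>c\<close>. A member of \<open>B\<close>
        that contains \<open>c\<close> and lies in it is met by the coset of \<open>c\<close> but
        not by that of \<open>d\<close>, so the codes differ.\<close>
      let ?S = "{x \<in> H. n d \<oplus> x \<in> H - N}"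
      have "\<exists>V\<in>B. c \<in> V \<and> V \<subseteq> ?S"
      proof (rule B(3))
        show "openin T ?S" using N(2) cd by (intro openin_translate) auto
        show "c \<in> ?S" using non cd by (simp add: comm)
        fix s v assume s: "s \<in> ?S" and v: "v \<in> N"
        have m: "s \<in> H" "v \<in> H" using s v NT by auto
        have "n d \<oplus> s = n d \<oplus> (s \<oplus> v) \<oplus> n v" using m cd by (simp add: ac)
        moreover have "n v \<in> N" using N(1) v unfolding subgrp_def by blast
        ultimately have "n d \<oplus> (s \<oplus> v) \<notin> N" using s N(1) unfolding subgrp_def by (metis (no_types, lifting) DiffD2 mem_Collect_eq)
        then show "s \<oplus> v \<in> ?S" using m cd by simp
      qed
      then obtain i where i: "c \<in> b i" "b i \<subseteq> ?S" using b by blast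
      then have "i \<in> q c" unfolding q_def using Nz cd by (auto intro!: bexI[of _ z])
      then obtain v where v: "v \<in> N" "d \<oplus> v \<in> ?S" using eq i unfolding q_def by blast
      then show False using NT cd by auto
    qed
  qed
  obtain Y where Y: "quotient_map T Y q" using ex_quotient_map by blast
  obtain f' n' where fn: "lca_group Y f' (q z) n'" "\<forall>a\<in>H. \<forall>b\<in>H. q (a \<oplus> b) = f' (q a) (q b)"
    "\<forall>a\<in>H. q (n a) = n' (q a)"
    using lca_group_quotient(2)[OF N Y q] by blast
  have op: "open_map T Y q" by (rule lca_group_quotient(1)[OF N Y q])
  have qT: "q ` H = topspace Y" using Y unfolding quotient_map_def by blast
  have cont: "continuous_map T Y q" using Y by (rule quotient_imp_continuous_map)
  have "second_countable Y" unfolding second_countable_def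
  proof (intro exI conjI allI impI ballI)
    show "countable ((`) q ` B)" using B(1) by blast
    show "openin Y V" if "V \<in> (`) q ` B" for V using that B(2) op unfolding open_map_def by blast
    fix U x assume Ux: "openin Y U \<and> x \<in> U"
    then have "x \<in> topspace Y" using openin_subset by blast
    then obtain h where h: "h \<in> H" "x = q h" using qT by blast
    have "\<exists>V\<in>B. h \<in> V \<and> V \<subseteq> {h \<in> H. q h \<in> U}"
    proof (rule B(3))
      show "openin T {h \<in> H. q h \<in> U}" using Ux by (intro openin_continuous_map_preimage[OF cont]) simp
      show "h \<in> {h \<in> H. q h \<in> U}" using h Ux by simp
      fix s v assume "s \<in> {h \<in> H. q h \<in> U}" "v \<in> N"
      then show "s \<oplus> v \<in> {h \<in> H. q h \<in> U}" using q[of "s \<oplus> v" s] NT by (auto simp: ac subset_iff)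
    qed
    then obtain V where "V \<in> B" "h \<in> V" "V \<subseteq> {h \<in> H. q h \<in> U}" by blast
    then show "\<exists>V\<in>(`) q ` B. x \<in> V \<and> V \<subseteq> U" using h by (intro bexI[of _ "q ` V"]) auto
  qed
  with fn op qT cont q have "lca_quot T f z n N Y f' (q z) n' q"
    unfolding lca_quot_def by simp
  then show ?thesis by blast
qed

lemma ex_lca_quot_second_countable:
  assumes "subgrp N" "closedin T N" "second_countable T"
  shows "\<exists>(T' :: nat set topology) f' z' n' q. lca_quot T f z n N T' f' z' n' q"
proof -
  obtain B where B: "countable B" "\<And>V. V \<in> B \<Longrightarrow> openin T V"
    "\<And>S x. openin T S \<Longrightarrow> x \<in> S \<Longrightarrow> \<exists>V \<in> B. x \<in> V \<and> V \<subseteq> S"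
    using assms(3) unfolding second_countable_def by metis
  show ?thesis by (rule ex_lca_quot[OF assms(1,2) B])
qed

end

section \<open>Invariant measures\<close>

text \<open>Haar measures without the two regularity conditions, which are automatic on second countable
  groups.\<close>

definition weak_haar where
  "weak_haar T f \<mu> \<longleftrightarrow> sets \<mu> = sets (borel_of T) \<and>
     (\<forall>g\<in>topspace T. \<forall>A\<in>sets \<mu>. emeasure \<mu> {h \<in> topspace T. f g h \<in> A} = emeasure \<mu> A) \<and>
     (\<forall>K. compactin T K \<longrightarrow> emeasure \<mu> K < \<infinity>) \<and>
     (\<forall>V. openin T V \<and> V \<noteq> {} \<longrightarrow> emeasure \<mu> V > 0)"

lemma weak_haarD:
  assumes "weak_haar T f \<mu>"
  shows "sets \<mu> = sets (borel_of T)"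
    and "g \<in> topspace T \<Longrightarrow> A \<in> sets \<mu> \<Longrightarrow> emeasure \<mu> {h \<in> topspace T. f g h \<in> A} = emeasure \<mu> A"
    and "compactin T K \<Longrightarrow> emeasure \<mu> K < \<infinity>"
    and "openin T V \<Longrightarrow> V \<noteq> {} \<Longrightarrow> emeasure \<mu> V > 0"
  using assms unfolding weak_haar_def by blast+

lemma space_borel_of [simp]: "space (borel_of T) = topspace T"
  unfolding borel_of_def by (rule space_measure_of) (use openin_subset in blast)

lemma sets_borel_of: "sets (borel_of T) = sigma_sets (topspace T) {U. openin T U}"
  unfolding borel_of_def by (rule sets_measure_of) (use openin_subset in blast)

lemma openin_borel: "openin T U \<Longrightarrow> U \<in> sets (borel_of T)"
  unfolding sets_borel_of by (rule sigma_sets.Basic) simp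

lemma closedin_borel: "closedin T C \<Longrightarrow> C \<in> sets (borel_of T)"
proof -
  assume C: "closedin T C"
  then have "topspace T - C \<in> sets (borel_of T)" by (intro openin_borel) blast
  then have "space (borel_of T) - (topspace T - C) \<in> sets (borel_of T)" by (rule sets.compl_sets)
  moreover have "space (borel_of T) - (topspace T - C) = C" using closedin_subset[OF C] by auto
  ultimately show ?thesis by simp
qed

lemma measurable_borel_of:
  assumes "continuous_map T S q"
  shows "q \<in> measurable (borel_of T) (borel_of S)"
proof (rule measurable_sigma_sets[OF sets_borel_of])
  show "{U. openin S U} \<subseteq> Pow (topspace S)" using openin_subset by blast
  show "q \<in> space (borel_of T) \<rightarrow> topspace S" using assms unfolding continuous_map_def by simp
  fix y assume "y \<in> {U. openin S U}"
  then have "openin T {x \<in> topspace T. q x \<in> y}" using assms unfolding continuous_map_def by blast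
  moreover have "q -` y \<inter> space (borel_of T) = {x \<in> topspace T. q x \<in> y}" by auto
  ultimately show "q -` y \<inter> space (borel_of T) \<in> sets (borel_of T)" by (simp add: openin_borel)
qed

lemma weak_haar_space: "weak_haar T f \<mu> \<Longrightarrow> space \<mu> = topspace T"
  unfolding weak_haar_def using sets_eq_imp_space_eq[of \<mu> "borel_of T"] by simp

section \<open>Regularity of invariant measures on second countable groups\<close>

context lca
begin

text \<open>Compact neighbourhoods form a neighbourhood base, so the basic open sets whose closure
  is compact and inside \<open>V\<close> already cover \<open>V\<close>.\<close>

lemma open_sigma_compact:
  assumes "second_countable T" "openin T V"
  shows "\<exists>K :: nat \<Rightarrow> 'a set. (\<forall>i. compactin T (K i)) \<and> incseq K \<and> (\<Union>i. K i) = V"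
proof -
  obtain B where B: "countable B" "\<And>V. V \<in> B \<Longrightarrow> openin T V"
    "\<And>S x. openin T S \<Longrightarrow> x \<in> S \<Longrightarrow> \<exists>V \<in> B. x \<in> V \<and> V \<subseteq> S"
    using assms(1) unfolding second_countable_def by metis
  \<comment> \<open>The empty set is added so that the family can be enumerated by
    \<open>from_nat_into\<close> even if \<open>V\<close> is empty.\<close>
  define KK where "KK = insert {} ((\<lambda>W. T closure_of W) ` {W \<in> B. compactin T (T closure_of W) \<and> T closure_of W \<subseteq> V})"
  have KKc: "countable KK" unfolding KK_def using B(1) by (auto intro: countable_subset)
  have KKk: "compactin T A" "A \<subseteq> V" if "A \<in> KK" for A using that unfolding KK_def by auto
  have UV: "\<Union>KK = V"
  proof (intro equalityI subsetI)
    fix x assume x: "x \<in> V"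
    have "neighbourhood_base_of (compactin T) T"
      using locally_compact_space_neighbourhood_base hausdorff locally_compact by blast
    then obtain U K where UK: "openin T U" "compactin T K" "x \<in> U" "U \<subseteq> K" "K \<subseteq> V"
      using x assms(2) unfolding neighbourhood_base_of by meson
    obtain W where W: "W \<in> B" "x \<in> W" "W \<subseteq> U" using B(3)[OF UK(1,3)] by blast
    have "T closure_of W \<subseteq> K"
      using W(3) UK(4) compactin_closed[OF UK(2)] by (intro closure_of_minimal) auto
    moreover from this have "compactin T (T closure_of W)"
      using closed_compactin[OF UK(2)] by simp
    ultimately have "T closure_of W \<in> KK" unfolding KK_def using W UK by auto
    moreover have "x \<in> T closure_of W"
      using W closure_of_subset[OF openin_subset[OF B(2)[OF W(1)]]] by blast
    ultimately show "x \<in> \<Union>KK" by blast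
  qed (use KKk in blast)
  define K where "K n = (\<Union>i\<le>n. from_nat_into KK i)" for n :: nat
  have ne: "KK \<noteq> {}" unfolding KK_def by blast
  have "(\<Union>n. K n) = \<Union> (range (from_nat_into KK))" unfolding K_def by auto
  then have "(\<Union>n. K n) = V" using range_from_nat_into[OF ne KKc] UV by simp
  moreover have "incseq K" unfolding K_def incseq_def by fastforce
  moreover have "compactin T (K n)" for n
    unfolding K_def using KKk(1) from_nat_into[OF ne] by (intro compactin_Union) auto
  ultimately show ?thesis by blast
qed

text \<open>Provides the open pieces of finite measure on which Borel sets are approximated before
  the pieces are glued.\<close>

lemma open_relcompact_cover:
  assumes "second_countable T"
  shows "\<exists>D :: nat \<Rightarrow> 'a set. (\<forall>i. openin T (D i) \<and> (\<exists>K. compactin T K \<and> D i \<subseteq> K)) \<and> (\<Union>i. D i) = H"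
proof -
  obtain K :: "nat \<Rightarrow> 'a set" where K: "\<And>i. compactin T (K i)" "(\<Union>i. K i) = H"
    using open_sigma_compact[OF assms openin_topspace] by blast
  have "\<exists>U L. openin T U \<and> compactin T L \<and> K i \<subseteq> U \<and> U \<subseteq> L" for i
    using K(1)[of i] locally_compact locally_compact_space_compact_closed_compact[OF disjI1[OF hausdorff]] by blast
  then obtain D where D: "\<And>i. openin T (D i) \<and> (\<exists>L. compactin T L \<and> K i \<subseteq> D i \<and> D i \<subseteq> L)" by metis
  have D1: "openin T (D i)" "\<exists>L. compactin T L \<and> D i \<subseteq> L" "K i \<subseteq> D i" for i
    using D[of i] by blast+
  have "(\<Union>i. D i) = H"
  proof
    show "(\<Union>i. D i) \<subseteq> H" using openin_subset[OF D1(1)] by (rule UN_least)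
    show "H \<subseteq> (\<Union>i. D i)" unfolding K(2)[symmetric] using D1(3) by (rule UN_mono[OF order_refl])
  qed
  then show ?thesis using D1 by (intro exI[of _ D] conjI allI) simp_all
qed

lemma weak_haar_sigma_finite:
  assumes "second_countable T" "weak_haar T f \<mu>"
  shows "sigma_finite_measure \<mu>"
proof
  obtain K :: "nat \<Rightarrow> 'a set" where K: "\<And>i. compactin T (K i)" "(\<Union>i. K i) = H"
    using open_sigma_compact[OF assms(1) openin_topspace] by blast
  show "\<exists>A. countable A \<and> A \<subseteq> sets \<mu> \<and> \<Union> A = space \<mu> \<and> (\<forall>a\<in>A. emeasure \<mu> a \<noteq> \<infinity>)"
  proof (intro exI[of _ "range K"] conjI)
    show "range K \<subseteq> sets \<mu>" using K(1) compactin_closed closedin_borel assms(2) unfolding weak_haar_def by auto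
    show "\<Union> (range K) = space \<mu>" using K(2) weak_haar_space[OF assms(2)] by simp
    show "\<forall>a\<in>range K. emeasure \<mu> a \<noteq> \<infinity>"
    proof (intro ballI)
      fix a assume "a \<in> range K"
      then obtain i where "a = K i" by blast
      then show "emeasure \<mu> a \<noteq> \<infinity>" using weak_haarD(3)[OF assms(2) K(1)[of i]] by simp
    qed
  qed simp
qed

text \<open>Induction over the generation of the sigma-algebra: bracketing between a closed and an
  open set is symmetric under complements, and open sets enter through sigma-compactness. Finite
  measure of \<open>X\<close> is what continuity from above demands.\<close>

lemma borel_approx_local:
  fixes \<mu> :: "'a measure"
  assumes sc: "second_countable T" and sets: "sets \<mu> = sets (borel_of T)"
    and X: "openin T X" "emeasure \<mu> X < \<infinity>"
    and A: "A \<in> sigma_sets (H) {U. openin T U}" and e: "(0::real) < e"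
  shows "\<exists>V F. openin T V \<and> closedin T F \<and> F \<subseteq> A \<and> A \<subseteq> V \<and> emeasure \<mu> ((V - F) \<inter> X) < e"
  using A e
proof (induction arbitrary: e rule: sigma_sets.induct)
  case (Basic V)
  then have V: "openin T V" by simp
  obtain K :: "nat \<Rightarrow> 'a set" where K: "\<And>i. compactin T (K i)" "incseq K" "(\<Union>i. K i) = V"
    using open_sigma_compact[OF sc V] by blast
  have cl: "closedin T (K i)" for i using K(1) by (rule compactin_closed)
  have "(\<lambda>i. emeasure \<mu> ((V - K i) \<inter> X)) \<longlonglongrightarrow> emeasure \<mu> (\<Inter>i. (V - K i) \<inter> X)"
  proof (rule Lim_emeasure_decseq)
    show "range (\<lambda>i. (V - K i) \<inter> X) \<subseteq> sets \<mu>"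
      unfolding sets using openin_borel[OF V] closedin_borel[OF cl] openin_borel[OF X(1)] by auto
    show "decseq (\<lambda>i. (V - K i) \<inter> X)" using K(2) unfolding incseq_def decseq_def by blast
    fix i
    have "emeasure \<mu> ((V - K i) \<inter> X) \<le> emeasure \<mu> X"
      by (rule emeasure_mono) (auto simp: sets openin_borel X)
    then show "emeasure \<mu> ((V - K i) \<inter> X) \<noteq> \<infinity>" using X(2) by (auto simp: top_unique)
  qed
  moreover have "(\<Inter>i. (V - K i) \<inter> X) = {}" using K(3) by blast
  ultimately have "\<forall>\<^sub>F i in sequentially. emeasure \<mu> ((V - K i) \<inter> X) < ennreal e"
    using Basic(2) by (intro order_tendstoD(2)) (auto simp: ennreal_zero_less_top)
  then obtain i where "emeasure \<mu> ((V - K i) \<inter> X) < ennreal e"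
    using eventually_happens[of _ sequentially] by auto
  then show ?case using V cl[of i] K(3) by (intro exI[of _ V] exI[of _ "K i"]) auto
next
  case Empty
  then show ?case by (intro exI[of _ "{}"]) simp
next
  case (Compl A)
  then obtain V F where VF: "openin T V" "closedin T F" "F \<subseteq> A" "A \<subseteq> V" "emeasure \<mu> ((V - F) \<inter> X) < e"
    by meson
  have "(H - F) - (H - V) = V - F" using openin_subset[OF VF(1)] by blast
  then show ?case
    using VF by (intro exI[of _ "H - F"] exI[of _ "H - V"]) auto
next
  case (Union A)
  \<comment> \<open>These errors add up to \<open>e / 2\<close>, strictly below \<open>e\<close>. As
    an infinite union of closed sets need not be closed, the inner set will be the finite union
    \<open>?G k\<close> for large \<open>k\<close>, which uses up the remaining slack.\<close>
  have "\<exists>V F. openin T V \<and> closedin T F \<and> F \<subseteq> A i \<and> A i \<subseteq> V \<and> emeasure \<mu> ((V - F) \<inter> X) < e / 2 * (1/2) ^ Suc i" for i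
    using Union(2)[of "e / 2 * (1/2) ^ Suc i" i] Union(3) by simp
  then obtain V F where VF: "\<And>i. openin T (V i)" "\<And>i. closedin T (F i)" "\<And>i. F i \<subseteq> A i" "\<And>i. A i \<subseteq> V i"
    "\<And>i. emeasure \<mu> ((V i - F i) \<inter> X) < e / 2 * (1/2) ^ Suc i" by metis
  have meas: "V i \<in> sets \<mu>" "F i \<in> sets \<mu>" "X \<in> sets \<mu>" for i
    unfolding sets using openin_borel[OF VF(1)] closedin_borel[OF VF(2)] openin_borel[OF X(1)] by simp_all
  let ?V = "\<Union>i. V i"
  let ?G = "\<lambda>k. \<Union>i\<le>k. F i"
  have fin: "emeasure \<mu> (B \<inter> X) \<noteq> \<infinity>" if "B \<in> sets \<mu>" for B
  proof -
    have "emeasure \<mu> (B \<inter> X) \<le> emeasure \<mu> X"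
      by (rule emeasure_mono) (auto simp: meas)
    then show ?thesis using X(2) by (auto simp: top_unique)
  qed
  have "(\<lambda>k. emeasure \<mu> ((?V - ?G k) \<inter> X)) \<longlonglongrightarrow> emeasure \<mu> (\<Inter>k. (?V - ?G k) \<inter> X)"
  proof (rule Lim_emeasure_decseq)
    show "range (\<lambda>k. (?V - ?G k) \<inter> X) \<subseteq> sets \<mu>" using meas by auto
    show "decseq (\<lambda>k. (?V - ?G k) \<inter> X)" unfolding decseq_def by fastforce
    show "emeasure \<mu> ((?V - ?G k) \<inter> X) \<noteq> \<infinity>" for k using meas by (intro fin) auto
  qed
  moreover have "emeasure \<mu> (\<Inter>k. (?V - ?G k) \<inter> X) < e"
  proof -
    have "(\<Inter>k. (?V - ?G k) \<inter> X) \<subseteq> (\<Union>i. (V i - F i) \<inter> X)" by force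
    then have "emeasure \<mu> (\<Inter>k. (?V - ?G k) \<inter> X) \<le> emeasure \<mu> (\<Union>i. (V i - F i) \<inter> X)"
      using meas by (intro emeasure_mono) auto
    also have "\<dots> \<le> (\<Sum>i. emeasure \<mu> ((V i - F i) \<inter> X))"
      using meas by (intro emeasure_subadditive_countably) auto
    also have "\<dots> \<le> (\<Sum>i. ennreal (e / 2 * (1/2) ^ Suc i))"
      using VF(5) by (intro suminf_le) (auto intro: less_imp_le)
    also have "\<dots> = ennreal (e / 2 * 1)"
      using Union(3) by (intro suminf_ennreal_eq sums_mult power_half_series) auto
    also have "\<dots> < ennreal e" using Union(3) by (intro ennreal_lessI) auto
    finally show ?thesis .
  qed
  ultimately have "\<forall>\<^sub>F k in sequentially. emeasure \<mu> ((?V - ?G k) \<inter> X) < ennreal e"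
    by (rule order_tendstoD(2))
  then obtain k where "emeasure \<mu> ((?V - ?G k) \<inter> X) < ennreal e"
    using eventually_happens[of _ sequentially] by auto
  moreover have "closedin T (?G k)" using VF(2) by (intro closedin_Union) auto
  moreover have "openin T ?V" using VF(1) by blast
  moreover have "?G k \<subseteq> (\<Union>i. A i)" "(\<Union>i. A i) \<subseteq> ?V" using VF(3,4) by blast+
  ultimately show ?case by blast
qed

text \<open>Inner regularity of open sets is sigma-compactness plus continuity from below. Outer
  regularity is glued from the local brackets on the sets \<open>D i\<close>.\<close>

lemma weak_haar_imp_haar_measure:
  assumes sc: "second_countable T" and weak_haar: "weak_haar T f \<mu>"
  shows "haar_measure T f \<mu>"
proof -
  have sets: "sets \<mu> = sets (borel_of T)" using weak_haar unfolding weak_haar_def by blast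
  have op: "V \<in> sets \<mu>" if "openin T V" for V using openin_borel[OF that] sets by simp
  have inv: "emeasure \<mu> ((\<oplus>) g ` A) = emeasure \<mu> A" if "g \<in> H" "A \<in> sets \<mu>" for g A
  proof -
    have "A \<subseteq> H" using sets.sets_into_space[OF that(2)] weak_haar_space[OF weak_haar] by simp
    then show ?thesis using weak_haar that unfolding translate_image[OF that(1) \<open>A \<subseteq> H\<close>] weak_haar_def by simp
  qed
  have inner: "emeasure \<mu> V = (SUP K\<in>{K. compactin T K \<and> K \<subseteq> V}. emeasure \<mu> K)" if V: "openin T V" for V
  proof (rule antisym)
    obtain K :: "nat \<Rightarrow> 'a set" where K: "\<And>i. compactin T (K i)" "incseq K" "(\<Union>i. K i) = V"
      using open_sigma_compact[OF sc V] by blast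
    have "range K \<subseteq> sets \<mu>" using K(1) compactin_closed closedin_borel sets by auto
    then have "emeasure \<mu> V = (SUP i. emeasure \<mu> (K i))" using SUP_emeasure_incseq[of K \<mu>] K by simp
    also have "\<dots> \<le> (SUP K\<in>{K. compactin T K \<and> K \<subseteq> V}. emeasure \<mu> K)"
      using K by (intro SUP_least SUP_upper) auto
    finally show "emeasure \<mu> V \<le> (SUP K\<in>{K. compactin T K \<and> K \<subseteq> V}. emeasure \<mu> K)" .
    show "(SUP K\<in>{K. compactin T K \<and> K \<subseteq> V}. emeasure \<mu> K) \<le> emeasure \<mu> V"
      using op[OF V] by (intro SUP_least emeasure_mono) auto
  qed
  obtain D :: "nat \<Rightarrow> 'a set" where D: "\<And>i. openin T (D i)" "\<And>i. \<exists>K. compactin T K \<and> D i \<subseteq> K" "(\<Union>i. D i) = H"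
    using open_relcompact_cover[OF sc] by blast
  have Dfin: "emeasure \<mu> (D i) < \<infinity>" for i
  proof -
    obtain K where K: "compactin T K" "D i \<subseteq> K" using D(2) by blast
    have "K \<in> sets \<mu>" using K(1) compactin_closed closedin_borel sets by auto
    then have "emeasure \<mu> (D i) \<le> emeasure \<mu> K" using K by (intro emeasure_mono)
    also have "\<dots> < \<infinity>" using K weak_haar unfolding weak_haar_def by blast
    finally show ?thesis .
  qed
  have outer: "emeasure \<mu> A = (INF V\<in>{V. openin T V \<and> A \<subseteq> V}. emeasure \<mu> V)" if A: "A \<in> sets \<mu>" for A
  proof (rule antisym)
    show "emeasure \<mu> A \<le> (INF V\<in>{V. openin T V \<and> A \<subseteq> V}. emeasure \<mu> V)"
      using op by (intro INF_greatest emeasure_mono) auto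
    show "(INF V\<in>{V. openin T V \<and> A \<subseteq> V}. emeasure \<mu> V) \<le> emeasure \<mu> A"
    proof (rule ennreal_le_epsilon)
      fix e :: real assume e: "0 < e"
      have AS: "A \<in> sigma_sets (H) {U. openin T U}" using A sets sets_borel_of by blast
      have "\<exists>V F. openin T V \<and> closedin T F \<and> F \<subseteq> A \<and> A \<subseteq> V \<and> emeasure \<mu> ((V - F) \<inter> D i) < ennreal (e * (1/2) ^ Suc i)" for i
        using e by (intro borel_approx_local[OF sc sets D(1) Dfin AS]) simp
      then obtain V F where VF: "\<And>i. openin T (V i)" "\<And>i. closedin T (F i)" "\<And>i. F i \<subseteq> A" "\<And>i. A \<subseteq> V i"
        "\<And>i. emeasure \<mu> ((V i - F i) \<inter> D i) < ennreal (e * (1/2) ^ Suc i)" by metis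
      have meas: "V i \<in> sets \<mu>" "F i \<in> sets \<mu>" "D i \<in> sets \<mu>" for i
        unfolding sets using openin_borel[OF VF(1)] closedin_borel[OF VF(2)] openin_borel[OF D(1)] by simp_all
      \<comment> \<open>The excess of \<open>V i\<close> is controlled only inside
        \<open>D i\<close>, so each \<open>V i\<close> is cut down before the union is taken. The
        union still contains \<open>A\<close>, because every \<open>V i\<close> does and the
        \<open>D i\<close> cover the group.\<close>
      let ?V = "\<Union>i. V i \<inter> D i"
      have oV: "openin T ?V" using VF(1) D(1) by blast
      have AV: "A \<subseteq> ?V"
      proof
        fix a assume a: "a \<in> A"
        then have "a \<in> H" using sets.sets_into_space[OF A] weak_haar_space[OF weak_haar] by auto
        then have "a \<in> (\<Union>i. D i)" using D(3) by simp
        then obtain i where "a \<in> D i" by (elim UN_E)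
        then show "a \<in> ?V" using subsetD[OF VF(4) a, of i] by (intro UN_I[of i]) simp_all
      qed
      have "emeasure \<mu> (?V - A) \<le> emeasure \<mu> (\<Union>i. (V i - F i) \<inter> D i)"
        using meas VF(3) by (intro emeasure_mono) (blast, auto)
      also have "\<dots> \<le> (\<Sum>i. emeasure \<mu> ((V i - F i) \<inter> D i))"
        using meas by (intro emeasure_subadditive_countably) auto
      also have "\<dots> \<le> (\<Sum>i. ennreal (e * (1/2) ^ Suc i))"
        using VF(5) by (intro suminf_le) (auto intro: less_imp_le)
      also have "\<dots> = ennreal (e * 1)"
        using e by (intro suminf_ennreal_eq sums_mult power_half_series) auto
      finally have le: "emeasure \<mu> (?V - A) \<le> ennreal e" by simp
      have "(INF V\<in>{V. openin T V \<and> A \<subseteq> V}. emeasure \<mu> V) \<le> emeasure \<mu> ?V"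
        using oV AV by (intro INF_lower) simp
      also have "\<dots> \<le> emeasure \<mu> (A \<union> (?V - A))"
        using A op[OF oV] by (intro emeasure_mono) auto
      also have "\<dots> \<le> emeasure \<mu> A + emeasure \<mu> (?V - A)"
        using A op[OF oV] by (intro emeasure_subadditive) auto
      also have "\<dots> \<le> emeasure \<mu> A + ennreal e" using le by (intro add_left_mono)
      finally show "(INF V\<in>{V. openin T V \<and> A \<subseteq> V}. emeasure \<mu> V) \<le> emeasure \<mu> A + ennreal e" .
    qed
  qed
  have "(\<forall>K. compactin T K \<longrightarrow> emeasure \<mu> K < \<infinity>)" "(\<forall>V. openin T V \<and> V \<noteq> {} \<longrightarrow> emeasure \<mu> V > 0)"
    using weak_haar unfolding weak_haar_def by blast+
  then show ?thesis
    unfolding haar_measure_def using weak_haar_space[OF weak_haar] sets inv inner outer by (intro conjI) simp_all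
qed

lemma haar_measure_imp_weak_haar:
  assumes "haar_measure T f \<mu>"
  shows "weak_haar T f \<mu>"
proof -
  have "emeasure \<mu> {h \<in> H. g \<oplus> h \<in> A} = emeasure \<mu> A" if "g \<in> H" "A \<in> sets \<mu>" for g A
  proof -
    have "A \<subseteq> H" using sets.sets_into_space[OF that(2)] assms unfolding haar_measure_def by simp
    then have "(\<oplus>) (n g) ` A = {h \<in> H. g \<oplus> h \<in> A}"
      using translate_image[of "n g" A] that by simp
    moreover have "emeasure \<mu> ((\<oplus>) (n g) ` A) = emeasure \<mu> A"
      using assms that unfolding haar_measure_def by simp
    ultimately show ?thesis by simp
  qed
  then show ?thesis using assms unfolding haar_measure_def weak_haar_def
    by (elim conjE) (intro conjI ballI; assumption?; simp)
qed

end

lemma weak_haarI: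
  assumes "sets \<mu> = sets (borel_of T)"
    "\<And>g A. g \<in> topspace T \<Longrightarrow> A \<in> sets \<mu> \<Longrightarrow> emeasure \<mu> {h \<in> topspace T. f g h \<in> A} = emeasure \<mu> A"
    "\<And>K. compactin T K \<Longrightarrow> emeasure \<mu> K < \<infinity>"
    "\<And>V. openin T V \<Longrightarrow> V \<noteq> {} \<Longrightarrow> emeasure \<mu> V > 0"
  shows "weak_haar T f \<mu>"
  using assms unfolding weak_haar_def by blast

section \<open>Invariant measures on products and on the standard groups\<close>

context lca
begin

lemma translate_sets:
  assumes "sets \<mu> = sets (borel_of T)" "A \<in> sets \<mu>" "g \<in> H"
  shows "{h \<in> H. g \<oplus> h \<in> A} \<in> sets \<mu>"
proof -
  have "(\<oplus>) g \<in> measurable (borel_of T) (borel_of T)"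
    by (rule measurable_borel_of[OF continuous_translate[OF assms(3)]])
  from measurable_sets[OF this, of A] assms show ?thesis
    by (simp add: vimage_def Int_def conj_commute)
qed

lemma translate_measurable: "weak_haar T f \<mu> \<Longrightarrow> g \<in> H \<Longrightarrow> f g \<in> measurable \<mu> \<mu>"
  using measurable_borel_of[OF continuous_translate] by (simp add: measurable_cong_sets[OF weak_haarD(1) weak_haarD(1)])

lemma distr_translate:
  assumes "weak_haar T f \<mu>" "g \<in> H"
  shows "distr \<mu> \<mu> (f g) = \<mu>"
proof (rule measure_eqI)
  fix X assume "X \<in> sets (distr \<mu> \<mu> (f g))"
  then have X: "X \<in> sets \<mu>" by simp
  have "f g -` X \<inter> space \<mu> = {h \<in> H. g \<oplus> h \<in> X}" using weak_haar_space[OF assms(1)] by auto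
  then show "emeasure (distr \<mu> \<mu> (f g)) X = emeasure \<mu> X"
    using X weak_haarD(2)[OF assms X] by (simp add: emeasure_distr[OF translate_measurable[OF assms]])
qed simp

end

text \<open>The product measure serves. Second countability enters twice: it makes both factors
  sigma-finite, and it makes open sets of \<open>E\<close> countable unions of measurable
  rectangles. The second conclusion carries null windows of \<open>T\<close> to null
  cylinders.\<close>

lemma weak_haar_prod:
  assumes T: "lca_group T f z n" "second_countable T" "weak_haar T f \<mu>"
    and S: "lca_group S g w m" "second_countable S" "weak_haar S g \<nu>"
  defines "E \<equiv> prod_topology T S"
  shows "\<exists>\<pi>. weak_haar E (\<lambda>p q. (f (fst p) (fst q), g (snd p) (snd q))) \<pi> \<and>
    (\<forall>A\<in>sets \<mu>. emeasure \<mu> A = 0 \<longrightarrow> A \<times> topspace S \<in> sets \<pi> \<and> emeasure \<pi> (A \<times> topspace S) = 0)"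
proof -
  interpret A: lca T f z n by (rule lca.intro) fact
  interpret B: lca S g w m by (rule lca.intro) fact
  interpret E: lca E "\<lambda>p q. (f (fst p) (fst q), g (snd p) (snd q))" "(z, w)" "\<lambda>p. (n (fst p), m (snd p))"
    unfolding E_def by (rule lca.intro, rule lca_prod) fact+
  interpret M: sigma_finite_measure \<mu> by (rule A.weak_haar_sigma_finite[OF T(2,3)])
  interpret N: sigma_finite_measure \<nu> by (rule B.weak_haar_sigma_finite[OF S(2,3)])
  interpret MN: pair_sigma_finite \<mu> \<nu> by unfold_locales
  note sT = weak_haarD(1)[OF T(3)] and sS = weak_haarD(1)[OF S(3)]
  note spT = weak_haar_space[OF T(3)] and spS = weak_haar_space[OF S(3)]
  have tE: "topspace E = topspace T \<times> topspace S" unfolding E_def by simp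
  have opT: "V \<in> sets \<mu>" if "openin T V" for V using openin_borel[OF that] sT by simp
  have opS: "V \<in> sets \<nu>" if "openin S V" for V using openin_borel[OF that] sS by simp
  obtain R where R: "countable R" "\<And>U V. (U, V) \<in> R \<Longrightarrow> openin T U \<and> openin S V"
    "\<And>W x y. openin (prod_topology T S) W \<Longrightarrow> (x, y) \<in> W \<Longrightarrow>
      \<exists>U V. (U, V) \<in> R \<and> x \<in> U \<and> y \<in> V \<and> U \<times> V \<subseteq> W"
    by (rule countable_rectangles[OF T(2) S(2)]) blast
  have opE: "W \<in> sets (\<mu> \<Otimes>\<^sub>M \<nu>)" if W: "openin E W" for W
  proof -
    let ?I = "{p \<in> R. fst p \<times> snd p \<subseteq> W}"
    have "W \<subseteq> (\<Union>p\<in>?I. fst p \<times> snd p)" using R(3) W unfolding E_def by fastforce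
    then have "W = (\<Union>p\<in>?I. fst p \<times> snd p)" by blast
    moreover have "(\<Union>p\<in>?I. fst p \<times> snd p) \<in> sets (\<mu> \<Otimes>\<^sub>M \<nu>)"
    proof (rule sets.countable_UN'')
      show "countable ?I" using R(1) by (rule countable_subset[rotated]) blast
      show "fst p \<times> snd p \<in> sets (\<mu> \<Otimes>\<^sub>M \<nu>)" if "p \<in> ?I" for p
        using that R(2)[of "fst p" "snd p"] opT opS by (intro pair_measureI) auto
    qed
    ultimately show ?thesis by simp
  qed
  \<comment> \<open>Measurability of the identity says that Borel sets of \<open>E\<close> are
    product measurable; \<open>\<pi>\<close> is the product measure moved along it to the Borel
    sigma-algebra.\<close>
  have id: "(\<lambda>x. x) \<in> measurable (\<mu> \<Otimes>\<^sub>M \<nu>) (borel_of E)"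
  proof (rule measurable_sigma_sets[OF sets_borel_of])
    show "{U. openin E U} \<subseteq> Pow (topspace E)" using openin_subset by blast
    show "(\<lambda>x. x) \<in> space (\<mu> \<Otimes>\<^sub>M \<nu>) \<rightarrow> topspace E" by (simp add: space_pair_measure tE spT spS)
    fix y assume "y \<in> {U. openin E U}"
    then show "(\<lambda>x. x) -` y \<inter> space (\<mu> \<Otimes>\<^sub>M \<nu>) \<in> sets (\<mu> \<Otimes>\<^sub>M \<nu>)" using opE by auto
  qed
  define \<pi> where "\<pi> = distr (\<mu> \<Otimes>\<^sub>M \<nu>) (borel_of E) (\<lambda>x. x)"
  have s\<pi>: "sets \<pi> = sets (borel_of E)" unfolding \<pi>_def by simp
  have sub: "A \<in> sets (\<mu> \<Otimes>\<^sub>M \<nu>)" if "A \<in> sets \<pi>" for A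
  proof -
    have "A \<subseteq> space (\<mu> \<Otimes>\<^sub>M \<nu>)" using sets.sets_into_space[of A "borel_of E"] that s\<pi>
      by (simp add: space_pair_measure tE spT spS)
    moreover have "(\<lambda>x. x) -` A \<inter> space (\<mu> \<Otimes>\<^sub>M \<nu>) \<in> sets (\<mu> \<Otimes>\<^sub>M \<nu>)"
      using measurable_sets[OF id] that s\<pi> by simp
    ultimately show ?thesis by (simp add: Int_absorb2)
  qed
  have e\<pi>: "emeasure \<pi> A = emeasure (\<mu> \<Otimes>\<^sub>M \<nu>) A" if "A \<in> sets \<pi>" for A
  proof -
    have "emeasure \<pi> A = emeasure (\<mu> \<Otimes>\<^sub>M \<nu>) ((\<lambda>x. x) -` A \<inter> space (\<mu> \<Otimes>\<^sub>M \<nu>))"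
      unfolding \<pi>_def using that s\<pi> by (intro emeasure_distr[OF id]) simp
    also have "(\<lambda>x. x) -` A \<inter> space (\<mu> \<Otimes>\<^sub>M \<nu>) = A" using sets.sets_into_space[OF sub[OF that]] by auto
    finally show ?thesis .
  qed
  have rect: "emeasure \<pi> (A \<times> B) = emeasure \<mu> A * emeasure \<nu> B"
    if "A \<times> B \<in> sets \<pi>" "A \<in> sets \<mu>" "B \<in> sets \<nu>" for A B
    using e\<pi>[OF that(1)] N.emeasure_pair_measure_Times[OF that(2,3)] by simp
  have "weak_haar E (\<lambda>p q. (f (fst p) (fst q), g (snd p) (snd q))) \<pi>"
  proof (rule weak_haarI)
    show "sets \<pi> = sets (borel_of E)" by (rule s\<pi>)
    fix p A assume p: "p \<in> topspace E" and A: "A \<in> sets \<pi>"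
    have p': "fst p \<in> topspace T" "snd p \<in> topspace S" using p unfolding tE mem_Times_iff by blast+
    note m1 = A.translate_measurable[OF T(3) p'(1)] and m2 = B.translate_measurable[OF S(3) p'(2)]
    note d1 = A.distr_translate[OF T(3) p'(1)] and d2 = B.distr_translate[OF S(3) p'(2)]
    let ?t = "\<lambda>(x, y). (f (fst p) x, g (snd p) y)"
    \<comment> \<open>Translation by \<open>p\<close> acts factorwise and fixes both factor
      measures, and the image of a product measure under a factorwise map is the product of the
      images.\<close>
    have eq: "\<mu> \<Otimes>\<^sub>M \<nu> = distr (\<mu> \<Otimes>\<^sub>M \<nu>) (\<mu> \<Otimes>\<^sub>M \<nu>) ?t"
      using pair_measure_distr[OF m1 m2] N.sigma_finite_measure_axioms unfolding d1 d2 by simp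
    have mt: "?t \<in> measurable (\<mu> \<Otimes>\<^sub>M \<nu>) (\<mu> \<Otimes>\<^sub>M \<nu>)" using m1 m2 by measurable
    have pre: "{h \<in> topspace E. (f (fst p) (fst h), g (snd p) (snd h)) \<in> A} = ?t -` A \<inter> space (\<mu> \<Otimes>\<^sub>M \<nu>)"
      by (auto simp: space_pair_measure tE spT spS)
    have "{h \<in> topspace E. (f (fst p) (fst h), g (snd p) (snd h)) \<in> A} \<in> sets \<pi>"
      by (rule E.translate_sets[OF s\<pi> A p])
    then have "emeasure \<pi> {h \<in> topspace E. (f (fst p) (fst h), g (snd p) (snd h)) \<in> A} =
        emeasure (\<mu> \<Otimes>\<^sub>M \<nu>) (?t -` A \<inter> space (\<mu> \<Otimes>\<^sub>M \<nu>))" using e\<pi> pre by simp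
    also have "\<dots> = emeasure (\<mu> \<Otimes>\<^sub>M \<nu>) A"
      by (subst (2) eq) (rule emeasure_distr[OF mt sub[OF A], symmetric])
    finally show "emeasure \<pi> {h \<in> topspace E. (f (fst p) (fst h), g (snd p) (snd h)) \<in> A} = emeasure \<pi> A"
      using e\<pi>[OF A] by simp
  next
    fix K assume K: "compactin E K"
    have K1: "compactin T (fst ` K)" and K2: "compactin S (snd ` K)"
      using image_compactin[OF K] continuous_map_fst continuous_map_snd unfolding E_def by blast+
    have KK: "compactin E (fst ` K \<times> snd ` K)" unfolding E_def using K1 K2 by (simp add: compactin_Times)
    then have s: "fst ` K \<times> snd ` K \<in> sets \<pi>" using E.compactin_closed closedin_borel s\<pi> by blast
    have "emeasure \<pi> K \<le> emeasure \<pi> (fst ` K \<times> snd ` K)"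
      using s by (intro emeasure_mono) force+
    also have "\<dots> = emeasure \<mu> (fst ` K) * emeasure \<nu> (snd ` K)"
      using closedin_borel[OF A.compactin_closed[OF K1]] closedin_borel[OF B.compactin_closed[OF K2]] sT sS
      by (intro rect[OF s]) simp_all
    also have "\<dots> < \<infinity>" using weak_haarD(3)[OF T(3) K1] weak_haarD(3)[OF S(3) K2] by (simp add: ennreal_mult_less_top)
    finally show "emeasure \<pi> K < \<infinity>" .
  next
    fix W assume W: "openin E W" "W \<noteq> {}"
    then obtain x y where "(x, y) \<in> W" by (metis ex_in_conv surj_pair)
    then obtain U V where UV: "openin T U" "openin S V" "x \<in> U" "y \<in> V" "U \<times> V \<subseteq> W"
      using W(1) unfolding E_def openin_prod_topology_alt by meson
    have "openin E (U \<times> V)" unfolding E_def using UV by (simp add: openin_prod_Times_iff)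
    then have s: "U \<times> V \<in> sets \<pi>" using openin_borel s\<pi> by simp
    have "emeasure \<mu> U > 0" "emeasure \<nu> V > 0"
      using weak_haarD(4)[OF T(3) UV(1)] weak_haarD(4)[OF S(3) UV(2)] UV by blast+
    then have "0 < emeasure \<mu> U * emeasure \<nu> V" by (simp add: ennreal_zero_less_mult_iff)
    also have "\<dots> = emeasure \<pi> (U \<times> V)" using rect[OF s opT[OF UV(1)] opS[OF UV(2)]] by simp
    also have "\<dots> \<le> emeasure \<pi> W" using UV(5) openin_borel[OF W(1)] s\<pi> by (intro emeasure_mono) auto
    finally show "0 < emeasure \<pi> W" .
  qed
  moreover have "A \<times> topspace S \<in> sets \<pi> \<and> emeasure \<pi> (A \<times> topspace S) = 0"
    if A: "A \<in> sets \<mu>" "emeasure \<mu> A = 0" for A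
  proof -
    have "fst \<in> measurable (borel_of E) (borel_of T)"
      unfolding E_def by (intro measurable_borel_of continuous_map_fst)
    from measurable_sets[OF this, of A] A sT have "fst -` A \<inter> topspace E \<in> sets \<pi>" using s\<pi> by simp
    moreover have "fst -` A \<inter> topspace E = A \<times> topspace S"
      using sets.sets_into_space[OF A(1)] spT tE by auto
    ultimately have s: "A \<times> topspace S \<in> sets \<pi>" by simp
    moreover have "topspace S \<in> sets \<nu>" using opS by blast
    ultimately show ?thesis using rect[OF s A(1)] A(2) by simp
  qed
  ultimately show ?thesis by blast
qed

lemma weak_haar_lborel: "weak_haar (euclidean :: 'g::euclidean_space topology) (+) lborel"
proof (rule weak_haarI)
  show s: "sets (lborel :: 'g measure) = sets (borel_of euclidean)"
    by (simp add: borel_of_def borel_def)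
  fix g :: 'g and A assume A: "A \<in> sets (lborel :: 'g measure)"
  have "emeasure lborel A = emeasure (distr lborel borel ((+) g)) A" by (simp add: lborel_distr_plus)
  also have "\<dots> = emeasure lborel ((+) g -` A \<inter> space lborel)" using A by (intro emeasure_distr) auto
  also have "(+) g -` A \<inter> space lborel = {h \<in> topspace euclidean. g + h \<in> A}" by auto
  finally show "emeasure lborel {h \<in> topspace euclidean. g + h \<in> A} = emeasure lborel A" by simp
next
  show "emeasure lborel K < \<infinity>" if "compactin euclidean K" for K :: "'g set"
    using that by (intro emeasure_compact_finite) simp
  show "0 < emeasure lborel V" if "openin euclidean V" "V \<noteq> {}" for V :: "'g set"
  proof -
    have "open V" using that by simp
    then have "\<not> negligible V" using that(2) by (rule open_not_negligible)
    moreover have "V \<in> sets borel" using \<open>open V\<close> by simp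
    ultimately have "emeasure lborel V \<noteq> 0"
      by (auto simp: negligible_iff_null_sets null_sets_def emeasure_completion)
    then show ?thesis by (simp add: zero_less_iff_neq_zero)
  qed
qed

lemma weak_haar_count_int: "weak_haar (euclidean :: int topology) (+) (count_space UNIV)"
proof (rule weak_haarI)
  have "A \<in> sets (borel_of (euclidean :: int topology))" for A
    by (rule openin_borel) (simp add: euclidean_int)
  then show "sets (count_space UNIV) = sets (borel_of (euclidean :: int topology))" by auto
  fix g :: int and A assume "A \<in> sets (count_space (UNIV :: int set))"
  have eq: "A = (+) g ` {h \<in> topspace euclidean. g + h \<in> A}"
  proof (intro equalityI subsetI)
    fix a assume "a \<in> A" then show "a \<in> (+) g ` {h \<in> topspace euclidean. g + h \<in> A}"
      by (intro image_eqI[of _ _ "a - g"]) auto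
  qed auto
  have "inj_on ((+) g) {h \<in> topspace euclidean. g + h \<in> A}" by simp
  then show "emeasure (count_space UNIV) {h \<in> topspace euclidean. g + h \<in> A} = emeasure (count_space UNIV) A"
    using card_image finite_image_iff eq by (metis (no_types, lifting) emeasure_count_space subset_UNIV)
next
  show "emeasure (count_space UNIV) K < \<infinity>" if "compactin euclidean K" for K :: "int set"
    using that unfolding euclidean_int by (simp add: compactin_discrete_topology of_nat_less_top)
  show "0 < emeasure (count_space UNIV) V" if "V \<noteq> {}" for V :: "int set"
    using that by (simp add: zero_less_iff_neq_zero emeasure_count_space_eq_0)
qed

section \<open>Push-forward of invariant measures to quotients\<close>

lemma lca_quotD:
  assumes "lca_quot T f z n N T' f' z' n' q"
  shows "lca_group T' f' z' n'" "second_countable T'" "continuous_map T T' q" "open_map T T' q"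
    "q ` topspace T = topspace T'" "a \<in> topspace T \<Longrightarrow> q a \<in> topspace T'"
    "a \<in> topspace T \<Longrightarrow> b \<in> topspace T \<Longrightarrow> q (f a b) = f' (q a) (q b)"
    "q z = z'" "a \<in> topspace T \<Longrightarrow> q (n a) = n' (q a)"
    "a \<in> topspace T \<Longrightarrow> b \<in> topspace T \<Longrightarrow> q a = q b \<longleftrightarrow> f a (n b) \<in> N"
  using assms unfolding lca_quot_def by blast+

context lca
begin

lemma quot_preimage_open:
  assumes q: "lca_quot T f z n N T' f' z' n' q" and V: "openin T' V" "V \<noteq> {}"
  shows "openin T {h \<in> H. q h \<in> V}" "{h \<in> H. q h \<in> V} \<noteq> {}"
proof -
  show "openin T {h \<in> H. q h \<in> V}"
    using lca_quotD(3)[OF q] V(1) by (rule openin_continuous_map_preimage)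
  obtain v where "v \<in> V" using V(2) by blast
  then have "v \<in> q ` H" using openin_subset[OF V(1)] lca_quotD(5)[OF q] by blast
  then show "{h \<in> H. q h \<in> V} \<noteq> {}" using \<open>v \<in> V\<close> by blast
qed

lemma quot_measurable:
  assumes q: "lca_quot T f z n N T' f' z' n' q" and weak_haar: "weak_haar T f \<mu>"
  shows "q \<in> measurable \<mu> (borel_of T')"
    and "A \<in> sets (borel_of T') \<Longrightarrow> {h \<in> H. q h \<in> A} \<in> sets \<mu>"
proof -
  show qm: "q \<in> measurable \<mu> (borel_of T')"
    using measurable_borel_of[OF lca_quotD(3)[OF q]] by (simp add: measurable_cong_sets[OF weak_haarD(1)[OF weak_haar] refl])
  show "{h \<in> H. q h \<in> A} \<in> sets \<mu>" if "A \<in> sets (borel_of T')"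
    using measurable_sets[OF qm that] weak_haar_space[OF weak_haar] by (simp add: vimage_def Int_def conj_commute)
qed

text \<open>\<open>q\<close> is open and the group is locally compact, so \<open>K\<close> is
  covered by finitely many images of open sets that lie in compact ones.\<close>

lemma quot_compact_lift:
  assumes q: "lca_quot T f z n N T' f' z' n' q" and K: "compactin T' K"
  obtains C where "compactin T C" "K \<subseteq> q ` C"
proof -
  note Q = lca_quotD[OF q]
  have "\<exists>V C. openin T V \<and> compactin T C \<and> h \<in> V \<and> V \<subseteq> C" if "h \<in> H" for h
    using locally_compact that unfolding locally_compact_space_def by blast
  then obtain V C where VC: "\<And>h. h \<in> H \<Longrightarrow> openin T (V h) \<and> compactin T (C h) \<and> h \<in> V h \<and> V h \<subseteq> C h"
    by metis
  have "openin T' (q ` V h)" if "h \<in> H" for h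
    using Q(4) VC[OF that] unfolding open_map_def by simp
  moreover have "K \<subseteq> (\<Union>h\<in>H. q ` V h)"
  proof
    fix k assume "k \<in> K"
    then have "k \<in> q ` H" using compactin_subset_topspace[OF K] Q(5) by blast
    then obtain h where h: "h \<in> H" "k = q h" by blast
    then show "k \<in> (\<Union>h\<in>H. q ` V h)" using VC[OF h(1)] by (intro UN_I[OF h(1)]) simp
  qed
  ultimately obtain F where F: "finite F" "F \<subseteq> H" "K \<subseteq> (\<Union>h\<in>F. q ` V h)"
    using compactin_subcover[OF K, of "H" "\<lambda>h. q ` V h"] by metis
  have "compactin T (\<Union>h\<in>F. C h)" using F VC by (intro compactin_Union) auto
  moreover have "K \<subseteq> q ` (\<Union>h\<in>F. C h)"
  proof
    fix k assume "k \<in> K"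
    then obtain h where h: "h \<in> F" "k \<in> q ` V h" using F(3) by blast
    then have "V h \<subseteq> C h" using VC F(2) by blast
    then show "k \<in> q ` (\<Union>h\<in>F. C h)" using h by blast
  qed
  ultimately show ?thesis by (rule that)
qed

text \<open>Compactness of \<open>N\<close> keeps the image measure finite on compact sets: the
  preimage of \<open>K\<close> lies in the sum of a compact lift \<open>C\<close> and
  \<open>N\<close>. For noncompact \<open>N\<close> this breaks down, and a fundamental domain is
  used instead.\<close>

lemma weak_haar_push_compact:
  assumes q: "lca_quot T f z n N T' f' z' n' q" and N: "compactin T N" and weak_haar: "weak_haar T f \<mu>"
  shows "weak_haar T' f' (distr \<mu> (borel_of T') q)"
    and "A \<in> sets (borel_of T') \<Longrightarrow> emeasure (distr \<mu> (borel_of T') q) A = emeasure \<mu> {h \<in> H. q h \<in> A}"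
proof -
  note Q = lca_quotD[OF q]
  note W = weak_haarD[OF weak_haar] and sp = weak_haar_space[OF weak_haar]
  note qm = quot_measurable(1)[OF q weak_haar] and pre = quot_measurable(2)[OF q weak_haar]
  have em: "emeasure (distr \<mu> (borel_of T') q) A = emeasure \<mu> {h \<in> H. q h \<in> A}"
    if "A \<in> sets (borel_of T')" for A
    using emeasure_distr[OF qm that] sp by (simp add: vimage_def Int_def conj_commute)
  interpret Q: lca T' f' z' n' by (rule lca.intro) (rule Q(1))
  have NT: "N \<subseteq> H" using N by (rule compactin_subset_topspace)
  show "weak_haar T' f' (distr \<mu> (borel_of T') q)"
  proof (rule weak_haarI)
    show "sets (distr \<mu> (borel_of T') q) = sets (borel_of T')" by simp
    fix g' A assume g': "g' \<in> topspace T'" and A: "A \<in> sets (distr \<mu> (borel_of T') q)"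
    obtain g where g: "g \<in> H" "g' = q g" using g' Q(5) by blast
    have A': "A \<in> sets (borel_of T')" using A by simp
    have tr: "{h \<in> topspace T'. f' g' h \<in> A} \<in> sets (borel_of T')"
      by (rule Q.translate_sets[OF refl A' g'])
    have "{h \<in> H. q h \<in> {h \<in> topspace T'. f' g' h \<in> A}} = {h \<in> H. g \<oplus> h \<in> {h \<in> H. q h \<in> A}}"
      using g Q(6,7) by auto
    then show "emeasure (distr \<mu> (borel_of T') q) {h \<in> topspace T'. f' g' h \<in> A} = emeasure (distr \<mu> (borel_of T') q) A"
      using em[OF tr] em[OF A'] W(2)[OF g(1) pre[OF A']] by simp
  next
    fix K assume K: "compactin T' K"
    obtain C where C: "compactin T C" "K \<subseteq> q ` C" using quot_compact_lift[OF q K] by metis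
    have CT: "C \<subseteq> H" using C(1) by (rule compactin_subset_topspace)
    have KK: "K \<in> sets (borel_of T')" using Q.compactin_closed[OF K] by (rule closedin_borel)
    let ?D = "{a \<oplus> b |a b. a \<in> C \<and> b \<in> N}"
    have D: "compactin T ?D" by (rule compactin_sum[OF C(1) N])
    have "{h \<in> H. q h \<in> K} \<subseteq> ?D"
    proof
      fix h assume "h \<in> {h \<in> H. q h \<in> K}"
      then obtain c where c: "h \<in> H" "c \<in> C" "q h = q c" using C(2) by blast
      then have "h \<oplus> n c \<in> N" using Q(10) CT by blast
      moreover have "h = c \<oplus> (h \<oplus> n c)" using c CT by (simp add: subset_iff)
      ultimately show "h \<in> ?D" using c(2) by blast
    qed
    moreover have "?D \<in> sets \<mu>" using closedin_borel[OF compactin_closed[OF D]] W(1) by simp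
    ultimately have "emeasure \<mu> {h \<in> H. q h \<in> K} \<le> emeasure \<mu> ?D" by (rule emeasure_mono)
    also have "\<dots> < \<infinity>" by (rule W(3)[OF D])
    finally show "emeasure (distr \<mu> (borel_of T') q) K < \<infinity>" using em[OF KK] by simp
  next
    fix V assume V: "openin T' V" "V \<noteq> {}"
    have "0 < emeasure \<mu> {h \<in> H. q h \<in> V}" by (intro W(4) quot_preimage_open[OF q V])
    then show "0 < emeasure (distr \<mu> (borel_of T') q) V" using em[OF openin_borel[OF V(1)]] by simp
  qed
  show "A \<in> sets (borel_of T') \<Longrightarrow> emeasure (distr \<mu> (borel_of T') q) A = emeasure \<mu> {h \<in> H. q h \<in> A}"
    by (rule em)
qed

lemma emeasure_partition:
  assumes "countable N" "\<And>p. p \<in> N \<Longrightarrow> D p \<in> sets \<mu>" "A \<in> sets \<mu>"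
    and "\<And>h. h \<in> space \<mu> \<Longrightarrow> \<exists>!p. p \<in> N \<and> h \<in> D p"
  shows "emeasure \<mu> A = (\<integral>\<^sup>+p. emeasure \<mu> (A \<inter> D p) \<partial>count_space N)"
proof -
  have "emeasure \<mu> (\<Union>p\<in>N. A \<inter> D p) = (\<integral>\<^sup>+p. emeasure \<mu> (A \<inter> D p) \<partial>count_space N)"
  proof (rule emeasure_UN_countable)
    show "disjoint_family_on (\<lambda>p. A \<inter> D p) N"
      unfolding disjoint_family_on_def
    proof (intro ballI impI)
      fix p p' assume p: "p \<in> N" "p' \<in> N" "p \<noteq> p'"
      show "A \<inter> D p \<inter> (A \<inter> D p') = {}"
      proof (rule ccontr)
        assume "A \<inter> D p \<inter> (A \<inter> D p') \<noteq> {}"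
        then obtain h where "h \<in> A" "h \<in> D p" "h \<in> D p'" by blast
        moreover from this have "h \<in> space \<mu>" using sets.sets_into_space[OF assms(3)] by blast
        ultimately show False using assms(4) p by blast
      qed
    qed
  qed (use assms in auto)
  moreover have "(\<Union>p\<in>N. A \<inter> D p) = A"
    using sets.sets_into_space[OF assms(3)] assms(4) by blast
  ultimately show ?thesis by simp
qed

text \<open>The measure of a Borel set of the quotient is the measure of its preimage inside the
  fundamental domain \<open>F\<close>.\<close>

lemma weak_haar_push_fundamental_domain:
  assumes q: "lca_quot T f z n N T' f' z' n' q" and N: "subgrp N" "countable N" and weak_haar: "weak_haar T f \<mu>"
    and F: "F \<in> sets \<mu>" "\<And>h. h \<in> H \<Longrightarrow> \<exists>!p. p \<in> N \<and> p \<oplus> h \<in> F"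
  shows "\<exists>\<mu>'. weak_haar T' f' \<mu>' \<and>
    (\<forall>A B. A \<in> sets \<mu>' \<and> B \<in> sets \<mu> \<and> emeasure \<mu> B = 0 \<and> A \<subseteq> q ` B \<longrightarrow> emeasure \<mu>' A = 0)"
proof -
  note Q = lca_quotD[OF q]
  note W = weak_haarD[OF weak_haar] and sp = weak_haar_space[OF weak_haar]
  have NT: "N \<subseteq> H" using N(1) unfolding subgrp_def by blast
  have Nn: "n p \<in> N" if "p \<in> N" for p using that N(1) unfolding subgrp_def by blast
  have FT: "F \<subseteq> H" using sets.sets_into_space[OF F(1)] sp by simp
  interpret Q: lca T' f' z' n' by (rule lca.intro) (rule Q(1))
  note qm = quot_measurable(1)[OF q weak_haar] and pre = quot_measurable(2)[OF q weak_haar]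
  define \<mu>' where "\<mu>' = distr (restrict_space \<mu> F) (borel_of T') q"
  have em: "emeasure \<mu>' A = emeasure \<mu> (F \<inter> {h \<in> H. q h \<in> A})"
    if "A \<in> sets (borel_of T')" for A
  proof -
    have "emeasure \<mu>' A = emeasure (restrict_space \<mu> F) (q -` A \<inter> space (restrict_space \<mu> F))"
      unfolding \<mu>'_def by (rule emeasure_distr[OF measurable_restrict_space1[OF qm] that])
    also have "q -` A \<inter> space (restrict_space \<mu> F) = F \<inter> {h \<in> H. q h \<in> A}"
      using sp FT by (auto simp: space_restrict_space)
    also have "emeasure (restrict_space \<mu> F) (F \<inter> {h \<in> H. q h \<in> A}) =
        emeasure \<mu> (F \<inter> {h \<in> H. q h \<in> A})"
      using F(1) by (intro emeasure_restrict_space) auto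
    finally show ?thesis .
  qed
  define D where "D p = {h \<in> H. p \<oplus> h \<in> F}" for p
  have Dm: "D p \<in> sets \<mu>" if "p \<in> H" for p
    unfolding D_def by (rule translate_sets[OF W(1) F(1) that])
  have Dpart: "\<exists>!p. p \<in> N \<and> h \<in> D p" if "h \<in> space \<mu>" for h
    using F(2)[of h] that sp unfolding D_def by simp
  have tm: "{h \<in> H. p \<oplus> h \<in> A} \<in> sets \<mu>" if "A \<in> sets \<mu>" "p \<in> H" for A p
    by (rule translate_sets[OF W(1) that])
  have qN: "q (p \<oplus> h) = q h" if "p \<in> N" "h \<in> H" for p h
    using Q(10)[of "p \<oplus> h" h] that NT by (auto simp: subset_iff)
  have "weak_haar T' f' \<mu>'"
  proof (rule weak_haarI)
    show "sets \<mu>' = sets (borel_of T')" unfolding \<mu>'_def by simp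
    fix g' A assume g': "g' \<in> topspace T'" and "A \<in> sets \<mu>'"
    then have A: "A \<in> sets (borel_of T')" unfolding \<mu>'_def by simp
    obtain g where g: "g \<in> H" "g' = q g" using g' Q(5) by blast
    let ?B = "{h \<in> H. q h \<in> A}"
    have B: "?B \<in> sets \<mu>" by (rule pre[OF A])
    let ?A' = "{h \<in> topspace T'. f' g' h \<in> A}"
    have A': "?A' \<in> sets (borel_of T')" by (rule Q.translate_sets[OF refl A g'])
    \<comment> \<open>\<open>?Fg\<close> is the translate of \<open>F\<close> by \<open>g\<close>,
      again a fundamental domain, and two such domains see the same measure of the
      \<open>N\<close>-invariant set \<open>?B\<close>: cut \<open>?Fg\<close> along the translates
      \<open>D p\<close> of \<open>F\<close> and move each piece by \<open>p\<close> into
      \<open>F\<close>. The moved pieces partition \<open>F \<inter> ?B\<close>.\<close>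
    let ?Fg = "{h \<in> H. n g \<oplus> h \<in> F}"
    have Fg: "?Fg \<in> sets \<mu>" using tm[OF F(1)] g by simp
    have "emeasure \<mu> (F \<inter> {h \<in> H. q h \<in> ?A'}) =
        emeasure \<mu> {h \<in> H. n g \<oplus> h \<in> F \<inter> {h \<in> H. q h \<in> ?A'}}"
      using W(2)[of "n g" "F \<inter> {h \<in> H. q h \<in> ?A'}"] g F(1) pre[OF A'] by simp
    also have "{h \<in> H. n g \<oplus> h \<in> F \<inter> {h \<in> H. q h \<in> ?A'}} = ?Fg \<inter> ?B"
    proof -
      have "q (n g \<oplus> h) \<in> ?A' \<longleftrightarrow> q h \<in> A" if "h \<in> H" for h
      proof -
        have "f' g' (q (n g \<oplus> h)) = q (g \<oplus> (n g \<oplus> h))"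
          using g that by (simp only: Q(7) add_closed neg_closed)
        also have "\<dots> = q h" using g that by simp
        finally show ?thesis using Q(6)[of "n g \<oplus> h"] g that by simp
      qed
      then show ?thesis using g by auto
    qed
    also have "emeasure \<mu> (?Fg \<inter> ?B) = (\<integral>\<^sup>+p. emeasure \<mu> (?Fg \<inter> ?B \<inter> D p) \<partial>count_space N)"
      using N(2) Dm NT Fg B Dpart by (intro emeasure_partition) auto
    also have "\<dots> = (\<integral>\<^sup>+p. emeasure \<mu> (F \<inter> ?B \<inter> {h \<in> H. n g \<oplus> (n p \<oplus> h) \<in> F}) \<partial>count_space N)"
    proof (intro nn_integral_cong)
      fix p assume "p \<in> space (count_space N)"
      then have p: "p \<in> N" "p \<in> H" using NT by auto
      have "emeasure \<mu> (?Fg \<inter> ?B \<inter> D p) = emeasure \<mu> {h \<in> H. n p \<oplus> h \<in> ?Fg \<inter> ?B \<inter> D p}"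
        using W(2)[of "n p" "?Fg \<inter> ?B \<inter> D p"] p Fg B Dm by simp
      also have "{h \<in> H. n p \<oplus> h \<in> ?Fg \<inter> ?B \<inter> D p} = F \<inter> ?B \<inter> {h \<in> H. n g \<oplus> (n p \<oplus> h) \<in> F}"
        using p qN[OF Nn[OF p(1)]] FT unfolding D_def by auto
      finally show "emeasure \<mu> (?Fg \<inter> ?B \<inter> D p) =
        emeasure \<mu> (F \<inter> ?B \<inter> {h \<in> H. n g \<oplus> (n p \<oplus> h) \<in> F})" .
    qed
    also have "\<dots> = emeasure \<mu> (F \<inter> ?B)"
    proof (rule emeasure_partition[symmetric])
      show "countable N" by (rule N(2))
      show "F \<inter> ?B \<in> sets \<mu>" using F B by simp
      fix p assume p: "p \<in> N"
      have "{h \<in> H. n p \<oplus> h \<in> ?Fg} \<in> sets \<mu>"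
        using tm[OF Fg neg_closed[OF subsetD[OF NT p]]] .
      moreover have "{h \<in> H. n p \<oplus> h \<in> ?Fg} = {h \<in> H. n g \<oplus> (n p \<oplus> h) \<in> F}"
        using p NT by auto
      ultimately show "{h \<in> H. n g \<oplus> (n p \<oplus> h) \<in> F} \<in> sets \<mu>" by simp
    next
      fix h assume "h \<in> space \<mu>"
      then have h: "h \<in> H" using sp by simp
      have eq: "n g \<oplus> (p \<oplus> h) = p \<oplus> (n g \<oplus> h)" if "p \<in> H" for p
        using that g h by (intro lcomm) auto
      obtain p where p: "p \<in> N" "p \<oplus> (n g \<oplus> h) \<in> F" "\<And>p'. p' \<in> N \<Longrightarrow> p' \<oplus> (n g \<oplus> h) \<in> F \<Longrightarrow> p' = p"
        using F(2)[of "n g \<oplus> h"] g h add_closed neg_closed by metis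
      have pT: "p \<in> H" using NT p(1) by (rule subsetD)
      show "\<exists>!p. p \<in> N \<and> h \<in> {h \<in> H. n g \<oplus> (n p \<oplus> h) \<in> F}"
      proof (rule ex1I[of _ "n p"])
        show "n p \<in> N \<and> h \<in> {h \<in> H. n g \<oplus> (n (n p) \<oplus> h) \<in> F}"
          using p(1,2) h Nn[OF p(1)] eq[OF pT] pT by simp
        fix r assume r: "r \<in> N \<and> h \<in> {h \<in> H. n g \<oplus> (n r \<oplus> h) \<in> F}"
        then have rT: "r \<in> H" and nr: "n r \<in> N" using NT Nn by blast+
        have "n r \<oplus> (n g \<oplus> h) \<in> F" using r eq[OF neg_closed[OF rT]] by simp
        with nr have "n r = p" by (rule p(3))
        then show "r = n p" using neg_neg[OF rT] by simp
      qed
    qed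
    finally show "emeasure \<mu>' ?A' = emeasure \<mu>' A" using em[OF A] em[OF A'] by simp
  next
    fix K assume K: "compactin T' K"
    obtain C where C: "compactin T C" "K \<subseteq> q ` C" using quot_compact_lift[OF q K] by metis
    have CT: "C \<subseteq> H" using C(1) by (rule compactin_subset_topspace)
    have KK: "K \<in> sets (borel_of T')" using Q.compactin_closed[OF K] by (rule closedin_borel)
    have Cm: "C \<in> sets \<mu>" using closedin_borel[OF compactin_closed[OF C(1)]] W(1) by simp
    \<comment> \<open>The part of \<open>F\<close> covered by the translate of \<open>C\<close> by
      \<open>p\<close>. Infinitely many \<open>p\<close> may contribute, but moving the pieces back
      turns the sum of their measures into the sum over the partition of \<open>C\<close> by the
      sets \<open>D p\<close>, which is the finite measure of \<open>C\<close>.\<close>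
    let ?S = "\<lambda>p. F \<inter> {h \<in> H. n p \<oplus> h \<in> C}"
    have Sm: "?S p \<in> sets \<mu>" if "p \<in> N" for p using F(1) tm[OF Cm, of "n p"] that NT by auto
    have sub: "F \<inter> {h \<in> H. q h \<in> K} \<subseteq> (\<Union>p\<in>N. ?S p)"
    proof
      fix h assume h: "h \<in> F \<inter> {h \<in> H. q h \<in> K}"
      then obtain c where c: "c \<in> C" "q h = q c" using C(2) by blast
      then have p: "h \<oplus> n c \<in> N" using Q(10)[of h c] h CT by blast
      have "n (h \<oplus> n c) \<oplus> h = c" using h c CT by (auto simp: neg_sub)
      then show "h \<in> (\<Union>p\<in>N. ?S p)" using h c p by (intro UN_I[OF p]) simp
    qed
    have Um: "(\<Union>p\<in>N. ?S p) \<in> sets \<mu>" using N(2) Sm by (intro sets.countable_UN'')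
    have "emeasure \<mu>' K \<le> emeasure \<mu> (\<Union>p\<in>N. ?S p)"
      unfolding em[OF KK] using sub Um by (rule emeasure_mono)
    also have "\<dots> = (\<integral>\<^sup>+h. indicator (\<Union>p\<in>N. ?S p) h \<partial>\<mu>)" using Um by simp
    also have "\<dots> \<le> (\<integral>\<^sup>+h. (\<integral>\<^sup>+p. indicator (?S p) h \<partial>count_space N) \<partial>\<mu>)"
    proof (intro nn_integral_mono)
      fix h
      show "indicator (\<Union>p\<in>N. ?S p) h \<le> (\<integral>\<^sup>+p. indicator (?S p) h \<partial>count_space N)"
      proof (cases "h \<in> (\<Union>p\<in>N. ?S p)")
        case True
        then obtain p where p: "p \<in> N" "h \<in> ?S p" by blast
        then show ?thesis using nn_integral_ge_point[OF p(1), of "\<lambda>p. indicator (?S p) h"] True by simp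
      qed simp
    qed
    also have "\<dots> = (\<integral>\<^sup>+p. (\<integral>\<^sup>+h. indicator (?S p) h \<partial>\<mu>) \<partial>count_space N)"
      using N(2) Sm by (intro nn_integral_count_space_nn_integral) (auto intro!: borel_measurable_indicator)
    also have "\<dots> = (\<integral>\<^sup>+p. emeasure \<mu> (C \<inter> D p) \<partial>count_space N)"
    proof (intro nn_integral_cong)
      fix p assume "p \<in> space (count_space N)"
      then have p: "p \<in> N" "p \<in> H" using NT by auto
      have "(\<integral>\<^sup>+h. indicator (?S p) h \<partial>\<mu>) = emeasure \<mu> (?S p)" using Sm[OF p(1)] by simp
      also have "\<dots> = emeasure \<mu> {h \<in> H. p \<oplus> h \<in> ?S p}"
        using W(2)[OF p(2) Sm[OF p(1)]] by simp
      also have "{h \<in> H. p \<oplus> h \<in> ?S p} = C \<inter> D p" using p CT unfolding D_def by auto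
      finally show "(\<integral>\<^sup>+h. indicator (?S p) h \<partial>\<mu>) = emeasure \<mu> (C \<inter> D p)" .
    qed
    also have "\<dots> = emeasure \<mu> C"
      using N(2) Dm NT Cm Dpart by (intro emeasure_partition[symmetric]) auto
    also have "\<dots> < \<infinity>" by (rule W(3)[OF C(1)])
    finally show "emeasure \<mu>' K < \<infinity>" .
  next
    fix V assume V: "openin T' V" "V \<noteq> {}"
    let ?B = "{h \<in> H. q h \<in> V}"
    have B: "openin T ?B" "?B \<noteq> {}" by (rule quot_preimage_open[OF q V])+
    then have Bm: "?B \<in> sets \<mu>" using openin_borel W(1) by simp
    have pos: "0 < emeasure \<mu> ?B" by (rule W(4)[OF B])
    show "0 < emeasure \<mu>' V"
    proof (rule ccontr)
      assume "\<not> 0 < emeasure \<mu>' V"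
      then have 0: "emeasure \<mu> (F \<inter> ?B) = 0" using em[OF openin_borel[OF V(1)]] by (simp add: zero_less_iff_neq_zero)
      \<comment> \<open>Since \<open>?B\<close> is \<open>N\<close>-invariant, each of its pieces in
        \<open>D p\<close> is a translate of \<open>F \<inter> ?B\<close>; if that were null, so
        would be the nonempty open set \<open>?B\<close>.\<close>
      have "emeasure \<mu> ?B = (\<integral>\<^sup>+p. emeasure \<mu> (?B \<inter> D p) \<partial>count_space N)"
        using N(2) Dm NT Bm Dpart by (intro emeasure_partition) auto
      also have "\<dots> = (\<integral>\<^sup>+p. 0 \<partial>count_space N)"
      proof (intro nn_integral_cong)
        fix p assume "p \<in> space (count_space N)"
        then have p: "p \<in> N" "p \<in> H" using NT by auto
        have "{h \<in> H. p \<oplus> h \<in> F \<inter> ?B} = ?B \<inter> D p" using p qN unfolding D_def by auto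
        then show "emeasure \<mu> (?B \<inter> D p) = 0" using W(2)[OF p(2), of "F \<inter> ?B"] F(1) Bm 0 by simp
      qed
      finally show False using pos by simp
    qed
  qed
  moreover have "emeasure \<mu>' A = 0"
    if A: "A \<in> sets \<mu>'" "B \<in> sets \<mu>" "emeasure \<mu> B = 0" "A \<subseteq> q ` B" for A B
  proof -
    have A': "A \<in> sets (borel_of T')" using A(1) unfolding \<mu>'_def by simp
    have BT: "B \<subseteq> H" using sets.sets_into_space[OF A(2)] sp by simp
    \<comment> \<open>The saturation of \<open>B\<close>: a union of countably many translates of a
      null set. It contains the part of the preimage of \<open>A\<close> in
      \<open>F\<close>.\<close>
    have "(\<Union>p\<in>N. {h \<in> H. n p \<oplus> h \<in> B}) \<in> null_sets \<mu>"
    proof (rule null_sets_UN'[OF N(2)])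
      fix p assume "p \<in> N"
      then have p: "n p \<in> H" using NT by auto
      show "{h \<in> H. n p \<oplus> h \<in> B} \<in> null_sets \<mu>"
        using tm[OF A(2) p] W(2)[OF p A(2)] A(3) by (simp add: null_sets_def)
    qed
    moreover have "F \<inter> {h \<in> H. q h \<in> A} \<in> sets \<mu>" using F(1) pre[OF A'] by simp
    moreover have "F \<inter> {h \<in> H. q h \<in> A} \<subseteq> (\<Union>p\<in>N. {h \<in> H. n p \<oplus> h \<in> B})"
    proof
      fix h assume h: "h \<in> F \<inter> {h \<in> H. q h \<in> A}"
      then obtain b where b: "b \<in> B" "q h = q b" using A(4) by blast
      then have p: "h \<oplus> n b \<in> N" using Q(10)[of h b] h BT by blast
      have "n (h \<oplus> n b) \<oplus> h = b" using h b BT by (auto simp: neg_sub)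
      then show "h \<in> (\<Union>p\<in>N. {h \<in> H. n p \<oplus> h \<in> B})" using h b p by (intro UN_I[OF p]) simp
    qed
    ultimately have "F \<inter> {h \<in> H. q h \<in> A} \<in> null_sets \<mu>" by (rule null_sets_subset)
    then show ?thesis unfolding em[OF A'] by (simp add: null_sets_def)
  qed
  ultimately show ?thesis by blast
qed

end

section \<open>Cut-and-project schemes of quotients\<close>

lemma second_countable_euclidean: "second_countable (euclidean :: 'a::second_countable_topology topology)"
proof -
  obtain B :: "'a set set" where B: "countable B" "\<And>C. C \<in> B \<Longrightarrow> open C" "\<And>S. open S \<Longrightarrow> \<exists>U. U \<subseteq> B \<and> S = \<Union>U"
    using univ_second_countable by blast
  have "\<exists>V\<in>B. x \<in> V \<and> V \<subseteq> U" if "open U" "x \<in> U" for U x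
    using B(3)[OF that(1)] that(2) by blast
  with B(1,2) show ?thesis unfolding second_countable_def by (intro exI[of _ B]) simp
qed

lemma cpsD:
  assumes "cps T f z n L"
  shows "lca_group T f z n" "L \<subseteq> UNIV \<times> topspace T" "(0, z) \<in> L"
    "p \<in> L \<Longrightarrow> p' \<in> L \<Longrightarrow> (fst p + fst p', f (snd p) (snd p')) \<in> L"
    "p \<in> L \<Longrightarrow> (- fst p, n (snd p)) \<in> L" "inj_on fst L"
    "compactin T C \<Longrightarrow> finite {p\<in>L. norm (fst p) \<le> r \<and> snd p \<in> C}"
    "\<exists>r C. compactin T C \<and> (\<forall>g. \<forall>h\<in>topspace T. \<exists>p\<in>L. norm (g - fst p) \<le> r \<and> f h (n (snd p)) \<in> C)"
    "T closure_of (snd ` L) = topspace T" "p \<in> L \<Longrightarrow> snd p \<in> topspace T"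
    "p \<in> L \<Longrightarrow> p' \<in> L \<Longrightarrow> (fst p - fst p', f (snd p) (n (snd p'))) \<in> L"
    "openin T V \<Longrightarrow> V \<noteq> {} \<Longrightarrow> \<exists>p\<in>L. snd p \<in> V"
proof -
  note a = assms[unfolded cps_def padd_def]
  show "lca_group T f z n" "L \<subseteq> UNIV \<times> topspace T" "(0, z) \<in> L" "inj_on fst L"
    "T closure_of (snd ` L) = topspace T"
    "\<exists>r C. compactin T C \<and> (\<forall>g. \<forall>h\<in>topspace T. \<exists>p\<in>L. norm (g - fst p) \<le> r \<and> f h (n (snd p)) \<in> C)"
    using a by simp_all
  show add: "(fst p + fst p', f (snd p) (snd p')) \<in> L" if "p \<in> L" "p' \<in> L" for p p' using a that by blast
  show neg: "(- fst p, n (snd p)) \<in> L" if "p \<in> L" for p using a that by blast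
  show "finite {p\<in>L. norm (fst p) \<le> r \<and> snd p \<in> C}" if "compactin T C" using a that by blast
  show "snd p \<in> topspace T" if "p \<in> L" using that \<open>L \<subseteq> UNIV \<times> topspace T\<close> by (auto simp: mem_Times_iff)
  show "(fst p - fst p', f (snd p) (n (snd p'))) \<in> L" if "p \<in> L" "p' \<in> L"
    using add[OF that(1) neg[OF that(2)]] by simp
  show "\<exists>p\<in>L. snd p \<in> V" if "openin T V" "V \<noteq> {}"
  proof -
    have "snd ` L \<inter> V \<noteq> {}" using \<open>T closure_of (snd ` L) = topspace T\<close> that unfolding dense_intersects_open by simp
    then show ?thesis by blast
  qed
qed

text \<open>Local finiteness exhausts \<open>L\<close> by countably many finite sets as soon as the
  internal group is sigma-compact.\<close>

lemma cps_countable: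
  assumes "cps T f z n L" and K: "\<And>i. compactin T (K (i::nat))" "(\<Union>i. K i) = topspace T"
  shows "countable L"
proof -
  have "L \<subseteq> (\<Union>i. \<Union>r. {p\<in>L. norm (fst p) \<le> real r \<and> snd p \<in> K i})"
  proof
    fix p assume p: "p \<in> L"
    then have "snd p \<in> (\<Union>i. K i)" using cpsD(10)[OF assms(1)] K(2) by simp
    then obtain i where "snd p \<in> K i" by (elim UN_E)
    moreover obtain r :: nat where "norm (fst p) \<le> real r" using real_arch_simple by blast
    ultimately show "p \<in> (\<Union>i. \<Union>r. {p\<in>L. norm (fst p) \<le> real r \<and> snd p \<in> K i})" using p by blast
  qed
  moreover have "countable (\<Union>i. \<Union>r::nat. {p\<in>L. norm (fst p) \<le> real r \<and> snd p \<in> K i})"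
    using cpsD(7)[OF assms(1) K(1)] by (intro countable_UN countableI_type countable_finite)
  ultimately show ?thesis by (rule countable_subset)
qed

lemma cps_countable_second_countable:
  assumes "cps T f z n L" "second_countable T"
  shows "countable L"
proof -
  interpret lca T f z n by (rule lca.intro[OF cpsD(1)[OF assms(1)]])
  from open_sigma_compact[OF assms(2) openin_topspace] obtain K where
    K: "\<forall>i. compactin T (K i)" "incseq K" "(\<Union>i. K i) = topspace T"
    by (elim exE conjE)
  show ?thesis by (rule cps_countable[OF assms(1), of K]) (use K in simp_all)
qed

context lca
begin

text \<open>Common to all passages to a quotient. \<open>M\<close> is the new lattice before
  division by \<open>N\<close>; it may contain several points over the same vector, and
  \<open>ker\<close> says that these merge in the quotient. This is why \<open>lf\<close> counts
  first components only: after division they determine the lattice point.\<close>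

lemma cps_quotient:
  fixes M :: "('g::euclidean_space \<times> 'a) set"
  assumes q: "lca_quot T f z n N T' f' z' n' q" and N: "subgrp N"
    and M: "M \<subseteq> UNIV \<times> H" "(0, z) \<in> M" "\<And>p p'. p \<in> M \<Longrightarrow> p' \<in> M \<Longrightarrow> (fst p + fst p', snd p \<oplus> snd p') \<in> M"
      "\<And>p. p \<in> M \<Longrightarrow> (- fst p, n (snd p)) \<in> M"
    and ker: "\<And>p. p \<in> M \<Longrightarrow> fst p = 0 \<Longrightarrow> snd p \<in> N"
    and lf: "\<And>r C. compactin T C \<Longrightarrow> finite (fst ` {p \<in> M. norm (fst p) \<le> r \<and> (\<exists>v\<in>N. snd p \<oplus> v \<in> C)})"
    and rd: "compactin T C" "\<And>g h. h \<in> H \<Longrightarrow> \<exists>p\<in>M. norm (g - fst p) \<le> r \<and> h \<oplus> n (snd p) \<in> C"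
    and dense: "\<And>V. openin T V \<Longrightarrow> V \<noteq> {} \<Longrightarrow> \<exists>p\<in>M. snd p \<in> V"
  shows "cps T' f' z' n' ((\<lambda>p. (fst p, q (snd p))) ` M)"
proof -
  note Q = lca_quotD[OF q]
  let ?L = "(\<lambda>p. (fst p, q (snd p))) ` M"
  have MT: "snd p \<in> H" if "p \<in> M" for p using that M(1) by (auto simp: mem_Times_iff)
  have eq: "q (snd p) = q (snd p')" if "p \<in> M" "p' \<in> M" "fst p = fst p'" for p p'
  proof -
    have "(fst p + - fst p', snd p \<oplus> n (snd p')) \<in> M" using M(3)[OF that(1) M(4)[OF that(2)]] by simp
    then have "snd p \<oplus> n (snd p') \<in> N" using ker that(3) by fastforce
    then show ?thesis using Q(10)[OF MT[OF that(1)] MT[OF that(2)]] by simp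
  qed
  have inj: "inj_on fst ?L"
  proof (rule inj_onI)
    fix x y assume xy: "x \<in> ?L" "y \<in> ?L" and e: "fst x = fst y"
    obtain p where p: "p \<in> M" "x = (fst p, q (snd p))" using xy(1) by (elim imageE)
    obtain p' where p': "p' \<in> M" "y = (fst p', q (snd p'))" using xy(2) by (elim imageE)
    have "fst p = fst p'" using e p(2) p'(2) by simp
    then show "x = y" using eq[OF p(1) p'(1)] p(2) p'(2) by simp
  qed
  show ?thesis unfolding cps_def
  proof (intro conjI allI impI)
    show "lca_group T' f' z' n'" by (rule Q(1))
    show "?L \<subseteq> UNIV \<times> topspace T'" using Q(6) MT by auto
    show "(0, z') \<in> ?L" using M(2) Q(8) by (intro image_eqI[of _ _ "(0, z)"]) simp_all
    show "\<forall>p\<in>?L. \<forall>q\<in>?L. padd f' p q \<in> ?L"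
    proof (intro ballI)
      fix x y assume "x \<in> ?L" "y \<in> ?L"
      then obtain p p' where p: "p \<in> M" "x = (fst p, q (snd p))" "p' \<in> M" "y = (fst p', q (snd p'))" by blast
      then show "padd f' x y \<in> ?L"
        using M(3)[OF p(1,3)] Q(7)[OF MT MT, OF p(1,3)]
        by (intro image_eqI[of _ _ "(fst p + fst p', snd p \<oplus> snd p')"]) (simp_all add: padd_def)
    qed
    show "\<forall>p\<in>?L. (- fst p, n' (snd p)) \<in> ?L"
    proof (intro ballI)
      fix x assume "x \<in> ?L"
      then obtain p where p: "p \<in> M" "x = (fst p, q (snd p))" by blast
      then show "(- fst x, n' (snd x)) \<in> ?L"
        using M(4)[OF p(1)] Q(9)[OF MT, OF p(1)]
        by (intro image_eqI[of _ _ "(- fst p, n (snd p))"]) simp_all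
    qed
    show "inj_on fst ?L" by (rule inj)
    fix r K assume K: "compactin T' K"
    obtain C where C: "compactin T C" "K \<subseteq> q ` C" using quot_compact_lift[OF q K] by metis
    have CT: "C \<subseteq> H" using C(1) by (rule compactin_subset_topspace)
    let ?A = "{p \<in> ?L. norm (fst p) \<le> r \<and> snd p \<in> K}"
    have "fst ` ?A \<subseteq> fst ` {p \<in> M. norm (fst p) \<le> r \<and> (\<exists>v\<in>N. snd p \<oplus> v \<in> C)}"
    proof
      fix y assume "y \<in> fst ` ?A"
      then obtain p where p: "p \<in> M" "y = fst p" "norm (fst p) \<le> r" "q (snd p) \<in> K" by auto
      then obtain c where c: "c \<in> C" "q (snd p) = q c" using C(2) by blast
      have cT: "c \<in> H" using c(1) CT by blast
      have "c \<oplus> n (snd p) \<in> N" using Q(10)[OF cT MT[OF p(1)]] c(2) by simp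
      moreover have "snd p \<oplus> (c \<oplus> n (snd p)) = c" using cT MT[OF p(1)] by simp
      ultimately show "y \<in> fst ` {p \<in> M. norm (fst p) \<le> r \<and> (\<exists>v\<in>N. snd p \<oplus> v \<in> C)}"
        using p c(1) by (intro image_eqI[of _ _ p] CollectI conjI bexI[of _ "c \<oplus> n (snd p)"]) simp_all
    qed
    then have "finite (fst ` ?A)" using lf[OF C(1)] by (rule finite_subset)
    moreover have "inj_on fst ?A" using inj by (rule inj_on_subset) blast
    ultimately show "finite ?A" by (rule finite_imageD)
  next
    show "\<exists>r C. compactin T' C \<and> (\<forall>g. \<forall>h\<in>topspace T'. \<exists>p\<in>?L. norm (g - fst p) \<le> r \<and> f' h (n' (snd p)) \<in> C)"
    proof (intro exI conjI allI ballI)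
      show "compactin T' (q ` C)" by (rule image_compactin[OF rd(1) Q(3)])
      fix g h' assume "h' \<in> topspace T'"
      then obtain h where h: "h \<in> H" "h' = q h" using Q(5) by blast
      obtain p where p: "p \<in> M" "norm (g - fst p) \<le> r" "h \<oplus> n (snd p) \<in> C" using rd(2)[OF h(1)] by blast
      have "f' h' (n' (q (snd p))) = q (h \<oplus> n (snd p))"
        using h MT[OF p(1)] by (simp add: Q(7,9))
      then show "\<exists>p\<in>?L. norm (g - fst p) \<le> r \<and> f' h' (n' (snd p)) \<in> q ` C"
        using p by (intro bexI[of _ "(fst p, q (snd p))"]) auto
    qed
    show "T' closure_of snd ` ?L = topspace T'"
      unfolding dense_intersects_open
    proof (intro allI impI)
      fix V assume V: "openin T' V \<and> V \<noteq> {}"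
      let ?B = "{h \<in> H. q h \<in> V}"
      have "openin T ?B" "?B \<noteq> {}" using V quot_preimage_open[OF q] by blast+
      then obtain p where "p \<in> M" "snd p \<in> ?B" using dense by blast
      then show "snd ` ?L \<inter> V \<noteq> {}" by force
    qed
  qed
qed

end

section \<open>Windows between an open and a compact set\<close>

text \<open>The base point has the form \<open>(s, z)\<close>: its internal component is absorbed into the windows.\<close>

definition inter_model where
  "inter_model T f z n L s U W Lam \<longleftrightarrow> cps T f z n L \<and> openin T U \<and> U \<noteq> {} \<and> compactin T W \<and> U \<subseteq> W \<and>
     (\<forall>p\<in>L. snd p \<in> U \<longrightarrow> s + fst p \<in> Lam) \<and> (\<forall>y\<in>Lam. \<exists>p\<in>L. snd p \<in> W \<and> y = s + fst p)"

lemma inter_modelD: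
  assumes "inter_model T f z n L s U W Lam"
  shows "cps T f z n L" "openin T U" "U \<noteq> {}" "compactin T W" "U \<subseteq> W"
    "p \<in> L \<Longrightarrow> snd p \<in> U \<Longrightarrow> s + fst p \<in> Lam"
    "y \<in> Lam \<Longrightarrow> \<exists>p\<in>L. snd p \<in> W \<and> y = s + fst p"
    "U \<subseteq> topspace T" "W \<subseteq> topspace T"
  using assms openin_subset[of T U] compactin_subset_topspace[of T W] unfolding inter_model_def by blast+

text \<open>The measure is bound existentially because every change of scheme brings its own; only
  the existence of some invariant measure with this null set is passed on.\<close>

definition haar_null where
  "haar_null T f A \<longleftrightarrow> (\<exists>\<mu>. weak_haar T f \<mu> \<and> A \<in> sets \<mu> \<and> emeasure \<mu> A = 0)"

text \<open>Adding to \<open>U\<close> the star images of all points of \<open>Lam\<close> captures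
  \<open>Lam\<close>, and by \<open>star\<close> no lattice point outside \<open>Lam\<close> shares
  such an image. The added points lie in the closed set \<open>W\<close>, so the boundary of
  \<open>W'\<close> is inside \<open>W - U\<close> wherever they fall. They are countable, hence
  form a Borel set.\<close>

lemma inter_model_imp_witness:
  assumes d: "inter_model T f z n L 0 U W Lam" and sc: "second_countable T"
    and star: "\<And>p p'. p \<in> L \<Longrightarrow> p' \<in> L \<Longrightarrow> snd p = snd p' \<Longrightarrow> fst p = fst p'"
  shows "\<exists>W'. model_set_witness Lam T f z n L W' \<and>
    (haar_null T f (W - U) \<longrightarrow> (\<exists>\<mu>'. haar_measure T f \<mu>' \<and> emeasure \<mu>' (boundary_in T W') = 0))"
proof -
  note D = inter_modelD[OF d]
  note C = cpsD[OF D(1)]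
  interpret lca T f z n by (rule lca.intro[OF C(1)])
  define W' where "W' = U \<union> snd ` {p \<in> L. fst p \<in> Lam}"
  have eqI: "p = p'" if "p \<in> L" "p' \<in> L" "fst p = fst p'" for p p' using C(6) that by (simp add: inj_on_def)
  have W'W: "W' \<subseteq> W"
  proof -
    have "snd p \<in> W" if p: "p \<in> L" "fst p \<in> Lam" for p
    proof -
      obtain p' where "p' \<in> L" "snd p' \<in> W" "fst p = fst p'" using D(7)[OF p(2)] by auto
      then show ?thesis using eqI[OF p(1)] by simp
    qed
    then show ?thesis using D(5) unfolding W'_def by blast
  qed
  have clW: "T closure_of W' \<subseteq> W" using W'W compactin_closed[OF D(4)] by (rule closure_of_minimal)
  have intW: "U \<subseteq> T interior_of W'" using D(2) by (intro interior_of_maximal) (auto simp: W'_def)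
  have "W' \<in> sets (borel_of T)"
  proof -
    have cnt: "countable (snd ` {p \<in> L. fst p \<in> Lam})"
      using cps_countable_second_countable[OF D(1) sc] by (auto intro: countable_subset)
    have "(\<Union>x\<in>snd ` {p \<in> L. fst p \<in> Lam}. {x}) \<in> sets (borel_of T)"
    proof (rule sets.countable_UN''[OF cnt])
      fix x assume "x \<in> snd ` {p \<in> L. fst p \<in> Lam}"
      then have "x \<in> topspace T" using C(10) by blast
      then show "{x} \<in> sets (borel_of T)" by (intro closedin_borel closedin_Hausdorff_singleton hausdorff)
    qed
    then show ?thesis unfolding W'_def using openin_borel[OF D(2)] by (intro sets.Un) simp_all
  qed
  moreover have "inj_on (star_map L) (fst ` L)"
  proof -
    have "star_map L (fst p) = snd p" if "p \<in> L" for p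
    proof -
      have "(THE p'. p' \<in> L \<and> fst p' = fst p) = p" using that eqI by (intro the_equality) auto
      then show ?thesis unfolding star_map_def by simp
    qed
    note st = this
    show ?thesis
    proof (rule inj_onI)
      fix x y assume "x \<in> fst ` L" "y \<in> fst ` L" and eq: "star_map L x = star_map L y"
      then obtain p p' where "p \<in> L" "x = fst p" "p' \<in> L" "y = fst p'" by blast
      then show "x = y" using star[of p p'] st eq by simp
    qed
  qed
  moreover have "Lam = fst ` (L \<inter> (UNIV \<times> W'))"
  proof (intro equalityI subsetI)
    fix y assume y: "y \<in> Lam"
    then obtain p where p: "p \<in> L" "y = 0 + fst p" using D(7) by blast
    then have "y = fst p" by simp
    then show "y \<in> fst ` (L \<inter> (UNIV \<times> W'))" using y p(1) unfolding W'_def by (intro image_eqI[of _ _ p]) (auto simp: mem_Times_iff)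
  next
    fix y assume "y \<in> fst ` (L \<inter> (UNIV \<times> W'))"
    then obtain p where p: "p \<in> L" "y = fst p" "snd p \<in> W'" by (auto simp: mem_Times_iff)
    show "y \<in> Lam"
    proof (cases "snd p \<in> U")
      case True then show ?thesis using D(6)[OF p(1)] p by simp
    next
      case False
      then obtain p' where "p' \<in> L" "fst p' \<in> Lam" "snd p = snd p'" using p(3) unfolding W'_def by blast
      then show ?thesis using star[OF p(1)] p(2) by simp
    qed
  qed
  moreover have "compactin T (T closure_of W')"
    using clW by (intro closed_compactin[OF D(4)]) simp_all
  moreover have "T interior_of W' \<noteq> {}" using intW D(3) by blast
  moreover have "W' \<subseteq> topspace T" using W'W D(9) by blast
  ultimately have "model_set_witness Lam T f z n L W'"
    unfolding model_set_witness_def using cps_imp_cp_scheme[OF D(1)] sc by blast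
  moreover have "\<exists>\<mu>'. haar_measure T f \<mu>' \<and> emeasure \<mu>' (boundary_in T W') = 0" if hn: "haar_null T f (W - U)"
  proof -
    obtain \<mu> where mu: "weak_haar T f \<mu>" "W - U \<in> sets \<mu>" "emeasure \<mu> (W - U) = 0" using hn unfolding haar_null_def by blast
    have "boundary_in T W' \<subseteq> W - U" unfolding boundary_in_def using clW intW by blast
    then have "emeasure \<mu> (boundary_in T W') \<le> emeasure \<mu> (W - U)" using mu(2) by (rule emeasure_mono)
    then show ?thesis using weak_haar_imp_haar_measure[OF sc mu(1)] mu(3) by (intro exI[of _ \<mu>]) simp
  qed
  ultimately show ?thesis by blast
qed

text \<open>Shared by the integer and the circle constructions. The second factors \<open>A\<close>
  and \<open>B\<close> differ because one window has to be open and the other compact;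
  \<open>red\<close> says that modulo \<open>P\<close> nothing of \<open>B\<close> is lost in
  \<open>A\<close> over \<open>U\<close>.\<close>

lemma product_quotient_window:
  assumes T: "lca_group T f z n" "second_countable T" and S: "lca_group S g w m" "second_countable S" "weak_haar S g \<nu>"
  defines "E \<equiv> prod_topology T S"
    and "fE \<equiv> \<lambda>p q. (f (fst p) (fst q), g (snd p) (snd q))" and "nE \<equiv> \<lambda>p. (n (fst p), m (snd p))"
  assumes q: "lca_quot E fE (z, w) nE P T' f' z' n' q" and P: "lca.subgrp E fE (z, w) nE P" "countable P"
    and F: "F \<in> sets (borel_of E)" "\<forall>h\<in>topspace E. \<exists>!p. p \<in> P \<and> fE p h \<in> F"
    and UW: "openin T U" "compactin T W" and AB: "openin S A" "compactin S B"
    and red: "q ` (U \<times> B) \<subseteq> q ` (U \<times> A)"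
  shows "openin T' (q ` (U \<times> A))" "compactin T' (q ` (W \<times> B))"
    "haar_null T f (W - U) \<longrightarrow> haar_null T' f' (q ` (W \<times> B) - q ` (U \<times> A))"
proof -
  note Q = lca_quotD[OF q]
  have gE: "lca_group E fE (z, w) nE" unfolding E_def fE_def nE_def by (rule lca_prod[OF T(1) S(1)])
  interpret E: lca E fE "(z, w)" nE by (rule lca.intro[OF gE])
  interpret T': lca T' f' z' n' by (rule lca.intro[OF Q(1)])
  have "openin E (U \<times> A)" unfolding E_def using UW(1) AB(1) by (simp add: openin_prod_Times_iff)
  then show op: "openin T' (q ` (U \<times> A))" using Q(4) unfolding open_map_def by simp
  have "compactin E (W \<times> B)" unfolding E_def using UW(2) AB(2) by (simp add: compactin_Times)
  then show cm: "compactin T' (q ` (W \<times> B))" using Q(3) by (rule image_compactin)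
  show "haar_null T f (W - U) \<longrightarrow> haar_null T' f' (q ` (W \<times> B) - q ` (U \<times> A))"
  proof
    assume "haar_null T f (W - U)"
    then obtain \<mu> where mu: "weak_haar T f \<mu>" "W - U \<in> sets \<mu>" "emeasure \<mu> (W - U) = 0" unfolding haar_null_def by blast
    obtain \<pi> where pi: "weak_haar E fE \<pi>" "(W - U) \<times> topspace S \<in> sets \<pi>" "emeasure \<pi> ((W - U) \<times> topspace S) = 0"
      using weak_haar_prod[OF T mu(1) S] mu(2,3) unfolding E_def fE_def by blast
    have "F \<in> sets \<pi>" using F(1) weak_haarD(1)[OF pi(1)] by simp
    then obtain \<mu>' where mu': "weak_haar T' f' \<mu>'"
      "\<forall>A B. A \<in> sets \<mu>' \<and> B \<in> sets \<pi> \<and> emeasure \<pi> B = 0 \<and> A \<subseteq> q ` B \<longrightarrow> emeasure \<mu>' A = 0"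
      using E.weak_haar_push_fundamental_domain[OF q P pi(1) _ bspec[OF F(2)]] by blast
    let ?D = "q ` (W \<times> B) - q ` (U \<times> A)"
    have m: "?D \<in> sets \<mu>'"
      using closedin_borel[OF T'.compactin_closed[OF cm]] openin_borel[OF op] weak_haarD(1)[OF mu'(1)] by simp
    \<comment> \<open>By \<open>red\<close>, points over \<open>U\<close> already lie in the image
      of \<open>U \<times> A\<close>, so only the null cylinder over \<open>W - U\<close> can
      contribute to the difference.\<close>
    have "?D \<subseteq> q ` ((W - U) \<times> topspace S)" using red compactin_subset_topspace[OF AB(2)] by blast
    with pi(2,3) have "emeasure \<mu>' ?D = 0" using mu'(2) m by blast
    then show "haar_null T' f' ?D" using mu'(1) m unfolding haar_null_def by (intro exI[of _ \<mu>']) simp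
  qed
qed

section \<open>Adjoining a translation vector\<close>

lemma second_countable_int: "second_countable (euclidean :: int topology)"
  by (simp add: euclidean_int second_countable_discrete_topology)

text \<open>Once \<open>s\<close> is a lattice vector, the coset of \<open>s\<close> consists of
  lattice points that the extra integer coordinate places at height 1. Cutting the window at this
  height therefore selects sums of \<open>s\<close> and one old lattice vector, up to
  relations.\<close>

lemma inter_model_adjoin:
  fixes T :: "'h topology" and L :: "('g::euclidean_space \<times> 'h) set"
  assumes d: "inter_model T f z n L s U W Lam" and sc: "second_countable T"
  shows "\<exists>(T' :: nat set topology) f' z' n' L' U' W'. inter_model T' f' z' n' L' 0 U' W' Lam \<and>
    second_countable T' \<and> (haar_null T f (W - U) \<longrightarrow> haar_null T' f' (W' - U'))"
proof -
  note D = inter_modelD[OF d]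
  note C = cpsD[OF D(1)]
  interpret H: lca T f z n by (rule lca.intro[OF C(1)])
  define E where "E = prod_topology T (euclidean :: int topology)"
  define fE where "fE = (\<lambda>p q :: 'h \<times> int. (f (fst p) (fst q), snd p + snd q))"
  define nE where "nE = (\<lambda>p :: 'h \<times> int. (n (fst p), - snd p))"
  have gE: "lca_group E fE (z, 0) nE"
    unfolding E_def fE_def nE_def by (rule lca_prod[OF C(1) lca_int])
  interpret E: lca E fE "(z, 0)" nE by (rule lca.intro[OF gE])
  have tE: "topspace E = topspace T \<times> UNIV" unfolding E_def by simp
  have scE: "second_countable E"
    unfolding E_def by (intro second_countable_prod sc second_countable_int)
  have cL: "countable L" by (rule cps_countable_second_countable[OF D(1) sc])
  \<comment> \<open>The internal coordinates of the expressions
    \<open>fst l + of_int j *\<^sub>R s\<close> that vanish. These must become trivial for the first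
    projection to stay injective.\<close>
  define P where "P = {p. \<exists>l\<in>L. fst l = - (of_int (snd p) *\<^sub>R s) \<and> fst p = snd l}"
  have uniq: "l = l'" if "l \<in> L" "l' \<in> L" "fst l = fst l'" for l l' using C(6) that by (simp add: inj_on_def)
  have sgP: "E.subgrp P"
    unfolding E.subgrp_def
  proof (intro conjI ballI)
    show "P \<subseteq> topspace E" unfolding tE P_def using C(10) by (auto simp: mem_Times_iff)
    show "(z, 0) \<in> P" unfolding P_def using C(3) by (auto intro!: bexI[of _ "(0, z)"])
    fix x assume "x \<in> P"
    then obtain l where l: "l \<in> L" "fst l = - (of_int (snd x) *\<^sub>R s)" "fst x = snd l" unfolding P_def by blast
    show "nE x \<in> P" unfolding P_def nE_def using C(5)[OF l(1)] l by (auto intro!: bexI[of _ "(- fst l, n (snd l))"])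
    fix y assume "y \<in> P"
    then obtain l' where l': "l' \<in> L" "fst l' = - (of_int (snd y) *\<^sub>R s)" "fst y = snd l'" unfolding P_def by blast
    show "fE x y \<in> P" unfolding P_def fE_def using C(4)[OF l(1) l'(1)] l l'
      by (auto intro!: bexI[of _ "(fst l + fst l', f (snd l) (snd l'))"] simp: scaleR_left_distrib)
  qed
  have PE: "P \<subseteq> topspace E" using sgP unfolding E.subgrp_def by blast
  \<comment> \<open>At each height \<open>j\<close> there is at most one relation, because
    \<open>fst\<close> is injective on \<open>L\<close>; points are closed and heights are
    open.\<close>
  have clP: "closedin E P"
    unfolding closedin_def
  proof (intro conjI PE)
    let ?S = "\<lambda>j. {h. (h, j) \<in> P}"
    have "topspace E - P = (\<Union>j. (topspace T - ?S j) \<times> {j})" using tE by auto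
    moreover have "openin E ((topspace T - ?S j) \<times> {j})" for j
    proof -
      have "\<exists>a. ?S j \<subseteq> {a}"
      proof (cases "?S j = {}")
        case False
        then obtain a where a: "(a, j) \<in> P" by blast
        have "?S j \<subseteq> {a}" using a uniq unfolding P_def by auto
        then show ?thesis by blast
      qed simp
      then have "finite (?S j)" by (meson finite.emptyI finite.insertI finite_subset)
      moreover have "?S j \<subseteq> topspace T" using PE tE by auto
      ultimately have "closedin T (?S j)" by (intro closedin_Hausdorff_finite H.hausdorff)
      then have "openin T (topspace T - ?S j)" by blast
      moreover have "openin (euclidean :: int topology) {j}" by (simp add: euclidean_int)
      ultimately show ?thesis unfolding E_def by (simp add: openin_prod_Times_iff)
    qed
    ultimately show "openin E (topspace E - P)" by (metis (no_types, lifting) openin_clauses(3) imageE)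
  qed
  obtain T' :: "nat set topology" and f' z' n' q where q: "lca_quot E fE (z, 0) nE P T' f' z' n' q"
    using E.ex_lca_quot_second_countable[OF sgP clP scE] by blast
  note Q = lca_quotD[OF q]
  \<comment> \<open>The group generated by the old lattice at height 0 and \<open>s\<close> with
    internal coordinate \<open>(z, 1)\<close>.\<close>
  define M where "M = {p. \<exists>l\<in>L. fst (snd p) = snd l \<and> fst p = fst l + of_int (snd (snd p)) *\<^sub>R s}"
  have Mi: "(fst l + of_int j *\<^sub>R s, (snd l, j)) \<in> M" if "l \<in> L" for l j unfolding M_def using that by auto
  have Me: "\<exists>l\<in>L. p = (fst l + of_int (snd (snd p)) *\<^sub>R s, (snd l, snd (snd p)))" if "p \<in> M" for p
    using that unfolding M_def by (cases p) auto
  define L' where "L' = (\<lambda>p. (fst p, q (snd p))) ` M"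
  have cps': "cps T' f' z' n' L'"
  proof -
    obtain r K where K: "compactin T K" "\<And>g h. h \<in> topspace T \<Longrightarrow> \<exists>p\<in>L. norm (g - fst p) \<le> r \<and> f h (n (snd p)) \<in> K"
      using C(8) by blast
    show ?thesis unfolding L'_def
    proof (rule E.cps_quotient[OF q sgP])
      show "M \<subseteq> UNIV \<times> topspace E" unfolding M_def tE using C(10) by (auto simp: mem_Times_iff)
      show "(0, (z, 0)) \<in> M" using Mi[OF C(3), of 0] by simp
      fix p assume "p \<in> M"
      then obtain l i where l: "l \<in> L" "p = (fst l + of_int i *\<^sub>R s, (snd l, i))" using Me by blast
      show "(- fst p, nE (snd p)) \<in> M"
        using Mi[OF C(5)[OF l(1)], of "- i"] l(2) unfolding nE_def by simp
      show "snd p \<in> P" if "fst p = 0"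
      proof -
        have "fst l = - (of_int i *\<^sub>R s)" using that l(2) by (simp add: eq_neg_iff_add_eq_0)
        then show ?thesis unfolding P_def using l by auto
      qed
      fix p' assume "p' \<in> M"
      then obtain l' i' where l': "l' \<in> L" "p' = (fst l' + of_int i' *\<^sub>R s, (snd l', i'))" using Me by blast
      show "(fst p + fst p', fE (snd p) (snd p')) \<in> M"
        using Mi[OF C(4)[OF l(1) l'(1)], of "i + i'"] l(2) l'(2) unfolding fE_def
        by (simp add: scaleR_left_distrib add_ac)
    next
      fix r K assume K: "compactin E K"
      have K1: "compactin T (fst ` K)"
        by (rule image_compactin[OF K]) (unfold E_def, rule continuous_map_fst)
      have "compactin (euclidean :: int topology) (snd ` K)"
        by (rule image_compactin[OF K]) (unfold E_def, rule continuous_map_snd)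
      then have K2: "finite (snd ` K)" unfolding euclidean_int by (simp add: compactin_discrete_topology)
      \<comment> \<open>A compact set meets finitely many heights. A relation moves a point of
        \<open>M\<close> to another height without changing its vector, so at height
        \<open>j\<close> the vector is an old lattice vector plus \<open>j\<close> times
        \<open>s\<close>, and local finiteness of \<open>L\<close> applies with the radius enlarged
        accordingly.\<close>
      let ?B = "\<lambda>j. (\<lambda>l. fst l + of_int j *\<^sub>R s) ` {l\<in>L. norm (fst l) \<le> r + norm (of_int j *\<^sub>R s) \<and> snd l \<in> fst ` K}"
      have "finite (\<Union>j\<in>snd ` K. ?B j)" using K2 C(7)[OF K1] by blast
      moreover have "fst ` {p \<in> M. norm (fst p) \<le> r \<and> (\<exists>v\<in>P. fE (snd p) v \<in> K)} \<subseteq> (\<Union>j\<in>snd ` K. ?B j)"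
      proof
        fix y assume "y \<in> fst ` {p \<in> M. norm (fst p) \<le> r \<and> (\<exists>v\<in>P. fE (snd p) v \<in> K)}"
        then obtain p v where p: "p \<in> M" "norm (fst p) \<le> r" "v \<in> P" "fE (snd p) v \<in> K" "y = fst p" by blast
        obtain l i where l: "l \<in> L" "p = (fst l + of_int i *\<^sub>R s, (snd l, i))" using Me[OF p(1)] by blast
        obtain l' where l': "l' \<in> L" "fst l' = - (of_int (snd v) *\<^sub>R s)" "fst v = snd l'" using p(3) unfolding P_def by blast
        let ?m = "(fst l + fst l', f (snd l) (snd l'))"
        let ?j = "i + snd v"
        have m: "?m \<in> L" by (rule C(4)[OF l(1) l'(1)])
        have fv: "fE (snd p) v = (f (snd l) (snd l'), ?j)" unfolding fE_def l(2) l'(3) by simp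
        have y: "y = fst ?m + of_int ?j *\<^sub>R s" using p(5) l(2) l'(2) by (simp add: scaleR_left_distrib)
        have "fst ?m = y - of_int ?j *\<^sub>R s" using y by simp
        then have "norm (fst ?m) \<le> norm y + norm (of_int ?j *\<^sub>R s)" by (simp only: norm_triangle_ineq4)
        then have "norm (fst ?m) \<le> r + norm (of_int ?j *\<^sub>R s)" using p(2,5) by simp
        moreover have "snd ?m \<in> fst ` K" using p(4) fv by (auto intro!: image_eqI[of _ _ "(f (snd l) (snd l'), ?j)"])
        moreover have "?j \<in> snd ` K" using p(4) fv by (auto intro!: image_eqI[of _ _ "(f (snd l) (snd l'), ?j)"])
        ultimately show "y \<in> (\<Union>j\<in>snd ` K. ?B j)" using m y by (intro UN_I[of ?j] image_eqI[of _ _ ?m]) simp_all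
      qed
      ultimately show "finite (fst ` {p \<in> M. norm (fst p) \<le> r \<and> (\<exists>v\<in>P. fE (snd p) v \<in> K)})"
        by (rule finite_subset[rotated])
    next
      show "compactin E (K \<times> {0})" unfolding E_def using K(1) by (simp add: compactin_Times)
      fix g e assume e: "e \<in> topspace E"
      obtain h j where hj: "e = (h, j)" "h \<in> topspace T" using e tE by auto
      obtain l where l: "l \<in> L" "norm (g - of_int j *\<^sub>R s - fst l) \<le> r" "f h (n (snd l)) \<in> K" using K(2)[OF hj(2)] by blast
      show "\<exists>p\<in>M. norm (g - fst p) \<le> r \<and> fE e (nE (snd p)) \<in> K \<times> {0}"
      proof (rule bexI[OF _ Mi[OF l(1), of j]])
        show "norm (g - fst (fst l + of_int j *\<^sub>R s, snd l, j)) \<le> r \<and>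
          fE e (nE (snd (fst l + of_int j *\<^sub>R s, snd l, j))) \<in> K \<times> {0}"
          using l(2,3) hj unfolding fE_def nE_def by (simp add: algebra_simps)
      qed
    next
      fix V assume V: "openin E V" "V \<noteq> {}"
      then obtain h j where "(h, j) \<in> V" by (metis ex_in_conv surj_pair)
      then obtain A B where AB: "openin T A" "h \<in> A" "j \<in> B" "A \<times> B \<subseteq> V"
        using V(1) unfolding E_def openin_prod_topology_alt by meson
      obtain l where l: "l \<in> L" "snd l \<in> A" using C(12)[OF AB(1)] AB(2) by blast
      then have "(snd l, j) \<in> V" using AB by blast
      then show "\<exists>p\<in>M. snd p \<in> V" by (intro bexI[OF _ Mi[OF l(1), of j]]) simp
    qed
  qed
  define U' where "U' = q ` (U \<times> {1})"
  define W' where "W' = q ` (W \<times> {1})"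
  \<comment> \<open>The heights at which relations occur, a subgroup of \<int>. \<open>P\<close> has
    exactly one point over each of them, so choosing by \<open>rep\<close> one integer from each
    coset of \<open>J\<close> yields a fundamental domain, whether \<open>J\<close> is trivial or
    not.\<close>
  define J where "J = {j. \<exists>l\<in>L. fst l = - (of_int j *\<^sub>R s)}"
  have J0: "0 \<in> J" unfolding J_def using C(3) by (auto intro!: bexI[of _ "(0, z)"])
  have Jd: "i - j \<in> J" if ij: "i \<in> J" "j \<in> J" for i j
  proof -
    obtain l l' where l: "l \<in> L" "fst l = - (of_int i *\<^sub>R s)" "l' \<in> L" "fst l' = - (of_int j *\<^sub>R s)"
      using ij unfolding J_def by blast
    show ?thesis unfolding J_def using C(11)[OF l(1,3)] l(2,4)
      by (auto intro!: bexI[of _ "(fst l - fst l', f (snd l) (n (snd l')))"] simp: algebra_simps)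
  qed
  define rep where "rep i = (SOME i'. i' - i \<in> J)" for i :: int
  have rep: "rep i - i \<in> J" for i unfolding rep_def by (rule someI[of _ i]) (simp add: J0)
  have repeq: "rep i = rep j" if "i - j \<in> J" for i j
  proof -
    have "(\<lambda>i'. i' - i \<in> J) = (\<lambda>i'. i' - j \<in> J)"
    proof (rule ext)
      fix k
      have ji: "j - i \<in> J" using Jd[OF J0 that] by simp
      show "(k - i \<in> J) = (k - j \<in> J)" using Jd[of "k - i" "j - i"] Jd[of "k - j" "i - j"] that ji by auto
    qed
    then show ?thesis unfolding rep_def by simp
  qed
  let ?F = "topspace T \<times> range rep"
  have F: "?F \<in> sets (borel_of E)"
    unfolding E_def by (rule openin_borel) (simp add: openin_prod_Times_iff euclidean_int)
  have F1: "\<exists>!p. p \<in> P \<and> fE p h \<in> ?F" if h: "h \<in> topspace E" for h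
  proof -
    let ?j = "rep (snd h) - snd h"
    obtain l where l: "l \<in> L" "fst l = - (of_int ?j *\<^sub>R s)" using rep unfolding J_def by blast
    show ?thesis
    proof (rule ex1I[of _ "(snd l, ?j)"])
      show "(snd l, ?j) \<in> P \<and> fE (snd l, ?j) h \<in> ?F"
        using l h C(10)[OF l(1)] tE unfolding P_def fE_def by (auto simp: mem_Times_iff)
      fix p assume p: "p \<in> P \<and> fE p h \<in> ?F"
      then obtain l' where l': "l' \<in> L" "fst l' = - (of_int (snd p) *\<^sub>R s)" "fst p = snd l'" unfolding P_def by blast
      obtain a where a: "snd p + snd h = rep a" using p unfolding fE_def by auto
      have "snd p \<in> J" using l' unfolding J_def by blast
      then have "snd h - a \<in> J" using Jd[of "rep a - a" "snd p"] rep[of a] a[symmetric] by (simp add: algebra_simps)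
      then have "rep (snd h) = rep a" by (rule repeq)
      then have j: "snd p = ?j" using a by simp
      then have "l' = l" using l' l by (intro uniq) simp_all
      then show "p = (snd l, ?j)" using j l'(3) by (cases p) simp
    qed
  qed
  have cP: "countable P"
  proof -
    have "P \<subseteq> (\<lambda>x. (snd (fst x), snd x)) ` (L \<times> UNIV)" unfolding P_def by force
    then show ?thesis using cL by (elim countable_subset) simp
  qed
  have AB: "openin (euclidean :: int topology) {1}" "compactin (euclidean :: int topology) {1}" "q ` (U \<times> {1}) \<subseteq> q ` (U \<times> {1})"
    by (simp_all add: euclidean_int)
  have F1': "\<forall>h\<in>topspace E. \<exists>!p. p \<in> P \<and> fE p h \<in> ?F" by (intro ballI F1)
  note window = product_quotient_window[OF C(1) sc lca_int second_countable_int weak_haar_count_int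
      q[unfolded E_def fE_def nE_def] sgP[unfolded E_def fE_def nE_def] cP F[unfolded E_def] F1'[unfolded E_def fE_def] D(2,4) AB,
      folded U'_def W'_def]
  have opU: "openin T' U'" and cmW: "compactin T' W'" using window(1,2) .
  have "inter_model T' f' z' n' L' 0 U' W' Lam"
    unfolding inter_model_def
  proof (intro conjI ballI impI)
    show "U' \<noteq> {}" unfolding U'_def using D(3) by blast
    show "U' \<subseteq> W'" unfolding U'_def W'_def using D(5) by blast
  next
    fix p assume p: "p \<in> L'" "snd p \<in> U'"
    obtain m where m: "m \<in> M" "p = (fst m, q (snd m))" using p(1) unfolding L'_def by blast
    obtain l i where l: "l \<in> L" "m = (fst l + of_int i *\<^sub>R s, (snd l, i))" using Me[OF m(1)] by blast
    obtain u where u: "u \<in> U" "q (snd m) = q (u, 1)" using p(2) m(2) unfolding U'_def by auto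
    have uT: "u \<in> topspace T" using u(1) D(8) by blast
    have lT: "snd l \<in> topspace T" by (rule C(10)[OF l(1)])
    \<comment> \<open>The point sits at height \<open>i\<close> but is congruent to one at height 1.
      The relation \<open>l'\<close> at height \<open>i - 1\<close> rewrites it as \<open>s\<close>
      plus the lattice vector \<open>fst l - fst l'\<close>, whose internal coordinate is exactly
      \<open>u\<close>.\<close>
    have "fE (snd m) (nE (u, 1)) \<in> P" using Q(10)[of "snd m" "(u, 1)"] u(2) uT lT l(2) tE by simp
    then obtain l' where l': "l' \<in> L" "fst l' = - (of_int (i - 1) *\<^sub>R s)" "f (snd l) (n u) = snd l'"
      unfolding P_def fE_def nE_def l(2) by auto
    have k: "(fst l - fst l', f (snd l) (n (snd l'))) \<in> L" by (rule C(11)[OF l(1) l'(1)])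
    have "f (snd l) (n (snd l')) = u" using l'(3)[symmetric] uT lT by (simp add: H.neg_sub)
    then have "s + (fst l - fst l') \<in> Lam" using D(6)[OF k] u(1) by simp
    moreover have "s + (fst l - fst l') = fst p" using m(2) l(2) l'(2) by (simp add: algebra_simps)
    ultimately show "0 + fst p \<in> Lam" by simp
  next
    fix y assume "y \<in> Lam"
    then obtain l where l: "l \<in> L" "snd l \<in> W" "y = s + fst l" using D(7) by blast
    show "\<exists>p\<in>L'. snd p \<in> W' \<and> y = 0 + fst p"
    proof (intro bexI conjI)
      show "(fst l + of_int 1 *\<^sub>R s, q (snd l, 1)) \<in> L'"
        unfolding L'_def by (rule image_eqI[OF _ Mi[OF l(1), of 1]]) simp
    qed (use l in \<open>auto simp: W'_def\<close>)
  qed (rule cps' opU cmW)+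
  moreover note window(3)
  ultimately show ?thesis using Q(2) by blast
qed

section \<open>Making the star map injective\<close>

text \<open>For fixed nonzero \<open>x\<close> and rational \<rho> the bad vectors form a
  hyperplane, and countably many null sets do not fill the space.\<close>

lemma ex_irrational_functional:
  fixes X :: "'g::euclidean_space set"
  assumes "countable X"
  shows "\<exists>a. \<forall>x\<in>X. x \<noteq> 0 \<longrightarrow> a \<bullet> x \<notin> \<rat>"
proof -
  let ?A = "\<lambda>x \<rho>. {a. x \<bullet> a = \<rho>}"
  have "negligible (\<Union>p\<in>(X - {0}) \<times> (\<rat> :: real set). ?A (fst p) (snd p))"
  proof (rule negligible_countable_Union)
    show "countable ((\<lambda>p. ?A (fst p) (snd p)) ` ((X - {0}) \<times> (\<rat> :: real set)))"
      using assms countable_rat by (intro countable_image countable_SIGMA) auto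
    show "negligible S" if "S \<in> (\<lambda>p. ?A (fst p) (snd p)) ` ((X - {0}) \<times> (\<rat> :: real set))" for S
      using that by (auto intro: negligible_hyperplane)
  qed
  then have "(\<Union>p\<in>(X - {0}) \<times> (\<rat> :: real set). ?A (fst p) (snd p)) \<noteq> UNIV"
    using non_negligible_UNIV by metis
  then obtain a where "a \<notin> (\<Union>p\<in>(X - {0}) \<times> (\<rat> :: real set). ?A (fst p) (snd p))" by blast
  then have "\<forall>x\<in>X. x \<noteq> 0 \<longrightarrow> a \<bullet> x \<notin> \<rat>" by (auto simp: inner_commute)
  then show ?thesis by blast
qed

text \<open>The star map is made injective by adding to it a generic character of \<open>\<real>\<^sup>d\<close> with values in
  \<open>\<real>/\<int>\<close>. Since its value at the nonzero element \<open>\<kappa>\<close> of the kernel of the old star map has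
  infinite order, the image of the new star map is still dense.\<close>

lemma inter_model_star_injective:
  fixes T :: "'h topology" and L :: "('g::euclidean_space \<times> 'h) set"
  assumes d: "inter_model T f z n L s U W Lam" and sc: "second_countable T"
    and \<kappa>: "(\<kappa>, z) \<in> L" "\<kappa> \<noteq> 0"
  shows "\<exists>(T' :: nat set topology) f' z' n' L' U' W'. inter_model T' f' z' n' L' s U' W' Lam \<and>
    second_countable T' \<and> (\<forall>p\<in>L'. \<forall>p'\<in>L'. snd p = snd p' \<longrightarrow> fst p = fst p') \<and>
    (haar_null T f (W - U) \<longrightarrow> haar_null T' f' (W' - U'))"
proof -
  note D = inter_modelD[OF d]
  note C = cpsD[OF D(1)]
  interpret H: lca T f z n by (rule lca.intro[OF C(1)])
  define E where "E = prod_topology T (euclidean :: real topology)"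
  define fE where "fE = (\<lambda>p q :: 'h \<times> real. (f (fst p) (fst q), snd p + snd q))"
  define nE where "nE = (\<lambda>p :: 'h \<times> real. (n (fst p), - snd p))"
  have gE: "lca_group E fE (z, 0) nE"
    unfolding E_def fE_def nE_def by (rule lca_prod[OF C(1) lca_euclidean])
  interpret E: lca E fE "(z, 0)" nE by (rule lca.intro[OF gE])
  have tE: "topspace E = topspace T \<times> UNIV" unfolding E_def by simp
  have scE: "second_countable E"
    unfolding E_def by (intro second_countable_prod sc second_countable_euclidean)
  have cL: "countable L" by (rule cps_countable_second_countable[OF D(1) sc])
  obtain a where a: "\<And>x. x \<in> fst ` L \<Longrightarrow> x \<noteq> 0 \<Longrightarrow> a \<bullet> x \<notin> \<rat>"
    using ex_irrational_functional[of "fst ` L"] cL by blast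
  define P where "P = {z} \<times> (\<int> :: real set)"
  have uniq: "l = l'" if "l \<in> L" "l' \<in> L" "fst l = fst l'" for l l' using C(6) that by (simp add: inj_on_def)
  have sgP: "E.subgrp P"
    unfolding E.subgrp_def
  proof (intro conjI ballI)
    show "fE x y \<in> P" if "x \<in> P" "y \<in> P" for x y using that unfolding P_def fE_def by auto
    show "nE x \<in> P" if "x \<in> P" for x using that unfolding P_def nE_def by auto
  qed (auto simp: P_def tE)
  have clP: "closedin E P"
    unfolding P_def E_def by (auto simp: closedin_prod_Times_iff closedin_Hausdorff_singleton H.hausdorff)
  obtain T' :: "nat set topology" and f' z' n' q where q: "lca_quot E fE (z, 0) nE P T' f' z' n' q"
    using E.ex_lca_quot_second_countable[OF sgP clP scE] by blast
  note Q = lca_quotD[OF q]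
  \<comment> \<open>All real lifts of the circle coordinate are taken at once, so that
    \<open>M\<close> is a subgroup of the product with \<real> and the cosets of \<open>P\<close>
    are the lifts of one lattice point.\<close>
  define M where "M = {p. \<exists>l\<in>L. \<exists>m. p = (fst l, (snd l, a \<bullet> fst l + of_int m))}"
  have Mi: "(fst l, (snd l, a \<bullet> fst l + of_int m)) \<in> M" if "l \<in> L" for l m unfolding M_def using that by auto
  have Me: "\<exists>l\<in>L. \<exists>m. p = (fst l, (snd l, a \<bullet> fst l + of_int m))" if "p \<in> M" for p
    using that unfolding M_def by auto
  define L' where "L' = (\<lambda>p. (fst p, q (snd p))) ` M"
  \<comment> \<open>Adding multiples of \<open>\<kappa>\<close> changes the vector, and with it the
    circle coordinate, but not the old star image.\<close>
  have mult: "(of_nat k *\<^sub>R \<kappa> + fst l, snd l) \<in> L" if "l \<in> L" for k :: nat and l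
  proof (induction k)
    case (Suc k)
    from C(4)[OF \<kappa>(1) this] that show ?case by (simp add: C(10) scaleR_left_distrib add_ac)
  qed (use that in simp)
  have qeq: "fst x = fst y \<and> snd x - snd y \<in> \<int>" if "q x = q y" "x \<in> topspace E" "y \<in> topspace E" for x y
  proof -
    have "fE x (nE y) \<in> P" using Q(10) that by blast
    then have "f (fst x) (n (fst y)) = z" "snd x - snd y \<in> \<int>" unfolding P_def fE_def nE_def by auto
    then show ?thesis using H.diff_eq_zero that(2,3) tE by (auto simp: mem_Times_iff)
  qed
  have qeqI: "q (h, t) = q (h, t')" if "h \<in> topspace T" "t - t' \<in> \<int>" for h t t'
    using Q(10)[of "(h, t)" "(h, t')"] that tE unfolding P_def fE_def nE_def by simp
  have cps': "cps T' f' z' n' L'"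
  proof -
    obtain r K where K: "compactin T K" "\<And>g h. h \<in> topspace T \<Longrightarrow> \<exists>p\<in>L. norm (g - fst p) \<le> r \<and> f h (n (snd p)) \<in> K"
      using C(8) by blast
    show ?thesis unfolding L'_def
    proof (rule E.cps_quotient[OF q sgP])
      show "M \<subseteq> UNIV \<times> topspace E" unfolding M_def tE using C(10) by auto
      show "(0, (z, 0)) \<in> M" using Mi[OF C(3), of 0] by simp
      fix p assume "p \<in> M"
      then obtain l i where l: "l \<in> L" "p = (fst l, (snd l, a \<bullet> fst l + of_int i))" using Me by blast
      show "(- fst p, nE (snd p)) \<in> M"
        using Mi[OF C(5)[OF l(1)], of "- i"] l(2) unfolding nE_def by simp
      show "snd p \<in> P" if "fst p = 0"
      proof -
        have "l = (0, z)" using that l(2) by (intro uniq[OF l(1) C(3)]) simp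
        then show ?thesis unfolding P_def using l(2) by simp
      qed
      fix p' assume "p' \<in> M"
      then obtain l' i' where l': "l' \<in> L" "p' = (fst l', (snd l', a \<bullet> fst l' + of_int i'))" using Me by blast
      show "(fst p + fst p', fE (snd p) (snd p')) \<in> M"
        using Mi[OF C(4)[OF l(1) l'(1)], of "i + i'"] l(2) l'(2) unfolding fE_def
        by (simp add: inner_add_right add_ac)
    next
      fix r K assume K: "compactin E K"
      have K1: "compactin T (fst ` K)"
        by (rule image_compactin[OF K]) (unfold E_def, rule continuous_map_fst)
      have "fst ` {p \<in> M. norm (fst p) \<le> r \<and> (\<exists>v\<in>P. fE (snd p) v \<in> K)} \<subseteq>
          fst ` {l\<in>L. norm (fst l) \<le> r \<and> snd l \<in> fst ` K}"
      proof
        fix y assume "y \<in> fst ` {p \<in> M. norm (fst p) \<le> r \<and> (\<exists>v\<in>P. fE (snd p) v \<in> K)}"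
        then obtain p v where p: "p \<in> M" "norm (fst p) \<le> r" "v \<in> P" "fE (snd p) v \<in> K" "y = fst p" by blast
        obtain l i where l: "l \<in> L" "p = (fst l, (snd l, a \<bullet> fst l + of_int i))" using Me[OF p(1)] by blast
        have "fst (fE (snd p) v) = snd l" using p(3) l C(10)[OF l(1)] unfolding fE_def P_def by auto
        then have "snd l \<in> fst ` K" using p(4) by (metis imageI)
        then show "y \<in> fst ` {l\<in>L. norm (fst l) \<le> r \<and> snd l \<in> fst ` K}" using l p(2,5) by (intro image_eqI[of _ _ l]) simp_all
      qed
      then show "finite (fst ` {p \<in> M. norm (fst p) \<le> r \<and> (\<exists>v\<in>P. fE (snd p) v \<in> K)})"
        using C(7)[OF K1] by (meson finite_imageI finite_subset)
    next
      show "compactin E (K \<times> {0..1})" unfolding E_def using K(1) by (simp add: compactin_Times)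
      fix g e assume e: "e \<in> topspace E"
      obtain h t where ht: "e = (h, t)" "h \<in> topspace T" using e tE by auto
      obtain l where l: "l \<in> L" "norm (g - fst l) \<le> r" "f h (n (snd l)) \<in> K" using K(2)[OF ht(2)] by blast
      \<comment> \<open>The integer part is absorbed by the choice of the lift; the real coordinate
        left over is a fractional part.\<close>
      show "\<exists>p\<in>M. norm (g - fst p) \<le> r \<and> fE e (nE (snd p)) \<in> K \<times> {0..1}"
      proof (rule bexI[OF _ Mi[OF l(1), of "\<lfloor>t - a \<bullet> fst l\<rfloor>"]])
        have "0 \<le> frac (t - a \<bullet> fst l)" "frac (t - a \<bullet> fst l) \<le> 1" by (simp_all add: frac_lt_1 less_imp_le)
        then show "norm (g - fst (fst l, snd l, a \<bullet> fst l + of_int \<lfloor>t - a \<bullet> fst l\<rfloor>)) \<le> r \<and>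
          fE e (nE (snd (fst l, snd l, a \<bullet> fst l + of_int \<lfloor>t - a \<bullet> fst l\<rfloor>))) \<in> K \<times> {0..1}"
          using l(2,3) ht unfolding fE_def nE_def frac_def by (simp add: algebra_simps)
      qed
    next
      fix V assume V: "openin E V" "V \<noteq> {}"
      then obtain h t where "(h, t) \<in> V" by (metis ex_in_conv surj_pair)
      then obtain A B where AB: "openin T A" "openin euclidean B" "h \<in> A" "t \<in> B" "A \<times> B \<subseteq> V"
        using V(1) unfolding E_def openin_prod_topology_alt by meson
      have "open B" using AB(2) by simp
      then obtain e where e: "e > 0" "ball t e \<subseteq> B" using AB(4) unfolding open_contains_ball by blast
      obtain l where l: "l \<in> L" "snd l \<in> A" using C(12)[OF AB(1)] AB(3) by blast
      \<comment> \<open>Irrational rotation: \<open>l\<close> is first chosen for the old coordinate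
        alone, then a multiple of \<open>\<kappa>\<close> brings the circle coordinate within
        \<open>e\<close> of \<open>t\<close> and leaves \<open>snd l\<close> in
        \<open>A\<close>.\<close>
      have "a \<bullet> \<kappa> \<notin> \<rat>" using a[of \<kappa>] \<kappa> by force
      then obtain j k where jk: "k > 0" "\<bar>of_int k * (a \<bullet> \<kappa>) - of_int j - (t - a \<bullet> fst l)\<bar> < e"
        using sequence_of_fractional_parts_is_dense e(1) by metis
      let ?l = "(of_nat (nat k) *\<^sub>R \<kappa> + fst l, snd l)"
      have m: "?l \<in> L" by (rule mult[OF l(1)])
      have "real (nat k) = of_int k" using jk(1) by simp
      then have "a \<bullet> fst ?l + of_int (- j) \<in> ball t e"
        using jk(2) by (simp add: dist_real_def inner_add_right algebra_simps abs_minus_commute)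
      then have "(snd l, a \<bullet> fst ?l + of_int (- j)) \<in> V" using e(2) l(2) AB(5) by blast
      then show "\<exists>p\<in>M. snd p \<in> V" by (intro bexI[OF _ Mi[OF m, of "- j"]]) simp
    qed
  qed
  \<comment> \<open>Both windows contain the full circle over the old ones, so membership depends on
    the old star image only. The whole line makes the first product open, one closed period makes
    the second compact.\<close>
  define U' where "U' = q ` (U \<times> UNIV)"
  define W' where "W' = q ` (W \<times> {0..1})"
  \<comment> \<open>The half-open period, written as a difference of closed sets to make it visibly
    Borel.\<close>
  let ?F = "topspace T \<times> {0..} - topspace T \<times> {1::real..}"
  have "closedin E (topspace T \<times> {c..})" for c :: real unfolding E_def by (simp add: closedin_prod_Times_iff)
  then have F: "?F \<in> sets (borel_of E)" by (intro sets.Diff closedin_borel)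
  have Fi: "p \<in> ?F \<longleftrightarrow> fst p \<in> topspace T \<and> 0 \<le> snd p \<and> snd p < 1" for p by (cases p) auto
  have F1: "\<exists>!p. p \<in> P \<and> fE p h \<in> ?F" if h: "h \<in> topspace E" for h
  proof (rule ex1I[of _ "(z, - of_int \<lfloor>snd h\<rfloor>)"])
    have hT: "fst h \<in> topspace T" using h tE by (simp add: mem_Times_iff)
    show "(z, - of_int \<lfloor>snd h\<rfloor>) \<in> P \<and> fE (z, - of_int \<lfloor>snd h\<rfloor>) h \<in> ?F"
      unfolding P_def Fi fE_def using hT by (simp, linarith)
    fix p assume p: "p \<in> P \<and> fE p h \<in> ?F"
    then obtain m where m: "p = (z, of_int m)" unfolding P_def by (auto elim: Ints_cases)
    have "0 \<le> of_int m + snd h" "of_int m + snd h < 1" using p unfolding Fi m fE_def by simp_all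
    then have "\<lfloor>snd h\<rfloor> = - m" by linarith
    then show "p = (z, - of_int \<lfloor>snd h\<rfloor>)" using m by simp
  qed
  have cP: "countable P"
  proof -
    have "P = (\<lambda>m. (z, of_int m)) ` UNIV" unfolding P_def by (auto elim: Ints_cases)
    then show ?thesis by simp
  qed
  have AB: "openin (euclidean :: real topology) UNIV" "compactin (euclidean :: real topology) {0..1}" "q ` (U \<times> {0..1}) \<subseteq> q ` (U \<times> UNIV)"
    by auto
  have F1': "\<forall>h\<in>topspace E. \<exists>!p. p \<in> P \<and> fE p h \<in> ?F" by (intro ballI F1)
  note window = product_quotient_window[OF C(1) sc lca_euclidean second_countable_euclidean weak_haar_lborel
      q[unfolded E_def fE_def nE_def] sgP[unfolded E_def fE_def nE_def] cP F[unfolded E_def] F1'[unfolded E_def fE_def] D(2,4) AB,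
      folded U'_def W'_def]
  have opU: "openin T' U'" and cmW: "compactin T' W'" using window(1,2) .
  have red: "q (h, t) = q (h, frac t)" if "h \<in> topspace T" for h t
    using that by (intro qeqI) (simp_all add: frac_def)
  have "inter_model T' f' z' n' L' s U' W' Lam"
    unfolding inter_model_def
  proof (intro conjI ballI impI)
    show "U' \<noteq> {}" unfolding U'_def using D(3) by blast
    show "U' \<subseteq> W'"
    proof
      fix x assume "x \<in> U'"
      then obtain u t where u: "u \<in> U" "x = q (u, t)" unfolding U'_def by blast
      then have "u \<in> topspace T" "u \<in> W" using D(5,8) by blast+
      then show "x \<in> W'" unfolding W'_def u(2) using red[of u t] frac_lt_1[of t]
        by (intro image_eqI[of _ _ "(u, frac t)"]) (simp_all add: less_imp_le)
    qed
  next
    fix p assume p: "p \<in> L'" "snd p \<in> U'"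
    obtain m where m: "m \<in> M" "p = (fst m, q (snd m))" using p(1) unfolding L'_def by blast
    obtain l i where l: "l \<in> L" "m = (fst l, (snd l, a \<bullet> fst l + of_int i))" using Me[OF m(1)] by blast
    obtain u t where u: "u \<in> U" "q (snd m) = q (u, t)" using p(2) m(2) unfolding U'_def by auto
    have uT: "u \<in> topspace T" using u(1) D(8) by blast
    have "snd l = u" using qeq[OF u(2)] uT C(10)[OF l(1)] l(2) tE by simp
    then show "s + fst p \<in> Lam" using D(6)[OF l(1)] u(1) m(2) l(2) by simp
  next
    fix y assume "y \<in> Lam"
    then obtain l where l: "l \<in> L" "snd l \<in> W" "y = s + fst l" using D(7) by blast
    let ?t = "a \<bullet> fst l + of_int (- \<lfloor>a \<bullet> fst l\<rfloor>)"
    have "?t = frac (a \<bullet> fst l)" unfolding frac_def by simp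
    then have t: "0 \<le> ?t" "?t \<le> 1" by (simp_all add: frac_lt_1 less_imp_le)
    show "\<exists>p\<in>L'. snd p \<in> W' \<and> y = s + fst p"
    proof (intro bexI conjI)
      show "(fst l, q (snd l, ?t)) \<in> L'"
        unfolding L'_def by (rule image_eqI[OF _ Mi[OF l(1), of "- \<lfloor>a \<bullet> fst l\<rfloor>"]]) simp
      show "snd (fst l, q (snd l, ?t)) \<in> W'" unfolding W'_def using t l(2) by (intro image_eqI[of _ _ "(snd l, ?t)"]) simp_all
    qed (use l in simp)
  qed (rule cps' opU cmW)+
  moreover have "fst p = fst p'" if pp: "p \<in> L'" "p' \<in> L'" "snd p = snd p'" for p p'
  proof -
    obtain m where m: "m \<in> M" "p = (fst m, q (snd m))" using pp(1) unfolding L'_def by blast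
    obtain l i where l: "l \<in> L" "m = (fst l, (snd l, a \<bullet> fst l + of_int i))" using Me[OF m(1)] by blast
    obtain m' where m': "m' \<in> M" "p' = (fst m', q (snd m'))" using pp(2) unfolding L'_def by blast
    obtain l' i' where l': "l' \<in> L" "m' = (fst l', (snd l', a \<bullet> fst l' + of_int i'))" using Me[OF m'(1)] by blast
    \<comment> \<open>Equal circle coordinates make the inner product of \<open>a\<close> with
      \<open>fst l - fst l'\<close> an integer, which the choice of \<open>a\<close> permits only
      for the zero vector.\<close>
    have "snd (snd m) - snd (snd m') \<in> \<int>"
      using qeq[of "snd m" "snd m'"] pp(3) m(2) m'(2) l l' C(10) tE by simp
    then have "snd (snd m) - snd (snd m') + of_int (i' - i) \<in> \<int>" by (intro Ints_add Ints_of_int)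
    then have "a \<bullet> (fst l - fst l') \<in> \<int>" using l(2) l'(2) by (simp add: inner_diff_right)
    then have "a \<bullet> (fst l - fst l') \<in> \<rat>" using Ints_subset_Rats by blast
    moreover have "fst l - fst l' \<in> fst ` L" using C(11)[OF l(1) l'(1)] by force
    ultimately have "fst l - fst l' = 0" using a by blast
    then show ?thesis using m(2) m'(2) l(2) l'(2) by simp
  qed
  moreover note window(3)
  ultimately show ?thesis using Q(2) by blast
qed

section \<open>Reduction to second countable internal groups\<close>

context lca
begin

lemma lca_group_subgroup:
  assumes S: "subgrp S" "openin T S"
  shows "lca_group (subtopology T S) f z n"
proof -
  have ST: "S \<subseteq> H" using S(1) unfolding subgrp_def by blast
  have sub: "topspace (subtopology T S) = S" using ST by (simp add: Int_absorb1)
  show ?thesis unfolding lca_group_def sub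
  proof (intro conjI ballI)
    show "continuous_map (prod_topology (subtopology T S) (subtopology T S)) (subtopology T S) (\<lambda>p. fst p \<oplus> snd p)"
      unfolding continuous_map_in_subtopology
    proof (intro conjI)
      show "continuous_map (prod_topology (subtopology T S) (subtopology T S)) T (\<lambda>p. fst p \<oplus> snd p)"
        unfolding subtopology_Times[symmetric] by (rule continuous_map_from_subtopology[OF continuous_add'])
      show "(\<lambda>p. fst p \<oplus> snd p) \<in> topspace (prod_topology (subtopology T S) (subtopology T S)) \<rightarrow> S"
        using S(1) unfolding subgrp_def by (auto simp: sub)
    qed
    show "continuous_map (subtopology T S) (subtopology T S) n"
      unfolding continuous_map_in_subtopology
      using continuous_map_from_subtopology[OF continuous_neg'] S(1) unfolding subgrp_def by (auto simp: sub)
    show "Hausdorff_space (subtopology T S)" by (rule Hausdorff_space_subtopology[OF hausdorff])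
    show "locally_compact_space (subtopology T S)"
      by (rule locally_compact_space_open_subset[OF disjI1[OF hausdorff] locally_compact S(2)])
  next
    fix x y w assume "x \<in> S" "y \<in> S" "w \<in> S"
    then show "x \<oplus> y \<oplus> w = x \<oplus> (y \<oplus> w)" using ST by (intro assoc) auto
  next
    fix x y assume "x \<in> S" "y \<in> S"
    then show "x \<oplus> y = y \<oplus> x" using ST by (intro comm) auto
  next
    fix x assume "x \<in> S"
    then have "x \<in> H" using ST by blast
    then show "z \<oplus> x = x" "n x \<oplus> x = z" by simp_all
  qed (use S(1) in \<open>auto simp: subgrp_def\<close>)
qed

text \<open>Openness of \<open>S\<close> makes its Borel sets the Borel sets of \<open>T\<close>
  inside \<open>S\<close> and keeps open sets of positive measure; being a subgroup,
  \<open>S\<close> absorbs translations by its own elements.\<close>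

lemma weak_haar_restrict:
  assumes S: "subgrp S" "openin T S" and weak_haar: "weak_haar T f \<mu>"
  shows "weak_haar (subtopology T S) f (restrict_space \<mu> S)"
    and "A \<subseteq> S \<Longrightarrow> emeasure (restrict_space \<mu> S) A = emeasure \<mu> A"
proof -
  note W = weak_haarD[OF weak_haar] and sp = weak_haar_space[OF weak_haar]
  have ST: "S \<subseteq> H" using S(1) unfolding subgrp_def by blast
  have sub: "topspace (subtopology T S) = S" using ST by (simp add: Int_absorb1)
  have Sm: "S \<in> sets \<mu>" using openin_borel[OF S(2)] W(1) by simp
  have em: "emeasure (restrict_space \<mu> S) A = emeasure \<mu> A" if "A \<subseteq> S" for A
    using Sm that by (intro emeasure_restrict_space) auto
  have sr: "space (restrict_space \<mu> S) = S" using ST sp by (simp add: space_restrict_space Int_absorb1 Int_absorb2)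
  have sets: "sets (restrict_space \<mu> S) = sets (borel_of (subtopology T S))"
  proof
    show "sets (restrict_space \<mu> S) \<subseteq> sets (borel_of (subtopology T S))"
    proof
      fix A assume "A \<in> sets (restrict_space \<mu> S)"
      then obtain B where B: "B \<in> sets (borel_of T)" "A = S \<inter> B" using W(1) by (auto simp: sets_restrict_space)
      have "(\<lambda>x. x) \<in> measurable (borel_of (subtopology T S)) (borel_of T)"
        by (intro measurable_borel_of continuous_map_from_subtopology) simp
      from measurable_sets[OF this B(1)] show "A \<in> sets (borel_of (subtopology T S))"
        using B(2) sub by (simp add: vimage_def Int_commute)
    qed
    have "{U. openin (subtopology T S) U} \<subseteq> sets (restrict_space \<mu> S)"
    proof
      fix U assume "U \<in> {U. openin (subtopology T S) U}"
      then have "openin T U" "U \<subseteq> S" using S(2) openin_open_subtopology by auto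
      then show "U \<in> sets (restrict_space \<mu> S)"
        using openin_borel[of T U] W(1) Sm by (auto simp: sets_restrict_space image_iff intro!: bexI[of _ U])
    qed
    from sets.sigma_sets_subset[OF this] show "sets (borel_of (subtopology T S)) \<subseteq> sets (restrict_space \<mu> S)"
      unfolding sets_borel_of sr sub .
  qed
  show "weak_haar (subtopology T S) f (restrict_space \<mu> S)"
  proof (rule weak_haarI)
    fix g A assume g: "g \<in> topspace (subtopology T S)" and A: "A \<in> sets (restrict_space \<mu> S)"
    have gS: "g \<in> S" "g \<in> H" using g sub ST by auto
    have AS: "A \<subseteq> S" using sets.sets_into_space[OF A] sr by simp
    have Am: "A \<in> sets \<mu>" using A Sm by (auto simp: sets_restrict_space)
    have "{h \<in> topspace (subtopology T S). g \<oplus> h \<in> A} = {h \<in> H. g \<oplus> h \<in> A}"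
    proof (intro equalityI subsetI)
      fix h assume h: "h \<in> {h \<in> H. g \<oplus> h \<in> A}"
      then have "n g \<oplus> (g \<oplus> h) \<in> S" using AS gS S(1) unfolding subgrp_def by blast
      then have "h \<in> S" using h gS by simp
      then show "h \<in> {h \<in> topspace (subtopology T S). g \<oplus> h \<in> A}" using h sub by simp
    qed (use ST sub in auto)
    moreover have "{h \<in> H. g \<oplus> h \<in> A} \<subseteq> S" using calculation sub by auto
    ultimately show "emeasure (restrict_space \<mu> S) {h \<in> topspace (subtopology T S). g \<oplus> h \<in> A} =
        emeasure (restrict_space \<mu> S) A"
      using em[OF AS] em[of "{h \<in> H. g \<oplus> h \<in> A}"] W(2)[OF gS(2) Am] by simp
  next
    fix K assume "compactin (subtopology T S) K"
    then have "compactin T K" "K \<subseteq> S" by (simp_all add: compactin_subtopology)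
    then show "emeasure (restrict_space \<mu> S) K < \<infinity>" using em W(3) by simp
  next
    fix V assume V: "openin (subtopology T S) V" "V \<noteq> {}"
    then have "openin T V" "V \<subseteq> S" using S(2) openin_open_subtopology by auto
    then show "0 < emeasure (restrict_space \<mu> S) V" using em W(4) V(2) by simp
  qed (rule sets)
  show "A \<subseteq> S \<Longrightarrow> emeasure (restrict_space \<mu> S) A = emeasure \<mu> A" by (rule em)
qed

text \<open>The subgroup is generated by \<open>C\<close> together with a compact neighbourhood of
  \<open>z\<close>; the latter makes it open.\<close>

lemma ex_sigma_compact_open_subgroup:
  assumes "compactin T C"
  shows "\<exists>S K. subgrp S \<and> openin T S \<and> C \<subseteq> S \<and> (\<forall>i::nat. compactin T (K i)) \<and> (\<Union>i. K i) = S"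
proof -
  obtain V K0 where VK: "openin T V" "compactin T K0" "z \<in> V" "V \<subseteq> K0"
    using locally_compact zero_closed unfolding locally_compact_space_def by meson
  define C' where "C' = C \<union> K0"
  have C': "compactin T C'" unfolding C'_def using assms VK(2) by (rule compactin_Un)
  \<comment> \<open>Iterated differences close the union under sums and inverses at once. Because
    \<open>z\<close> lies in every \<open>K i\<close>, the sequence increases.\<close>
  define K where "K = rec_nat C' (\<lambda>_ A. {a \<oplus> n b |a b. a \<in> A \<and> b \<in> A})"
  have K0: "K 0 = C'" and KS: "K (Suc i) = {a \<oplus> n b |a b. a \<in> K i \<and> b \<in> K i}" for i
    unfolding K_def by simp_all
  have Kc: "compactin T (K i)" for i
    by (induction i) (simp_all only: K0 KS C' compactin_diff)
  have KT: "K i \<subseteq> H" for i using Kc by (rule compactin_subset_topspace)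
  have zK: "z \<in> K i" for i
  proof (induction i)
    case 0 then show ?case using VK K0 unfolding C'_def by auto
  next
    case (Suc i)
    have "z = z \<oplus> n z" by simp
    then show ?case unfolding KS using Suc by blast
  qed
  have step: "K i \<subseteq> K (Suc i)" for i
  proof
    fix a assume a: "a \<in> K i"
    then have "a = a \<oplus> n z" using KT[of i] by (auto simp: subset_iff)
    then show "a \<in> K (Suc i)" unfolding KS using a zK by blast
  qed
  have mono: "K i \<subseteq> K j" if "i \<le> j" for i j using lift_Suc_mono_le[of K, OF step that] .
  define S where "S = (\<Union>i. K i)"
  have diff: "a \<oplus> n b \<in> S" if ab: "a \<in> S" "b \<in> S" for a b
  proof -
    obtain i j where "a \<in> K i" "b \<in> K j" using ab unfolding S_def by blast
    then have "a \<in> K (max i j)" "b \<in> K (max i j)" using mono[of i "max i j"] mono[of j "max i j"] by auto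
    then have "a \<oplus> n b \<in> K (Suc (max i j))" unfolding KS by blast
    then show ?thesis unfolding S_def by blast
  qed
  have ST: "S \<subseteq> H" unfolding S_def using KT by blast
  have zS: "z \<in> S" unfolding S_def using zK by blast
  have neg: "n b \<in> S" if "b \<in> S" for b using diff[OF zS that] ST that by (auto simp: subset_iff)
  have add: "a \<oplus> b \<in> S" if "a \<in> S" "b \<in> S" for a b
    using diff[OF that(1) neg[OF that(2)]] ST that by (auto simp: subset_iff)
  have "subgrp S" unfolding subgrp_def using ST zS add neg by blast
  moreover have "openin T S"
  proof (subst openin_subopen, intro ballI)
    fix h assume h: "h \<in> S"
    then have hT: "h \<in> H" using ST by blast
    have "V \<subseteq> S" unfolding S_def using VK(4) K0 C'_def by blast
    then have "(\<oplus>) h ` V \<subseteq> S" using add[OF h] by blast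
    moreover have "h \<in> (\<oplus>) h ` V" using VK(3) hT by (intro image_eqI[of _ _ z]) simp_all
    ultimately show "\<exists>V'. openin T V' \<and> h \<in> V' \<and> V' \<subseteq> S" using openin_translate_image[OF VK(1) hT] by blast
  qed
  moreover have "C \<subseteq> S" unfolding S_def using K0 C'_def by blast
  ultimately show ?thesis using Kc S_def by (intro exI[of _ S] exI[of _ K]) simp
qed

end

text \<open>\<open>S\<close> is made to contain also the compact set \<open>C0\<close> that
  witnesses cocompactness: if \<open>h\<close> is in \<open>S\<close> and \<open>h\<close> minus the
  star image of \<open>p\<close> is in \<open>C0\<close>, then that star image lies in
  \<open>S\<close>. So the smaller lattice is still cocompact; it is dense because \<open>S\<close>
  is open.\<close>

lemma inter_model_restrict:
  assumes d: "inter_model T f z n L s U W Lam"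
  shows "\<exists>S K. lca.subgrp T f z n S \<and> openin T S \<and> W \<subseteq> S \<and> (\<forall>i::nat. compactin T (K i)) \<and> (\<Union>i. K i) = S \<and>
    inter_model (subtopology T S) f z n {p \<in> L. snd p \<in> S} s U W Lam"
proof -
  note D = inter_modelD[OF d]
  note C = cpsD[OF D(1)]
  interpret lca T f z n by (rule lca.intro[OF C(1)])
  obtain r C0 where C0: "compactin T C0" "\<forall>g. \<forall>h\<in>topspace T. \<exists>p\<in>L. norm (g - fst p) \<le> r \<and> f h (n (snd p)) \<in> C0"
    using C(8) by blast
  obtain S K where S: "subgrp S" "openin T S" "W \<union> C0 \<subseteq> S" "\<forall>i::nat. compactin T (K i)" "(\<Union>i. K i) = S"
    using ex_sigma_compact_open_subgroup[OF compactin_Un[OF D(4) C0(1)]] by blast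
  have ST: "S \<subseteq> topspace T" using S(1) unfolding subgrp_def by blast
  have sub: "topspace (subtopology T S) = S" using ST by (simp add: Int_absorb1)
  let ?L = "{p \<in> L. snd p \<in> S}"
  have US: "U \<subseteq> S" using D(5) S(3) by blast
  have "cps (subtopology T S) f z n ?L"
    unfolding cps_def padd_def
  proof (intro conjI allI impI ballI)
    show "lca_group (subtopology T S) f z n" by (rule lca_group_subgroup[OF S(1,2)])
    show "?L \<subseteq> UNIV \<times> topspace (subtopology T S)" unfolding sub by (auto simp: mem_Times_iff)
    show "(0, z) \<in> ?L" using C(3) S(1) unfolding subgrp_def by simp
    fix p assume p: "p \<in> ?L"
    show "(- fst p, n (snd p)) \<in> ?L" using C(5)[of p] p S(1) unfolding subgrp_def by simp
    fix p' assume p': "p' \<in> ?L"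
    show "(fst p + fst p', f (snd p) (snd p')) \<in> ?L" using C(4)[of p p'] p p' S(1) unfolding subgrp_def by simp
  next
    show "inj_on fst ?L" using C(6) by (rule inj_on_subset) blast
    fix r K assume "compactin (subtopology T S) K"
    then have "finite {p \<in> L. norm (fst p) \<le> r \<and> snd p \<in> K}" by (intro C(7)) (simp add: compactin_subtopology)
    then show "finite {p \<in> ?L. norm (fst p) \<le> r \<and> snd p \<in> K}" by (rule finite_subset[rotated]) blast
  next
    have "\<exists>p\<in>?L. norm (g - fst p) \<le> r \<and> f h (n (snd p)) \<in> C0" if h: "h \<in> S" for g h
    proof -
      have hT: "h \<in> topspace T" using h ST by blast
      then obtain p where p: "p \<in> L" "norm (g - fst p) \<le> r" "f h (n (snd p)) \<in> C0" using C0(2) by blast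
      have pT: "snd p \<in> topspace T" by (rule C(10)[OF p(1)])
      have "f h (n (f h (n (snd p)))) \<in> S" using p(3) S(1,3) h unfolding subgrp_def by blast
      moreover have "f h (n (f h (n (snd p)))) = snd p" using hT pT by (simp add: neg_sub)
      ultimately show ?thesis using p by (intro bexI[of _ p]) simp_all
    qed
    moreover have "compactin (subtopology T S) C0" using C0(1) S(3) by (simp add: compactin_subtopology)
    ultimately show "\<exists>r C. compactin (subtopology T S) C \<and>
        (\<forall>g. \<forall>h\<in>topspace (subtopology T S). \<exists>p\<in>?L. norm (g - fst p) \<le> r \<and> f h (n (snd p)) \<in> C)"
      unfolding sub by (intro exI[of _ r] exI[of _ C0]) simp
    show "subtopology T S closure_of snd ` ?L = topspace (subtopology T S)"
      unfolding dense_intersects_open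
    proof (intro allI impI)
      fix V assume V: "openin (subtopology T S) V \<and> V \<noteq> {}"
      then have "openin T V" "V \<subseteq> S" using S(2) openin_open_subtopology by auto
      then obtain p where "p \<in> L" "snd p \<in> V" using C(12)[of V] V by blast
      then show "snd ` ?L \<inter> V \<noteq> {}" using \<open>V \<subseteq> S\<close> by blast
    qed
  qed
  moreover have "openin (subtopology T S) U" using D(2) US S(2) openin_open_subtopology by blast
  moreover have "compactin (subtopology T S) W" using D(4) S(3) by (simp add: compactin_subtopology)
  moreover have "\<forall>y\<in>Lam. \<exists>p\<in>?L. snd p \<in> W \<and> y = s + fst p" using D(7) S(3) by blast
  moreover have "\<forall>p\<in>?L. snd p \<in> U \<longrightarrow> s + fst p \<in> Lam" using D(6) by blast
  ultimately have "inter_model (subtopology T S) f z n ?L s U W Lam"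
    unfolding inter_model_def using D(3,5) by blast
  with S show ?thesis by blast
qed

section \<open>Quotients by small compact subgroups\<close>

lemma (in lca) approximation_gap_sets:
  assumes "weak_haar T f \<mu>" "\<And>i::nat. openin T (O1 i)" "\<And>i::nat. compactin T (K1 i)"
  shows "(\<Inter>i. O1 i) - (\<Union>i. K1 i) \<in> sets \<mu>"
proof -
  have "O1 i \<in> sets \<mu>" "K1 i \<in> sets \<mu>" for i
    using openin_borel[OF assms(2)] closedin_borel[OF compactin_closed[OF assms(3)]] weak_haarD(1)[OF assms(1)] by simp_all
  then show ?thesis by (intro sets.Diff sets.countable_INT' sets.countable_UN') auto
qed

text \<open>A variant of the Kakutani--Kodaira theorem: the window is approximated from outside by the open
  sets \<open>O1 i\<close> and from inside by the compact sets \<open>K1 i\<close>, and a compact subgroup \<open>N\<close> is found that respects all these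
  approximations and has a second countable quotient.\<close>

lemma (in lca) inter_model_second_countable:
  fixes L :: "('g::euclidean_space \<times> 'a) set"
  assumes d: "inter_model T f z n L s U W Lam"
    and S: "\<And>i. compactin T (S (i::nat))" "(\<Union>i. S i) = H"
    and O1: "\<And>i::nat. openin T (O1 i)" "\<And>i. W \<subseteq> O1 i"
    and K1: "\<And>i::nat. compactin T (K1 i)" "\<And>i. K1 i \<subseteq> U" "(\<Union>i. K1 i) \<noteq> {}"
  shows "\<exists>(T' :: nat set topology) f' z' n' L' U' W'. inter_model T' f' z' n' L' s U' W' Lam \<and>
    second_countable T' \<and> (\<forall>\<mu>. weak_haar T f \<mu> \<and> emeasure \<mu> ((\<Inter>i. O1 i) - (\<Union>i. K1 i)) = 0 \<longrightarrow> haar_null T' f' (W' - U'))"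
proof -
  note D = inter_modelD[OF d]
  note C = cpsD[OF D(1)]
  obtain V0 C0 where VC: "openin T V0" "compactin T C0" "z \<in> V0" "V0 \<subseteq> C0"
    using locally_compact zero_closed unfolding locally_compact_space_def by meson
  \<comment> \<open>The difference condition makes the intersection of the \<open>V i\<close> a
    closed subgroup, and the bound \<open>C0\<close> makes it compact. The last two conditions
    ensure that adding its elements keeps \<open>W\<close> inside each \<open>O1 i\<close> and each
    \<open>K1 i\<close> inside \<open>U\<close>.\<close>
  have "\<exists>V. \<forall>i::nat. (openin T (V i) \<and> z \<in> V i \<and> V i \<subseteq> C0) \<and>
     (V (Suc i) \<subseteq> V i \<and> (\<forall>a\<in>V (Suc i). \<forall>b\<in>V (Suc i). a \<oplus> n b \<in> V i) \<and>
      (\<forall>w\<in>W. \<forall>v\<in>V (Suc i). w \<oplus> v \<in> O1 i) \<and> (\<forall>k\<in>K1 i. \<forall>v\<in>V (Suc i). k \<oplus> v \<in> U))"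
  proof (rule dependent_nat_choice)
    show "\<exists>x. openin T x \<and> z \<in> x \<and> x \<subseteq> C0" using VC by blast
    fix V and i :: nat assume V: "openin T V \<and> z \<in> V \<and> V \<subseteq> C0"
    obtain A where A: "openin T A" "z \<in> A" "A \<subseteq> V" "\<And>a b. a \<in> A \<Longrightarrow> b \<in> A \<Longrightarrow> a \<oplus> n b \<in> V"
      using small_nbhd[of V] V by metis
    obtain B where B: "openin T B" "z \<in> B" "\<And>k v. k \<in> W \<Longrightarrow> v \<in> B \<Longrightarrow> k \<oplus> v \<in> O1 i"
      using compact_nbhd_in_open[OF D(4) O1(1) O1(2)] by metis
    obtain B' where B': "openin T B'" "z \<in> B'" "\<And>k v. k \<in> K1 i \<Longrightarrow> v \<in> B' \<Longrightarrow> k \<oplus> v \<in> U"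
      using compact_nbhd_in_open[OF K1(1) D(2) K1(2)] by metis
    show "\<exists>y. (openin T y \<and> z \<in> y \<and> y \<subseteq> C0) \<and> y \<subseteq> V \<and> (\<forall>a\<in>y. \<forall>b\<in>y. a \<oplus> n b \<in> V) \<and>
        (\<forall>w\<in>W. \<forall>v\<in>y. w \<oplus> v \<in> O1 i) \<and> (\<forall>k\<in>K1 i. \<forall>v\<in>y. k \<oplus> v \<in> U)"
      using A B B' V by (intro exI[of _ "A \<inter> B \<inter> B'"]) auto
  qed
  then obtain V :: "nat \<Rightarrow> 'a set" where
    V: "\<forall>i. (openin T (V i) \<and> z \<in> V i \<and> V i \<subseteq> C0) \<and>
     (V (Suc i) \<subseteq> V i \<and> (\<forall>a\<in>V (Suc i). \<forall>b\<in>V (Suc i). a \<oplus> n b \<in> V i) \<and>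
      (\<forall>w\<in>W. \<forall>v\<in>V (Suc i). w \<oplus> v \<in> O1 i) \<and> (\<forall>k\<in>K1 i. \<forall>v\<in>V (Suc i). k \<oplus> v \<in> U))" by (elim exE)
  have Vo: "openin T (V i)" and Vz: "z \<in> V i" and VC0: "V i \<subseteq> C0" and Vd: "V (Suc i) \<subseteq> V i" for i
    using V by simp_all
  have Vm: "a \<oplus> n b \<in> V i" if "a \<in> V (Suc i)" "b \<in> V (Suc i)" for a b i using V that by blast
  have VW: "w \<oplus> v \<in> O1 i" if "w \<in> W" "v \<in> V (Suc i)" for w v i using V that by blast
  have VK: "k \<oplus> v \<in> U" if "k \<in> K1 i" "v \<in> V (Suc i)" for k v i using V that by blast
  have VT: "V i \<subseteq> H" for i using Vo by (rule openin_subset)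
  have mono: "V j \<subseteq> V i" if "i \<le> j" for i j using lift_Suc_antimono_le[of V, OF Vd that] .
  define N where "N = (\<Inter>i. V i)"
  have NV: "N \<subseteq> V i" for i unfolding N_def by blast
  have NT: "N \<subseteq> H" using NV[of 0] VT[of 0] by (rule subset_trans)
  have Nz: "z \<in> N" unfolding N_def using Vz by blast
  have Ndiff: "a \<oplus> n b \<in> N" if "a \<in> N" "b \<in> N" for a b
    unfolding N_def using Vm that NV by blast
  have Nneg: "n b \<in> N" if "b \<in> N" for b using Ndiff[OF Nz that] subsetD[OF NT that] by simp
  have Nadd: "a \<oplus> b \<in> N" if "a \<in> N" "b \<in> N" for a b
    using Ndiff[OF that(1) Nneg[OF that(2)]] subsetD[OF NT that(2)] by simp
  have sgN: "subgrp N" unfolding subgrp_def using NT Nz Nadd Nneg by blast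
  have Vadd: "v \<oplus> w \<in> V i" if "v \<in> V (Suc i)" "w \<in> N" for v w i
    using Vm[OF that(1), of "n w"] Nneg[OF that(2)] NV[of "Suc i"] subsetD[OF NT that(2)] by auto
  \<comment> \<open>A point in the closure of \<open>V (Suc i)\<close> is a difference of two of its
    elements. Hence \<open>N\<close> is also the intersection of the closures and thus
    closed.\<close>
  have Vcl: "T closure_of (V (Suc i)) \<subseteq> V i" for i
  proof
    fix x assume x: "x \<in> T closure_of (V (Suc i))"
    then have xT: "x \<in> H" using closure_of_subset_topspace by fast
    have "x \<in> (\<oplus>) x ` V (Suc i)" using Vz[of "Suc i"] xT by (intro image_eqI[of _ _ z]) simp_all
    then obtain y where y: "y \<in> V (Suc i)" "y \<in> (\<oplus>) x ` V (Suc i)"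
      using x openin_translate_image[OF Vo xT] unfolding in_closure_of by meson
    then obtain w where w: "w \<in> V (Suc i)" "y = x \<oplus> w" by blast
    have "w \<in> H" using w(1) VT by blast
    then have "x = y \<oplus> n w" using w(2) xT by simp
    then show "x \<in> V i" using Vm[OF y(1) w(1)] by simp
  qed
  have Ncl: "N = (\<Inter>i. T closure_of (V i))"
  proof
    show "N \<subseteq> (\<Inter>i. T closure_of (V i))" using NV closure_of_subset[OF VT] by blast
    show "(\<Inter>i. T closure_of (V i)) \<subseteq> N" unfolding N_def using Vcl by blast
  qed
  have clN: "closedin T N" unfolding Ncl by (intro closedin_INT) auto
  have cmN: "compactin T N" using NV[of 0] VC0[of 0] clN by (intro closed_compactin[OF VC(2)]) auto
  \<comment> \<open>Compactness of \<open>C0\<close>: it is covered by \<open>X\<close> and the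
    complements of the decreasing closures, so a single \<open>V k\<close> already lies in
    \<open>X\<close>.\<close>
  have base: "\<exists>i. V i \<subseteq> X" if X: "openin T X" "N \<subseteq> X" for X
  proof -
    let ?A = "\<lambda>i. X \<union> (H - T closure_of (V i))"
    have op: "openin T (?A i)" for i using X(1) by (intro openin_Un) auto
    have cov: "C0 \<subseteq> (\<Union>i\<in>UNIV. ?A i)"
    proof
      fix x assume x: "x \<in> C0"
      then have xT: "x \<in> H" using compactin_subset_topspace[OF VC(2)] by blast
      show "x \<in> (\<Union>i\<in>UNIV. ?A i)"
      proof (cases "x \<in> N")
        case False
        then show ?thesis using xT unfolding Ncl by blast
      qed (use X(2) in blast)
    qed
    obtain F where F: "finite F" "C0 \<subseteq> (\<Union>i\<in>F. ?A i)"
      using compactin_subcover[OF VC(2) op cov] by metis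
    define k where "k = Max (insert 0 F)"
    have k: "i \<le> k" if "i \<in> F" for i unfolding k_def using F(1) that by (intro Max_ge) auto
    have "V k \<subseteq> X"
    proof
      fix v assume v: "v \<in> V k"
      then have "v \<in> (\<Union>i\<in>F. ?A i)" using VC0 F(2) by blast
      then obtain i where i: "i \<in> F" "v \<in> ?A i" by (elim UN_E)
      have "v \<in> T closure_of (V i)" using v mono[OF k[OF i(1)]] closure_of_subset[OF VT] by blast
      then show "v \<in> X" using i(2) by blast
    qed
    then show ?thesis by blast
  qed
  have cL: "countable L" by (rule cps_countable[OF D(1) S])
  \<comment> \<open>Translates of the \<open>V i\<close> by star images of lattice points. They are
    countable in number and, since these images are dense, refine every \<open>N\<close>-invariant
    open set; no countable base of the original group is involved.\<close>
  define B where "B = (\<lambda>p. (\<oplus>) (snd (fst p)) ` V (snd p)) ` (L \<times> UNIV)"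
  have cB: "countable B" unfolding B_def using cL by simp
  have oB: "openin T X" if "X \<in> B" for X
  proof -
    obtain l i where "l \<in> L" "X = (\<oplus>) (snd l) ` V i" using \<open>X \<in> B\<close> unfolding B_def by force
    then show ?thesis using openin_translate_image[OF Vo C(10)] by simp
  qed
  have "\<exists>Y\<in>B. h \<in> Y \<and> Y \<subseteq> X" if X: "openin T X" "h \<in> X" and sat: "\<And>s v. s \<in> X \<Longrightarrow> v \<in> N \<Longrightarrow> s \<oplus> v \<in> X" for X h
  proof -
    have h: "h \<in> H" using X openin_subset by blast
    have "N \<subseteq> {x \<in> H. h \<oplus> x \<in> X}" using NT sat[OF X(2)] by blast
    then obtain i where i: "V i \<subseteq> {x \<in> H. h \<oplus> x \<in> X}"
      using base[OF openin_translate[OF X(1) h]] by blast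
    have "continuous_map T T (\<lambda>x. h \<oplus> n x)" using h by (intro continuous_intros) simp_all
    from openin_continuous_map_preimage[OF this Vo[of "Suc i"]]
    have "openin T {x \<in> H. h \<oplus> n x \<in> V (Suc i)}" .
    moreover have "h \<in> {x \<in> H. h \<oplus> n x \<in> V (Suc i)}" using h Vz by simp
    \<comment> \<open>With \<open>h\<close> and the lattice point closer than
      \<open>V (Suc i)\<close>, the translate of \<open>V (Suc i)\<close> at the lattice point
      contains \<open>h\<close> and stays in the translate of \<open>V i\<close> at
      \<open>h\<close>.\<close>
    ultimately obtain l where l: "l \<in> L" "h \<oplus> n (snd l) \<in> V (Suc i)" using C(12) by blast
    have lT: "snd l \<in> H" by (rule C(10)[OF l(1)])
    let ?Y = "(\<oplus>) (snd l) ` V (Suc i)"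
    have "h \<in> ?Y" using l(2) h lT by (intro image_eqI[of _ _ "h \<oplus> n (snd l)"]) simp_all
    moreover have "?Y \<subseteq> X"
    proof
      fix y assume "y \<in> ?Y"
      then obtain w where w: "w \<in> V (Suc i)" "y = snd l \<oplus> w" by blast
      have wT: "w \<in> H" using w(1) VT by blast
      have "w \<oplus> n (h \<oplus> n (snd l)) \<in> V i" by (rule Vm[OF w(1) l(2)])
      then have "h \<oplus> (w \<oplus> n (h \<oplus> n (snd l))) \<in> X" using i by blast
      moreover have "h \<oplus> (w \<oplus> n (h \<oplus> n (snd l))) = y"
      proof -
        have "w \<oplus> n (h \<oplus> n (snd l)) = w \<oplus> snd l \<oplus> n h"
          using h lT wT assoc[of w "snd l" "n h"] by (simp add: neg_sub)
        then show ?thesis using h lT wT w(2) comm[of w "snd l"] by simp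
      qed
      ultimately show "y \<in> X" by simp
    qed
    moreover have "?Y \<in> B" unfolding B_def using l(1) by (intro image_eqI[of _ _ "(l, Suc i)"]) simp_all
    ultimately show ?thesis by blast
  qed
  then obtain T' :: "nat set topology" and f' z' n' q where q: "lca_quot T f z n N T' f' z' n' q"
    using ex_lca_quot[OF sgN clN cB oB] by blast
  note Q = lca_quotD[OF q]
  define L' where "L' = (\<lambda>p. (fst p, q (snd p))) ` L"
  have cps': "cps T' f' z' n' L'"
  proof -
    obtain r K where K: "compactin T K" "\<And>g h. h \<in> H \<Longrightarrow> \<exists>p\<in>L. norm (g - fst p) \<le> r \<and> f h (n (snd p)) \<in> K"
      using C(8) by blast
    show ?thesis unfolding L'_def
    proof (rule cps_quotient[OF q sgN C(2,3) C(4) C(5)])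
      show "snd p \<in> N" if "p \<in> L" "fst p = 0" for p
      proof -
        have "p = (0, z)" using C(6) that C(3) by (intro inj_onD[OF C(6)]) auto
        then show ?thesis using Nz by simp
      qed
      fix r C1 assume C1: "compactin T C1"
      let ?D = "{c \<oplus> n v |c v. c \<in> C1 \<and> v \<in> N}"
      have "{p \<in> L. norm (fst p) \<le> r \<and> (\<exists>v\<in>N. snd p \<oplus> v \<in> C1)} \<subseteq> {p \<in> L. norm (fst p) \<le> r \<and> snd p \<in> ?D}"
      proof
        fix p assume "p \<in> {p \<in> L. norm (fst p) \<le> r \<and> (\<exists>v\<in>N. snd p \<oplus> v \<in> C1)}"
        then obtain v where v: "p \<in> L" "norm (fst p) \<le> r" "v \<in> N" "snd p \<oplus> v \<in> C1" by blast
        have "snd p = snd p \<oplus> v \<oplus> n v" using C(10)[OF v(1)] subsetD[OF NT v(3)] by simp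
        then have "snd p \<in> ?D" using v(3,4) by blast
        then show "p \<in> {p \<in> L. norm (fst p) \<le> r \<and> snd p \<in> ?D}" using v by simp
      qed
      then show "finite (fst ` {p \<in> L. norm (fst p) \<le> r \<and> (\<exists>v\<in>N. snd p \<oplus> v \<in> C1)})"
        using C(7)[OF compactin_diff[OF C1 cmN]] by (intro finite_imageI) (rule finite_subset)
    next
      show "compactin T K" by (rule K(1))
      show "\<exists>p\<in>L. norm (g - fst p) \<le> r \<and> h \<oplus> n (snd p) \<in> K" if "h \<in> H" for g h by (rule K(2)[OF that])
      show "\<exists>p\<in>L. snd p \<in> X" if "openin T X" "X \<noteq> {}" for X by (rule C(12)[OF that])
    qed
  qed
  \<comment> \<open>Two indices are given away: saturating by \<open>N\<close> takes
    \<open>V (Suc (Suc i))\<close> into \<open>V (Suc i)\<close>, and sums of \<open>K1 i\<close>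
    with the latter are still in \<open>U\<close>. So even the saturation of \<open>U1\<close> stays
    inside \<open>U\<close>.\<close>
  define U1 where "U1 = (\<Union>i. \<Union>k\<in>K1 i. (\<oplus>) k ` V (Suc (Suc i)))"
  define U' where "U' = q ` U1"
  define W' where "W' = q ` W"
  have KT: "K1 i \<subseteq> H" for i using K1(1) by (rule compactin_subset_topspace)
  have oU1: "openin T U1"
    unfolding U1_def using KT openin_translate_image[OF Vo] by (intro openin_Union) blast
  have U1T: "U1 \<subseteq> H" using oU1 by (rule openin_subset)
  have preU: "y \<in> U" if y: "y \<in> H" "q y \<in> U'" for y
  proof -
    obtain u where u: "u \<in> U1" "q y = q u" using y(2) unfolding U'_def by blast
    then obtain i k v where k: "k \<in> K1 i" "v \<in> V (Suc (Suc i))" "u = k \<oplus> v" unfolding U1_def by blast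
    have m: "k \<in> H" "v \<in> H" using k KT VT by blast+
    have uT: "u \<in> H" using k(3) m by simp
    have nu: "y \<oplus> n u \<in> N" using Q(10)[OF y(1) uT] u(2) by simp
    have "k \<oplus> (v \<oplus> (y \<oplus> n u)) \<in> U" by (rule VK[OF k(1) Vadd[OF k(2) nu]])
    moreover have "k \<oplus> (v \<oplus> (y \<oplus> n u)) = k \<oplus> v \<oplus> (y \<oplus> n u)"
      using m y(1) k(3) by (intro assoc[symmetric]) simp_all
    moreover have "k \<oplus> v \<oplus> (y \<oplus> n u) = y" using m y(1) k(3) by (simp add: cancel_middle del: assoc)
    ultimately show ?thesis by simp
  qed
  have K1U: "K1 i \<subseteq> U1" for i
  proof
    fix k assume k: "k \<in> K1 i"
    then have "k \<in> H" using KT by blast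
    then have "k \<in> (\<oplus>) k ` V (Suc (Suc i))" using Vz by (intro image_eqI[of _ _ z]) simp_all
    then show "k \<in> U1" unfolding U1_def using k by blast
  qed
  have opU: "openin T' U'" unfolding U'_def using Q(4) oU1 unfolding open_map_def by simp
  have cmW: "compactin T' W'" unfolding W'_def using D(4) Q(3) by (rule image_compactin)
  have U1U: "U1 \<subseteq> U" using preU U1T unfolding U'_def by blast
  have "inter_model T' f' z' n' L' s U' W' Lam"
    unfolding inter_model_def
  proof (intro conjI ballI impI)
    show "U' \<noteq> {}" unfolding U'_def using K1(3) K1U by blast
    show "U' \<subseteq> W'" unfolding U'_def W'_def using U1U D(5) by (intro image_mono) (rule subset_trans)
  next
    fix p assume p: "p \<in> L'" "snd p \<in> U'"
    then obtain l where l: "l \<in> L" "p = (fst l, q (snd l))" unfolding L'_def by blast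
    then have "snd l \<in> U" using preU[OF C(10)[OF l(1)]] p(2) by simp
    then show "s + fst p \<in> Lam" using D(6)[OF l(1)] l(2) by simp
  next
    fix y assume "y \<in> Lam"
    then obtain l where l: "l \<in> L" "snd l \<in> W" "y = s + fst l" using D(7) by blast
    then show "\<exists>p\<in>L'. snd p \<in> W' \<and> y = s + fst p"
      unfolding L'_def W'_def by (intro bexI[of _ "(fst l, q (snd l))"]) auto
  qed (rule cps' opU cmW)+
  moreover have "haar_null T' f' (W' - U')" if weak_haar: "weak_haar T f \<mu>" and null: "emeasure \<mu> ((\<Inter>i. O1 i) - (\<Union>i. K1 i)) = 0" for \<mu>
  proof -
    interpret T': lca T' f' z' n' by (rule lca.intro[OF Q(1)])
    let ?\<mu>' = "distr \<mu> (borel_of T') q"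
    have m: "W' - U' \<in> sets (borel_of T')"
      using closedin_borel[OF T'.compactin_closed[OF cmW]] openin_borel[OF opU] by simp
    \<comment> \<open>The saturation of \<open>W\<close> is inside every \<open>O1 i\<close>, and
      \<open>U1\<close> contains every \<open>K1 i\<close>; what the quotient loses is therefore
      confined to the gap of the approximations.\<close>
    have "{h \<in> H. q h \<in> W' - U'} \<subseteq> (\<Inter>i. O1 i) - (\<Union>i. K1 i)"
    proof
      fix y assume y: "y \<in> {h \<in> H. q h \<in> W' - U'}"
      then obtain w where w: "w \<in> W" "q y = q w" unfolding W'_def by blast
      have wT: "w \<in> H" using w(1) D(9) by blast
      have yT: "y \<in> H" using y by simp
      have "y \<oplus> n w \<in> N" using Q(10)[OF yT wT] w(2) by simp
      then have "w \<oplus> (y \<oplus> n w) \<in> O1 i" for i using VW[OF w(1)] subsetD[OF NV[of "Suc i"]] by simp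
      moreover have "w \<oplus> (y \<oplus> n w) = y" using yT wT by simp
      moreover have "y \<notin> K1 i" for i
      proof
        assume "y \<in> K1 i"
        then have "q y \<in> U'" unfolding U'_def using K1U by blast
        then show False using y by simp
      qed
      ultimately show "y \<in> (\<Inter>i. O1 i) - (\<Union>i. K1 i)" by simp
    qed
    moreover have "(\<Inter>i. O1 i) - (\<Union>i. K1 i) \<in> sets \<mu>" by (rule approximation_gap_sets[OF weak_haar O1(1) K1(1)])
    ultimately have "emeasure \<mu> {h \<in> H. q h \<in> W' - U'} \<le> emeasure \<mu> ((\<Inter>i. O1 i) - (\<Union>i. K1 i))"
      by (rule emeasure_mono)
    then have "emeasure ?\<mu>' (W' - U') = 0" using weak_haar_push_compact(2)[OF q cmN weak_haar m] null by simp
    then show ?thesis using weak_haar_push_compact(1)[OF q cmN weak_haar] m unfolding haar_null_def by (intro exI[of _ ?\<mu>']) simp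
  qed
  ultimately show ?thesis using Q(2) by blast
qed

text \<open>Outer regularity for \<open>W\<close> and inner regularity for \<open>U\<close>, each
  along a sequence attaining the infimum or supremum. Since \<open>W\<close> has finite measure,
  equality of measures makes the differences null. Here the regularity clauses of the given Haar
  measure enter.\<close>

lemma (in lca) haar_measure_approx:
  assumes mu: "haar_measure T f \<mu>" and W: "compactin T W" and U: "openin T U" "U \<subseteq> W" "U \<noteq> {}"
    and null: "emeasure \<mu> (W - U) = 0"
  shows "\<exists>O1 K1. (\<forall>i::nat. openin T (O1 i) \<and> W \<subseteq> O1 i \<and> compactin T (K1 i) \<and> K1 i \<subseteq> U) \<and> (\<Union>i. K1 i) \<noteq> {} \<and>
    emeasure \<mu> ((\<Inter>i. O1 i) - (\<Union>i. K1 i)) = 0"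
proof -
  note H = mu[unfolded haar_measure_def]
  have op: "V \<in> sets \<mu>" if "openin T V" for V using openin_borel[OF that] H by simp
  have cm: "K \<in> sets \<mu>" if "compactin T K" for K using closedin_borel[OF compactin_closed[OF that]] H by simp
  obtain u where u: "u \<in> U" using U(3) by blast
  have WT: "W \<subseteq> H" using W by (rule compactin_subset_topspace)
  have uT: "u \<in> H" using u U(2) WT by blast
  have fW: "emeasure \<mu> W \<noteq> \<infinity>" using H W by auto
  let ?IO = "{V. openin T V \<and> W \<subseteq> V}" and ?IK = "{K. compactin T K \<and> K \<subseteq> U}"
  have eW: "emeasure \<mu> W = (INF V\<in>?IO. emeasure \<mu> V)" using H cm[OF W] by blast
  have eU: "emeasure \<mu> U = (SUP K\<in>?IK. emeasure \<mu> K)" using H U(1) by blast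
  have "H \<in> ?IO" using WT by simp
  then have "emeasure \<mu> ` ?IO \<noteq> {}" by blast
  then obtain g where g: "range g \<subseteq> emeasure \<mu> ` ?IO" "Inf (emeasure \<mu> ` ?IO) = (INF i::nat. g i)"
    using ennreal_Inf_countable_INF by meson
  then have "\<forall>i. \<exists>V. V \<in> ?IO \<and> g i = emeasure \<mu> V" by blast
  then obtain O1 where O1: "\<And>i. O1 i \<in> ?IO" "\<And>i. g i = emeasure \<mu> (O1 i)" by metis
  have "{} \<in> ?IK" by simp
  then have "?IK \<noteq> {}" by blast
  then obtain g' :: "nat \<Rightarrow> ennreal" where g': "range g' \<subseteq> emeasure \<mu> ` ?IK" "Sup (emeasure \<mu> ` ?IK) = (SUP i. g' i)"
    using ennreal_SUP_countable_SUP[of ?IK "emeasure \<mu>"] by blast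
  then have "\<forall>i. \<exists>K. K \<in> ?IK \<and> g' i = emeasure \<mu> K" by blast
  then obtain K where K: "\<And>i. K i \<in> ?IK" "\<And>i. g' i = emeasure \<mu> (K i)" by metis
  \<comment> \<open>The compact sets chosen for the supremum could all be empty, for instance if
    \<open>U\<close> were null for the sequence chosen; the point \<open>u\<close> keeps the later
    open window nonempty.\<close>
  define K1 where "K1 i = {u} \<union> K i" for i
  have K1: "compactin T (K1 i)" "K1 i \<subseteq> U" for i
  proof -
    have "compactin T (K i)" "K i \<subseteq> U" using K(1)[of i] by simp_all
    then show "compactin T (K1 i)" "K1 i \<subseteq> U"
      using u compactin_Un[OF finite_imp_compactin[of "{u}" T]] uT unfolding K1_def by simp_all
  qed
  have mO: "(\<Inter>i. O1 i) \<in> sets \<mu>" using O1(1) op by (intro sets.countable_INT') auto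
  have mK: "(\<Union>i. K1 i) \<in> sets \<mu>" using K1(1) cm by (intro sets.countable_UN') auto
  have mW: "W \<in> sets \<mu>" and mU: "U \<in> sets \<mu>" using cm[OF W] op[OF U(1)] .
  have "emeasure \<mu> (\<Inter>i. O1 i) \<le> emeasure \<mu> W"
    unfolding eW g(2) O1(2) using op O1(1) by (intro INF_greatest emeasure_mono) auto
  moreover have WO: "W \<subseteq> (\<Inter>i. O1 i)" using O1(1) by blast
  ultimately have eqW: "emeasure \<mu> (\<Inter>i. O1 i) = emeasure \<mu> W"
    using emeasure_mono[OF WO mO] by (intro antisym)
  have d1: "emeasure \<mu> ((\<Inter>i. O1 i) - W) = 0"
    using emeasure_Diff[OF fW mO mW WO] eqW fW by simp
  have "emeasure \<mu> U \<le> emeasure \<mu> (\<Union>i. K1 i)"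
    unfolding eU g'(2) K(2) using mK by (intro SUP_least emeasure_mono) (auto simp: K1_def)
  moreover have KU: "(\<Union>i. K1 i) \<subseteq> U" using K1(2) by blast
  ultimately have eqU: "emeasure \<mu> (\<Union>i. K1 i) = emeasure \<mu> U"
    using emeasure_mono[OF KU mU] by (intro antisym)
  have fK: "emeasure \<mu> (\<Union>i. K1 i) \<noteq> \<infinity>"
    using emeasure_mono[OF subset_trans[OF KU U(2)] mW] fW by (auto simp: top_unique)
  have d2: "emeasure \<mu> (U - (\<Union>i. K1 i)) = 0"
    using emeasure_Diff[OF fK mU mK KU] eqU fK by simp
  \<comment> \<open>The gap splits into the outer excess, the given null set and the inner
    deficit.\<close>
  have "(\<Inter>i. O1 i) - W \<union> (W - U) \<union> (U - (\<Union>i. K1 i)) \<in> null_sets \<mu>"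
    using d1 d2 null mO mK mW mU by (intro null_sets.Un) (auto simp: null_sets_def)
  then have "(\<Inter>i. O1 i) - (\<Union>i. K1 i) \<in> null_sets \<mu>"
    by (rule null_sets_subset) (use mO mK in auto)
  then have "emeasure \<mu> ((\<Inter>i. O1 i) - (\<Union>i. K1 i)) = 0" by (simp add: null_sets_def)
  moreover have "(\<Union>i. K1 i) \<noteq> {}" unfolding K1_def by blast
  ultimately show ?thesis using O1(1) K1 by (intro exI[of _ O1] exI[of _ K1]) simp
qed

section \<open>Composition of the changes of scheme\<close>

theorem theorem2p9:
  fixes Lam :: "'g::euclidean_space set"
    and T :: "'h topology" and f :: "'h \<Rightarrow> 'h \<Rightarrow> 'h" and z :: 'h and n :: "'h \<Rightarrow> 'h"
    and L :: "('g \<times> 'h) set" and x :: "'g \<times> 'h" and U W :: "'h set"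
  assumes "cp_scheme T f z n L"
    and "snd x \<in> topspace T"
    and "openin T U" and "U \<noteq> {}"
    and "compactin T W" and "U \<subseteq> W"
    and "cp_set f L U x \<subseteq> Lam" and "Lam \<subseteq> cp_set f L W x"
  shows "(\<exists>(T' :: nat set topology) f' z' n' L' W'.
            model_set_witness Lam T' f' z' n' L' W')
       \<and> ((\<exists>\<mu>. haar_measure T f \<mu> \<and> emeasure \<mu> (W - U) = 0) \<longrightarrow>
          (\<exists>(T' :: nat set topology) f' z' n' L' W'.
            model_set_witness Lam T' f' z' n' L' W' \<and>
            (\<exists>\<mu>'. haar_measure T' f' \<mu>' \<and> emeasure \<mu>' (boundary_in T' W') = 0)))"
proof -
  have cps: "cps T f z n L" by (rule cp_scheme_imp_cps) fact
  note C = cpsD[OF cps]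
  interpret lca T f z n by (rule lca.intro[OF C(1)])
  let ?t = "snd x"
  define U1 where "U1 = {h \<in> topspace T. f ?t h \<in> U}"
  define W1 where "W1 = {h \<in> topspace T. f ?t h \<in> W}"
  have WT: "W \<subseteq> topspace T" using assms(5) by (rule compactin_subset_topspace)
  have W1: "W1 = f (n ?t) ` W" unfolding W1_def using translate_image[of "n ?t" W] WT assms(2) by simp
  have oU1: "openin T U1" unfolding U1_def by (rule openin_translate) fact+
  have cW1: "compactin T W1" unfolding W1 using assms(2,5) by (intro compactin_translate) simp_all
  have UW1: "U1 \<subseteq> W1" unfolding U1_def W1_def using assms(6) by blast
  have neU1: "U1 \<noteq> {}"
  proof -
    obtain u where u: "u \<in> U" using assms(4) by blast
    then have "u \<in> topspace T" using assms(6) WT by blast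
    then have "f (n ?t) u \<in> U1" unfolding U1_def using u assms(2) by simp
    then show ?thesis by blast
  qed
  have d: "inter_model T f z n L (fst x) U1 W1 Lam"
    unfolding inter_model_def
  proof (intro conjI ballI impI)
    fix p assume p: "p \<in> L" "snd p \<in> U1"
    have "padd f x p \<in> {q \<in> padd f x ` L. snd q \<in> U}" using p unfolding U1_def by (simp add: padd_def)
    then have "fst (padd f x p) \<in> cp_set f L U x" unfolding cp_set_def by (rule imageI)
    then show "fst x + fst p \<in> Lam" using assms(7) by (auto simp: padd_def)
  next
    fix y assume "y \<in> Lam"
    then have "y \<in> cp_set f L W x" using assms(8) by blast
    then obtain p where p: "p \<in> L" "snd (padd f x p) \<in> W" "y = fst (padd f x p)" unfolding cp_set_def by blast
    then show "\<exists>p\<in>L. snd p \<in> W1 \<and> y = fst x + fst p"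
      unfolding W1_def using C(10)[OF p(1)] by (intro bexI[of _ p]) (simp_all add: padd_def)
  qed (fact cps oU1 neU1 cW1 UW1)+
  let ?null = "\<exists>\<mu>. haar_measure T f \<mu> \<and> emeasure \<mu> (W - U) = 0"
  \<comment> \<open>Both claims of the theorem are served by one construction: the approximations
    are chosen well if a suitable measure exists, and otherwise arbitrarily, with the whole group
    outside and one point inside.\<close>
  have "\<exists>O1 K1. (\<forall>i::nat. openin T (O1 i) \<and> W1 \<subseteq> O1 i \<and> compactin T (K1 i) \<and> K1 i \<subseteq> U1) \<and> (\<Union>i. K1 i) \<noteq> {} \<and>
    (?null \<longrightarrow> (\<exists>\<mu>. weak_haar T f \<mu> \<and> emeasure \<mu> ((\<Inter>i. O1 i) - (\<Union>i. K1 i)) = 0))"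
  proof (cases ?null)
    case True
    then obtain \<mu> where mu: "haar_measure T f \<mu>" "emeasure \<mu> (W - U) = 0" by blast
    have weak_haar: "weak_haar T f \<mu>" by (rule haar_measure_imp_weak_haar[OF mu(1)])
    have "W - U \<in> sets \<mu>"
      using closedin_borel[OF compactin_closed[OF assms(5)]] openin_borel[OF assms(3)] weak_haarD(1)[OF weak_haar] by simp
    moreover have "W1 - U1 = {h \<in> topspace T. f ?t h \<in> W - U}" unfolding W1_def U1_def by blast
    ultimately have "emeasure \<mu> (W1 - U1) = 0" using weak_haarD(2)[OF weak_haar assms(2)] mu(2) by (simp only:)
    from haar_measure_approx[OF mu(1) cW1 oU1 UW1 neU1 this] weak_haar show ?thesis by blast
  next
    case False
    obtain u where u: "u \<in> U1" using neU1 by blast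
    then have "u \<in> topspace T" unfolding U1_def by blast
    then show ?thesis using False u compactin_subset_topspace[OF cW1]
      by - (rule exI[of _ "\<lambda>_. topspace T"], rule exI[of _ "\<lambda>_. {u}"], auto)
  qed
  then obtain O1 K1 where OK0: "\<forall>i::nat. openin T (O1 i) \<and> W1 \<subseteq> O1 i \<and> compactin T (K1 i) \<and> K1 i \<subseteq> U1"
    and OK1: "(\<Union>i. K1 i) \<noteq> {}"
    and OK2: "?null \<longrightarrow> (\<exists>\<mu>. weak_haar T f \<mu> \<and> emeasure \<mu> ((\<Inter>i. O1 i) - (\<Union>i. K1 i)) = 0)"
    by (elim exE conjE)
  have OK: "openin T (O1 i)" "W1 \<subseteq> O1 i" "compactin T (K1 i)" "K1 i \<subseteq> U1" for i
    using OK0 by simp_all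
  obtain S K where S: "subgrp S" "openin T S" "W1 \<subseteq> S" "\<And>i::nat. compactin T (K i)" "(\<Union>i. K i) = S"
    and d0: "inter_model (subtopology T S) f z n {p \<in> L. snd p \<in> S} (fst x) U1 W1 Lam"
    using inter_model_restrict[OF d] by blast
  let ?T = "subtopology T S"
  interpret S: lca ?T f z n by (rule lca.intro[OF cpsD(1)[OF inter_modelD(1)[OF d0]]])
  have tS: "topspace ?T = S" using S(1) unfolding subgrp_def by (simp add: Int_absorb1)
  have "\<exists>(T' :: nat set topology) f' z' n' L' U' W'. inter_model T' f' z' n' L' (fst x) U' W' Lam \<and>
    second_countable T' \<and> (\<forall>\<mu>. weak_haar ?T f \<mu> \<and> emeasure \<mu> ((\<Inter>i. O1 i \<inter> S) - (\<Union>i. K1 i)) = 0 \<longrightarrow> haar_null T' f' (W' - U'))"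
  proof (rule S.inter_model_second_countable[OF d0])
    show "compactin ?T (K i)" for i using S(4,5) by (auto simp: compactin_subtopology)
    show "(\<Union>i. K i) = topspace ?T" using S(5) tS by simp
    show "openin ?T (O1 i \<inter> S)" for i using OK(1) by (simp add: openin_subtopology_Int)
    show "W1 \<subseteq> O1 i \<inter> S" for i using OK(2) S(3) by blast
    show "compactin ?T (K1 i)" for i using OK(3) subset_trans[OF OK(4) subset_trans[OF UW1 S(3)]] by (simp add: compactin_subtopology)
  qed (rule OK OK1)+
  then obtain T1 :: "nat set topology" and f1 z1 n1 L1 U2 W2 where d1: "inter_model T1 f1 z1 n1 L1 (fst x) U2 W2 Lam"
    and sc1: "second_countable T1"
    and n1: "\<And>\<mu>. weak_haar ?T f \<mu> \<Longrightarrow> emeasure \<mu> ((\<Inter>i. O1 i \<inter> S) - (\<Union>i. K1 i)) = 0 \<Longrightarrow> haar_null T1 f1 (W2 - U2)" by blast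
  have n1': "haar_null T1 f1 (W2 - U2)" if nl: ?null
  proof -
    obtain \<mu> where mu: "weak_haar T f \<mu>" "emeasure \<mu> ((\<Inter>i. O1 i) - (\<Union>i. K1 i)) = 0" using OK2 nl by blast
    have m: "(\<Inter>i. O1 i) - (\<Union>i. K1 i) \<in> sets \<mu>" by (rule approximation_gap_sets[OF mu(1) OK(1,3)])
    \<comment> \<open>Intersecting the outer sets with \<open>S\<close> only shrinks the gap and
      places it inside \<open>S\<close>, where the restricted measure agrees with
      \<open>\<mu>\<close>.\<close>
    have "emeasure \<mu> ((\<Inter>i. O1 i \<inter> S) - (\<Union>i. K1 i)) \<le> emeasure \<mu> ((\<Inter>i. O1 i) - (\<Union>i. K1 i))"
      using m by (intro emeasure_mono) auto
    moreover have "(\<Inter>i. O1 i \<inter> S) - (\<Union>i. K1 i) \<subseteq> S" by blast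
    ultimately show ?thesis
      using n1[OF weak_haar_restrict(1)[OF S(1,2) mu(1)]] weak_haar_restrict(2)[OF S(1,2) mu(1)] mu(2) by simp
  qed
  obtain T2 :: "nat set topology" and f2 z2 n2 L2 U3 W3 where d2: "inter_model T2 f2 z2 n2 L2 0 U3 W3 Lam"
    and sc2: "second_countable T2" and n2: "haar_null T1 f1 (W2 - U2) \<Longrightarrow> haar_null T2 f2 (W3 - U3)"
    using inter_model_adjoin[OF d1 sc1] by blast
  have "\<exists>(T3 :: nat set topology) f3 z3 n3 L3 U4 W4. inter_model T3 f3 z3 n3 L3 0 U4 W4 Lam \<and> second_countable T3 \<and>
      (\<forall>p\<in>L3. \<forall>p'\<in>L3. snd p = snd p' \<longrightarrow> fst p = fst p') \<and> (haar_null T2 f2 (W3 - U3) \<longrightarrow> haar_null T3 f3 (W4 - U4))"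
  \<comment> \<open>Without a nonzero kernel element the star map is already injective, as
    differences of lattice points with equal star image lie in the kernel; the circle is added only
    in the other case.\<close>
  proof (cases "\<exists>\<kappa>. (\<kappa>, z2) \<in> L2 \<and> \<kappa> \<noteq> 0")
    case True
    then show ?thesis using inter_model_star_injective[OF d2 sc2] by blast
  next
    case False
    note C2 = cpsD[OF inter_modelD(1)[OF d2]]
    interpret T2: lca T2 f2 z2 n2 by (rule lca.intro[OF C2(1)])
    have "fst p = fst p'" if "p \<in> L2" "p' \<in> L2" "snd p = snd p'" for p p'
    proof -
      have "(fst p - fst p', z2) \<in> L2" using C2(11)[OF that(1,2)] that(3) C2(10)[OF that(2)] by simp
      then have "fst p - fst p' = 0" using False by blast
      then show ?thesis by simp
    qed
    then show ?thesis using d2 sc2 by blast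
  qed
  then obtain T3 :: "nat set topology" and f3 z3 n3 L3 U4 W4 where d3: "inter_model T3 f3 z3 n3 L3 0 U4 W4 Lam"
    and sc3: "second_countable T3" and st: "\<forall>p\<in>L3. \<forall>p'\<in>L3. snd p = snd p' \<longrightarrow> fst p = fst p'"
    and n3: "haar_null T2 f2 (W3 - U3) \<longrightarrow> haar_null T3 f3 (W4 - U4)" by blast
  obtain W' where "model_set_witness Lam T3 f3 z3 n3 L3 W'"
    "haar_null T3 f3 (W4 - U4) \<longrightarrow> (\<exists>\<mu>'. haar_measure T3 f3 \<mu>' \<and> emeasure \<mu>' (boundary_in T3 W') = 0)"
    using inter_model_imp_witness[OF d3 sc3] st by blast
  then show ?thesis using n1' n2 n3 by blast
qed

end
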